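(* Let $L,a>0$ and let $g$ satisfy the hypotheses stated in the context. If $a\ne 1$, then for any $0<\epsilon<2$ the energy decay rate $t^{-\frac{2}{2-\epsilon}}$ cannot be expected for every $U_0\in D(\mathcal{A}_G)$; that is, there is no constant $C>0$ such that $$E_G(t)\le \frac{C}{t^{\frac{2}{2-\epsilon}}}\,\|U_0\|_{D(\mathcal{A}_G)}^2\qquad\text{for all } t>0 \text{ and all } U_0\in D(\mathcal{A}_G),$$ where $E_G(t)$ is the energy of the solution of $U_t=\mathcal{A}_GU$, $U(0)=U_0$.
   Context: Hypotheses on $g$: $g\in L^1([0,\infty))\cap C^1([0,\infty))$ is a strictly positive function with $g(0)=:g_0>0$, $\int_0^\infty g(s)\,ds=:\widetilde g$, $\widetilde a:=a-\widetilde g>0$, and $g'(s)\le -m g(s)$ for some $m>0$ (for all $s\ge0$). Space (complex-valued functions): $\mathcal{H}_G=(H^1_0(0,L)\times L^2(0,L))^2\times L^2_g((0,\infty);H^1_0(0,L))$, where $L^2_g$ is the $L^2$ space with weight $g(s)\,ds$, with inner product $$(U,U^1)_{\mathcal{H}_G}=\int_0^L\big(\widetilde a\,u_x\overline{u^1_x}+v\overline{v^1}+y_x\overline{y^1_x}+z\overline{z^1}\big)dx+\int_0^L\int_0^\infty g(s)\,\omega_x(\cdot,s)\overline{\omega^1_x}(\cdot,s)\,ds\,dx$$ for $U=(u,v,y,z,\omega)$, $U^1=(u^1,v^1,y^1,z^1,\omega^1)$. The operator $\mathcal{A}_G:D(\mathcal{A}_G)\subset\mathcal{H}_G\to\mathcal{H}_G$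 has domain the set of $U=(u,v,y,z,\omega)\in\mathcal{H}_G$ with $y\in H^2(0,L)\cap H^1_0(0,L)$, $v,z\in H^1_0(0,L)$, $\big(\widetilde a u_x+\int_0^\infty g(s)\omega_x(\cdot,s)ds\big)_x\in L^2(0,L)$, $\omega_s(\cdot,s)\in L^2_g((0,\infty);H^1_0(0,L))$, $\omega(\cdot,0)=0$, and $$\mathcal{A}_G(u,v,y,z,\omega)=\Big(v,\;\big(\widetilde a u_x+\textstyle\int_0^\infty g(s)\omega_x(\cdot,s)ds\big)_x-z,\;z,\;y_{xx}+v,\;-\omega_s(\cdot,s)+v\Big).$$ This is the first-order form, with $U=(u,u_t,y,y_t,\omega)$ and $\omega(x,s,t)=u(x,t)-u(x,t-s)$, of the system $u_{tt}-au_{xx}+\int_0^\infty g(s)u_{xx}(x,t-s)ds+y_t=0$, $y_{tt}-y_{xx}-u_t=0$ on $(0,L)\times(0,\infty)$ with homogeneous Dirichlet conditions. $\|\cdot\|_{D(\mathcal{A}_G)}$ is the graph norm. The energy is $$E_G(t)=\frac12\int_0^L\big(|u_t|^2+\widetilde a|u_x|^2+|y_t|^2+|y_x|^2\big)dx+\frac12\int_0^L\int_0^\infty g(s)|\omega_x(\cdot,s,t)|^2ds\,dx.$$ *)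

theory Defs
  imports "HOL-Analysis.Analysis"
begin

text \<open>
  Elements of the function spaces are represented by functions, which are only meaningful up to
  equality almost everywhere. Derived objects that are unique only as equivalence classes (weak
  derivatives, Bochner integrals) are therefore selected with \<open>SOME\<close>; all norms below are
  independent of the selected representative. Differences of functions and of tuples of functions
  are the pointwise and componentwise differences of the library.
\<close>

section \<open>Sobolev spaces on the interval from 0 to L\<close>

text \<open>
  Test functions are the continuously differentiable functions with compact support in the open
  set \<open>I\<close>; \<open>C\<^sub>c\<^sup>\<infinity>\<close> test functions lead to the same weak derivatives and spaces.
\<close>

definition test_fun :: "real set \<Rightarrow> (real \<Rightarrow> complex) set" where
  "test_fun I = {\<phi>. \<phi> C1_differentiable_on UNIV \<and>
     (\<exists>K. compact K \<and> K \<subseteq> I \<and> (\<forall>x. x \<notin> K \<longrightarrow> \<phi> x = 0))}"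

definition L2 :: "real \<Rightarrow> (real \<Rightarrow> complex) set" where
  "L2 L = {f. f \<in> borel_measurable (lebesgue_on {0<..<L}) \<and>
     integrable (lebesgue_on {0<..<L}) (\<lambda>x. (cmod (f x))\<^sup>2)}"

definition L2_inner :: "real \<Rightarrow> (real \<Rightarrow> complex) \<Rightarrow> (real \<Rightarrow> complex) \<Rightarrow> complex" where
  "L2_inner L f h = (\<integral>x. f x * cnj (h x) \<partial>lebesgue_on {0<..<L})"

definition L2_norm :: "real \<Rightarrow> (real \<Rightarrow> complex) \<Rightarrow> real" where
  "L2_norm L f = sqrt (Re (L2_inner L f f))"

definition is_weak_deriv :: "real \<Rightarrow> (real \<Rightarrow> complex) \<Rightarrow> (real \<Rightarrow> complex) \<Rightarrow> bool" where
  "is_weak_deriv L f h \<longleftrightarrow>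
     (\<forall>\<phi>\<in>test_fun {0<..<L}.
        (\<integral>x. f x * vector_derivative \<phi> (at x) \<partial>lebesgue_on {0<..<L})
        = - (\<integral>x. h x * \<phi> x \<partial>lebesgue_on {0<..<L}))"

definition H1 :: "real \<Rightarrow> (real \<Rightarrow> complex) set" where
  "H1 L = {f \<in> L2 L. \<exists>h\<in>L2 L. is_weak_deriv L f h}"

definition weak_deriv :: "real \<Rightarrow> (real \<Rightarrow> complex) \<Rightarrow> (real \<Rightarrow> complex)" where
  "weak_deriv L f = (SOME h. h \<in> L2 L \<and> is_weak_deriv L f h)"

definition H1_norm :: "real \<Rightarrow> (real \<Rightarrow> complex) \<Rightarrow> real" where
  "H1_norm L f = sqrt ((L2_norm L f)\<^sup>2 + (L2_norm L (weak_deriv L f))\<^sup>2)"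

definition H10 :: "real \<Rightarrow> (real \<Rightarrow> complex) set" where
  "H10 L = {f \<in> H1 L. \<exists>\<phi>::nat \<Rightarrow> real \<Rightarrow> complex.
     (\<forall>n. \<phi> n \<in> test_fun {0<..<L}) \<and> (\<lambda>n. H1_norm L (f - \<phi> n)) \<longlonglongrightarrow> 0}"

definition H10_norm :: "real \<Rightarrow> (real \<Rightarrow> complex) \<Rightarrow> real" where
  "H10_norm L f = L2_norm L (weak_deriv L f)"

definition H2 :: "real \<Rightarrow> (real \<Rightarrow> complex) set" where
  "H2 L = {f \<in> H1 L. weak_deriv L f \<in> H1 L}"

section \<open>Bochner integration with values in a function space\<close>

text \<open>
  The library's Bochner integral needs the values to form a type of class \<open>banach\<close>, whereas the
  spaces above depend on the real number \<open>L\<close>. The following definitions copy the library's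
  for values in a set \<open>S\<close> of functions with (semi)norm \<open>N\<close>.
\<close>

definition bochner_measurable ::
  "(real \<Rightarrow> complex) set \<Rightarrow> ((real \<Rightarrow> complex) \<Rightarrow> real) \<Rightarrow> real measure \<Rightarrow> (real \<Rightarrow> real \<Rightarrow> complex) \<Rightarrow> bool"
where
  "bochner_measurable S N M F \<longleftrightarrow>
     (\<exists>\<sigma>::nat \<Rightarrow> real \<Rightarrow> real \<Rightarrow> complex.
        (\<forall>n. simple_function M (\<sigma> n) \<and> \<sigma> n ` space M \<subseteq> S) \<and>
        (AE s in M. (\<lambda>n. N (F s - \<sigma> n s)) \<longlonglongrightarrow> 0))"

definition simple_integral_fun :: "real measure \<Rightarrow> (real \<Rightarrow> real \<Rightarrow> complex) \<Rightarrow> (real \<Rightarrow> complex)" where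
  "simple_integral_fun M \<sigma> =
     (\<lambda>x. \<Sum>f\<in>\<sigma> ` space M. measure M {s \<in> space M. \<sigma> s = f} *\<^sub>R f x)"

definition has_bochner_fun ::
  "(real \<Rightarrow> complex) set \<Rightarrow> ((real \<Rightarrow> complex) \<Rightarrow> real) \<Rightarrow> real measure \<Rightarrow> (real \<Rightarrow> real \<Rightarrow> complex)
     \<Rightarrow> (real \<Rightarrow> complex) \<Rightarrow> bool"
where
  "has_bochner_fun S N M F P \<longleftrightarrow>
     (AE s in M. F s \<in> S) \<and> bochner_measurable S N M F \<and> P \<in> S \<and>
     (\<exists>\<sigma>::nat \<Rightarrow> real \<Rightarrow> real \<Rightarrow> complex.
        (\<forall>n. simple_function M (\<sigma> n) \<and> \<sigma> n ` space M \<subseteq> S \<and>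
             emeasure M {s \<in> space M. \<sigma> n s \<noteq> (\<lambda>_. 0)} \<noteq> \<infinity> \<and>
             integrable M (\<lambda>s. N (F s - \<sigma> n s))) \<and>
        (\<lambda>n. \<integral>s. N (F s - \<sigma> n s) \<partial>M) \<longlonglongrightarrow> 0 \<and>
        (\<lambda>n. N (P - simple_integral_fun M (\<sigma> n))) \<longlonglongrightarrow> 0)"

section \<open>The weighted history space\<close>

text \<open>
  A history is a function \<open>\<omega>\<close> with \<open>\<omega> s x\<close> standing for the \<open>\<omega>(x, s)\<close> of the
  mathematical notation, so that \<open>\<omega> s\<close> is an element of \<open>H10 L\<close> for almost every \<open>s > 0\<close>.
\<close>

definition weight_measure :: "(real \<Rightarrow> real) \<Rightarrow> real measure" where
  "weight_measure g = density (lebesgue_on {0<..}) (\<lambda>s. ennreal (g s))"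

definition L2g :: "real \<Rightarrow> (real \<Rightarrow> real) \<Rightarrow> (real \<Rightarrow> real \<Rightarrow> complex) set" where
  "L2g L g = {\<omega>. (AE s in weight_measure g. \<omega> s \<in> H10 L) \<and>
     bochner_measurable (H10 L) (H10_norm L) (weight_measure g) \<omega> \<and>
     integrable (weight_measure g) (\<lambda>s. (H10_norm L (\<omega> s))\<^sup>2)}"

text \<open>The element \<open>\<integral>\<^sub>0\<^sup>\<infinity> g(s) \<omega>\<^sub>x(\<cdot>, s) ds\<close> of \<open>L2 L\<close>.\<close>

definition memory_int :: "real \<Rightarrow> (real \<Rightarrow> real) \<Rightarrow> (real \<Rightarrow> real \<Rightarrow> complex) \<Rightarrow> (real \<Rightarrow> complex)" where
  "memory_int L g \<omega> =
     (SOME P. has_bochner_fun (L2 L) (L2_norm L) (weight_measure g) (\<lambda>s. weak_deriv L (\<omega> s)) P)"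

text \<open>
  \<open>\<integral> \<phi>' \<omega> ds = - \<integral> \<phi> \<eta> ds\<close> for all test functions \<open>\<phi>\<close> on \<open>s > 0\<close>, both integrals existing as
  Bochner integrals with values in \<open>H10 L\<close>.
\<close>

definition is_weak_ds :: "real \<Rightarrow> (real \<Rightarrow> real \<Rightarrow> complex) \<Rightarrow> (real \<Rightarrow> real \<Rightarrow> complex) \<Rightarrow> bool" where
  "is_weak_ds L \<omega> \<eta> \<longleftrightarrow>
     (\<forall>\<phi>\<in>test_fun {0<..}. \<exists>P.
        has_bochner_fun (H10 L) (H10_norm L) (lebesgue_on {0<..})
          (\<lambda>s x. vector_derivative \<phi> (at s) * \<omega> s x) P \<and>
        has_bochner_fun (H10 L) (H10_norm L) (lebesgue_on {0<..})
          (\<lambda>s x. \<phi> s * \<eta> s x) (- P))"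

definition weak_ds :: "real \<Rightarrow> (real \<Rightarrow> real) \<Rightarrow> (real \<Rightarrow> real \<Rightarrow> complex) \<Rightarrow> (real \<Rightarrow> real \<Rightarrow> complex)" where
  "weak_ds L g \<omega> = (SOME \<eta>. \<eta> \<in> L2g L g \<and> is_weak_ds L \<omega> \<eta>)"

text \<open>
  The condition \<open>\<omega>(\<cdot>, 0) = 0\<close> concerns the representative of \<open>\<omega>\<close> which is continuous on
  \<open>s \<ge> 0\<close> with values in \<open>H10 L\<close>.
\<close>

definition zero_trace :: "real \<Rightarrow> (real \<Rightarrow> real \<Rightarrow> complex) \<Rightarrow> bool" where
  "zero_trace L \<omega> \<longleftrightarrow>
     (\<exists>\<omega>'. (\<forall>s\<ge>0. \<omega>' s \<in> H10 L) \<and>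
        (\<forall>s\<ge>0. ((\<lambda>r. H10_norm L (\<omega>' r - \<omega>' s)) \<longlongrightarrow> 0) (at s within {0..})) \<and>
        (AE s in lebesgue_on {0<..}. \<omega> s \<in> H10 L \<and> H10_norm L (\<omega> s - \<omega>' s) = 0) \<and>
        H10_norm L (\<omega>' 0) = 0)"

section \<open>The energy space, the operator, and the evolution equation\<close>

type_synonym state =
  "(real \<Rightarrow> complex) \<times> (real \<Rightarrow> complex) \<times> (real \<Rightarrow> complex) \<times> (real \<Rightarrow> complex) \<times> (real \<Rightarrow> real \<Rightarrow> complex)"

definition a_tilde :: "real \<Rightarrow> (real \<Rightarrow> real) \<Rightarrow> real" where
  "a_tilde a g = a - (\<integral>s. g s \<partial>lebesgue_on {0..})"

definition HG :: "real \<Rightarrow> (real \<Rightarrow> real) \<Rightarrow> state set" where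
  "HG L g = H10 L \<times> L2 L \<times> H10 L \<times> L2 L \<times> L2g L g"

text \<open>
  In the last term the integration in \<open>x\<close> is the inner one: this is the inner product of
  \<open>\<omega>\<^sub>x\<close> and \<open>\<omega>\<^sup>1\<^sub>x\<close> as functions of \<open>s\<close> with values in \<open>L2 L\<close>.
\<close>

fun HG_inner :: "real \<Rightarrow> real \<Rightarrow> (real \<Rightarrow> real) \<Rightarrow> state \<Rightarrow> state \<Rightarrow> complex" where
  "HG_inner L a g (u, v, y, z, \<omega>) (u1, v1, y1, z1, \<omega>1) =
     of_real (a_tilde a g) * L2_inner L (weak_deriv L u) (weak_deriv L u1) + L2_inner L v v1
     + L2_inner L (weak_deriv L y) (weak_deriv L y1) + L2_inner L z z1
     + (\<integral>s. L2_inner L (weak_deriv L (\<omega> s)) (weak_deriv L (\<omega>1 s)) \<partial>weight_measure g)"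

definition HG_norm :: "real \<Rightarrow> real \<Rightarrow> (real \<Rightarrow> real) \<Rightarrow> state \<Rightarrow> real" where
  "HG_norm L a g U = sqrt (Re (HG_inner L a g U U))"

definition flux :: "real \<Rightarrow> real \<Rightarrow> (real \<Rightarrow> real) \<Rightarrow> (real \<Rightarrow> complex) \<Rightarrow> (real \<Rightarrow> real \<Rightarrow> complex) \<Rightarrow> (real \<Rightarrow> complex)" where
  "flux L a g u \<omega> = (\<lambda>x. of_real (a_tilde a g) * weak_deriv L u x + memory_int L g \<omega> x)"

definition D_AG :: "real \<Rightarrow> real \<Rightarrow> (real \<Rightarrow> real) \<Rightarrow> state set" where
  "D_AG L a g = {(u, v, y, z, \<omega>) \<in> HG L g.
     y \<in> H2 L \<inter> H10 L \<and> v \<in> H10 L \<and> z \<in> H10 L \<and> flux L a g u \<omega> \<in> H1 L \<and>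
     (\<exists>\<eta>\<in>L2g L g. is_weak_ds L \<omega> \<eta>) \<and> zero_trace L \<omega>}"

fun AG :: "real \<Rightarrow> real \<Rightarrow> (real \<Rightarrow> real) \<Rightarrow> state \<Rightarrow> state" where
  "AG L a g (u, v, y, z, \<omega>) =
     (v,
      (\<lambda>x. weak_deriv L (flux L a g u \<omega>) x - z x),
      z,
      (\<lambda>x. weak_deriv L (weak_deriv L y) x + v x),
      (\<lambda>s x. - weak_ds L g \<omega> s x + v x))"

definition graph_norm :: "real \<Rightarrow> real \<Rightarrow> (real \<Rightarrow> real) \<Rightarrow> state \<Rightarrow> real" where
  "graph_norm L a g U = HG_norm L a g U + HG_norm L a g (AG L a g U)"

fun scale_state :: "real \<Rightarrow> state \<Rightarrow> state" where
  "scale_state c (u, v, y, z, \<omega>) =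
     ((\<lambda>x. c *\<^sub>R u x), (\<lambda>x. c *\<^sub>R v x), (\<lambda>x. c *\<^sub>R y x), (\<lambda>x. c *\<^sub>R z x), (\<lambda>s x. c *\<^sub>R \<omega> s x))"

text \<open>
  Classical solutions on \<open>t \<ge> 0\<close>: \<open>U\<close> has values in the domain, is continuously differentiable
  with values in the energy space, and satisfies \<open>U' = AG U\<close> and \<open>U 0 = U0\<close>.
  \<open>AG\<close> generates a contraction semigroup, so every \<open>U0\<close> in the domain has exactly one such
  solution, up to equality in the energy space.
\<close>

definition is_solution :: "real \<Rightarrow> real \<Rightarrow> (real \<Rightarrow> real) \<Rightarrow> state \<Rightarrow> (real \<Rightarrow> state) \<Rightarrow> bool" where
  "is_solution L a g U0 U \<longleftrightarrow>
     U 0 = U0 \<and> (\<forall>t\<ge>0. U t \<in> D_AG L a g) \<and>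
     (\<forall>t\<ge>0. ((\<lambda>r. HG_norm L a g (scale_state (1 / (r - t)) (U r - U t) - AG L a g (U t)))
              \<longlongrightarrow> 0) (at t within {0..})) \<and>
     (\<forall>t\<ge>0. ((\<lambda>r. HG_norm L a g (AG L a g (U r) - AG L a g (U t))) \<longlongrightarrow> 0) (at t within {0..}))"

text \<open>
  The energy of a solution at time \<open>t\<close> is the value of the following function at
  \<open>U t = (u, u\<^sub>t, y, y\<^sub>t, \<omega>)\<close>.
\<close>

fun energy :: "real \<Rightarrow> real \<Rightarrow> (real \<Rightarrow> real) \<Rightarrow> state \<Rightarrow> real" where
  "energy L a g (u, v, y, z, \<omega>) =
     1/2 * (\<integral>x. (cmod (v x))\<^sup>2 + a_tilde a g * (cmod (weak_deriv L u x))\<^sup>2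
               + (cmod (z x))\<^sup>2 + (cmod (weak_deriv L y x))\<^sup>2 \<partial>lebesgue_on {0<..<L})
     + 1/2 * (\<integral>s. (\<integral>x. (cmod (weak_deriv L (\<omega> s) x))\<^sup>2 \<partial>lebesgue_on {0<..<L}) \<partial>weight_measure g)"

end

theory Submission
  imports Defs
begin

text \<open>
  The modes \<open>sin (\<mu> x)\<close> with \<open>\<mu> = n \<pi> / L\<close> decouple the system: it has the exponential solution
  \<open>u = \<alpha> e\<^sup>z\<^sup>t sin (\<mu> x)\<close>, \<open>y = e\<^sup>z\<^sup>t sin (\<mu> x)\<close>, \<open>\<omega> = \<alpha> (1 - e\<^sup>-\<^sup>z\<^sup>s) e\<^sup>z\<^sup>t sin (\<mu> x)\<close> as soon as
  \<open>(z\<^sup>2 + \<mu>\<^sup>2 (a - G z)) (z\<^sup>2 + \<mu>\<^sup>2) = - z\<^sup>2\<close>, where \<open>G\<close> is the Laplace transform of \<open>g\<close>.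
  In the unknown \<open>w = z\<^sup>2 + \<mu>\<^sup>2\<close> this is a fixed point equation of the form
  \<open>w = 1 / (a - 1) + O(1 / \<mu>)\<close>, which Brouwer's theorem solves because \<open>G z = O(1 / z)\<close>. As
  \<open>1 / (a - 1)\<close> is real, \<open>Im w = O(1 / \<mu>)\<close> and so \<open>Re z = O(1 / \<mu>\<^sup>2)\<close>: up to the time \<open>t = \<mu>\<^sup>2\<close> the
  energy loses only a bounded factor, while the squared graph norm of the data is \<open>O(\<mu>\<^sup>2)\<close> times
  the initial energy. A rate \<open>t\<^sup>-\<^sup>p\<close> with \<open>p > 1\<close> is therefore impossible.
\<close>

section \<open>Test functions and the fundamental lemma\<close>

text \<open>The number 1 / (a - 1) is where the unequal wave speeds enter. The root z lies near i
  \<mu>, a frequency of the undamped y-wave. The memory acts only on u, whose principal symbol at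
  that frequency is \<mu>^2 (a - 1), so y feels the damping only through the zero-order coupling;
  for a = 1 both waves would resonate. At t = \<mu>^2 the energy is at least a constant times 1 / t
  times the squared graph norm, and 2 / (2 - \<epsilon>) > 1 for every \<epsilon> in (0, 2).

  The refuted estimate ranges over all solutions, so every exponential solution supplies an instance
  of it. What makes the verification long is that weak derivatives, the memory integral and
  \<open>weak_ds\<close> are arbitrary choices among representatives: the explicit formulas have to
  hold for every possible choice, up to null sets. The identities are therefore tested with
  countably many scalar functionals, which reduces them to uniqueness statements for scalar
  functions on a line.\<close>

lemma test_funI:
  assumes "\<And>x. (\<phi> has_vector_derivative \<phi>' x) (at x)" "continuous_on UNIV \<phi>'"
    "compact K" "K \<subseteq> I" "\<And>x. x \<notin> K \<Longrightarrow> \<phi> x = 0"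
  shows "\<phi> \<in> test_fun I"
  using assms unfolding test_fun_def C1_differentiable_on_def by blast

lemma test_funE:
  assumes "\<phi> \<in> test_fun I"
  obtains \<phi>' K where "\<And>x. (\<phi> has_vector_derivative \<phi>' x) (at x)" "continuous_on UNIV \<phi>'"
    "compact K" "K \<subseteq> I" "\<And>x. x \<notin> K \<Longrightarrow> \<phi> x = 0" "\<And>x. x \<notin> K \<Longrightarrow> \<phi>' x = 0"
proof -
  from assms obtain \<phi>' K where D: "\<And>x. (\<phi> has_vector_derivative \<phi>' x) (at x)" "continuous_on UNIV \<phi>'"
    "compact K" "K \<subseteq> I" "\<And>x. x \<notin> K \<Longrightarrow> \<phi> x = 0"
    unfolding test_fun_def C1_differentiable_on_def by blast
  have "\<phi>' x = 0" if "x \<notin> K" for x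
  proof -
    have "open (- K)" using compact_imp_closed[OF D(3)] by auto
    have "((\<lambda>_. 0) has_vector_derivative \<phi>' x) (at x)"
      by (rule has_vector_derivative_transform_within_open[OF D(1) \<open>open (-K)\<close>]) (use that D(5) in auto)
    then show ?thesis using vector_derivative_at[of "\<lambda>_. 0" "\<phi>' x" x] by simp
  qed
  with D that show ?thesis by blast
qed

text \<open>\<open>I\<close> may be unbounded, as for the history variable. Off \<open>K\<close> the
  integrand is 0, so the indicators of \<open>I\<close> and of \<open>{a..b}\<close> give the same
  product, and on the closed interval continuity yields integrability and agreement with the gauge
  integral.\<close>

lemma has_bochner_integral_compact_support:
  fixes k :: "real \<Rightarrow> complex"
  assumes k: "continuous_on UNIV k" and supp: "\<And>x. x \<notin> K \<Longrightarrow> k x = 0"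
    and K: "K \<subseteq> I" "K \<subseteq> {a..b}" and I: "I \<in> sets lebesgue"
  shows "has_bochner_integral (lebesgue_on I) k (integral {a..b} k)"
proof -
  have eq: "(\<lambda>x. indicator I x *\<^sub>R k x) = (\<lambda>x. indicator {a..b} x *\<^sub>R k x)"
    using K supp by (force simp: indicator_def fun_eq_iff)
  have int: "integrable (lebesgue_on {a..b}) k"
    using continuous_imp_integrable[of a b k] k continuous_on_subset by (metis box_real(2) subset_UNIV)
  have "has_bochner_integral (lebesgue_on {a..b}) k (integral {a..b} k)"
    using int lebesgue_integral_eq_integral[OF int] by (simp add: has_bochner_integral_iff)
  then show ?thesis using I
    by (simp add: has_bochner_integral_restrict_space eq)
qed

text \<open>Integration by parts in a form that serves both x in (0, L) and s in (0, infinity). As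
  \<open>f\<close> is C1 on the whole line, the product can be integrated over any interval
  containing the support, and the boundary terms vanish.\<close>

lemma compact_support_parts:
  assumes \<phi>: "\<phi> \<in> test_fun I" and I: "I \<in> sets lebesgue"
    and f: "\<And>x. (f has_vector_derivative f' x) (at x)" "continuous_on UNIV f'"
  shows "integrable (lebesgue_on I) (\<lambda>x. f x * vector_derivative \<phi> (at x))"
    and "integrable (lebesgue_on I) (\<lambda>x. f' x * \<phi> x)"
    and "(\<integral>x. f x * vector_derivative \<phi> (at x) \<partial>lebesgue_on I) = - (\<integral>x. f' x * \<phi> x \<partial>lebesgue_on I)"
proof -
  obtain \<phi>' K where D: "\<And>x. (\<phi> has_vector_derivative \<phi>' x) (at x)" "continuous_on UNIV \<phi>'"
    "compact K" "K \<subseteq> I" "\<And>x. x \<notin> K \<Longrightarrow> \<phi> x = 0" "\<And>x. x \<notin> K \<Longrightarrow> \<phi>' x = 0"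
    using test_funE[OF \<phi>] by metis
  \<comment> \<open>The strict bound keeps both end points -r and r outside \<open>K\<close>, which
    is what removes the boundary terms.\<close>
  obtain r where r: "r > 0" "\<And>x. x \<in> K \<Longrightarrow> norm x < r"
    using compact_imp_bounded[OF D(3)] bounded_pos_less by metis
  then have K: "K \<subseteq> {-r..r}" and r': "r \<notin> K" "-r \<notin> K" by fastforce+
  have vd: "vector_derivative \<phi> (at x) = \<phi>' x" for x
    using D(1) vector_derivative_at by blast
  have cf: "continuous_on UNIV f" "continuous_on UNIV \<phi>"
    using f(1) D(1) by (meson continuous_at_imp_continuous_on has_vector_derivative_continuous)+
  have 1: "has_bochner_integral (lebesgue_on I) (\<lambda>x. f x * \<phi>' x) (integral {-r..r} (\<lambda>x. f x * \<phi>' x))"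
    by (rule has_bochner_integral_compact_support[OF _ _ D(4) K I]) (use cf D f in \<open>auto intro!: continuous_intros\<close>)
  have 2: "has_bochner_integral (lebesgue_on I) (\<lambda>x. f' x * \<phi> x) (integral {-r..r} (\<lambda>x. f' x * \<phi> x))"
    by (rule has_bochner_integral_compact_support[OF _ _ D(4) K I]) (use cf D f in \<open>auto intro!: continuous_intros\<close>)
  have "((\<lambda>x. f x * \<phi>' x + f' x * \<phi> x) has_integral (f r * \<phi> r - f (-r) * \<phi> (-r))) {-r..r}"
    by (rule fundamental_theorem_of_calculus)
      (use r f D in \<open>auto intro!: has_vector_derivative_mult intro: has_vector_derivative_at_within\<close>)
  then have "integral {-r..r} (\<lambda>x. f x * \<phi>' x + f' x * \<phi> x) = 0"
    using D(5) r' by (simp add: integral_unique)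
  moreover have "(\<lambda>x. f x * \<phi>' x) integrable_on {-r..r}" "(\<lambda>x. f' x * \<phi> x) integrable_on {-r..r}"
    by (rule integrable_continuous_real; use cf D(2) f(2) continuous_on_subset[OF _ subset_UNIV] in \<open>intro continuous_on_mult; blast\<close>)+
  ultimately have "integral {-r..r} (\<lambda>x. f x * \<phi>' x) = - integral {-r..r} (\<lambda>x. f' x * \<phi> x)"
    by (simp add: Henstock_Kurzweil_Integration.integral_add eq_neg_iff_add_eq_0)
  with 1 2 show "integrable (lebesgue_on I) (\<lambda>x. f x * vector_derivative \<phi> (at x))"
    "integrable (lebesgue_on I) (\<lambda>x. f' x * \<phi> x)"
    "(\<integral>x. f x * vector_derivative \<phi> (at x) \<partial>lebesgue_on I) = - (\<integral>x. f' x * \<phi> x \<partial>lebesgue_on I)"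
    unfolding vd by (auto simp: has_bochner_integral_iff)
qed

text \<open>A C1 switch from 0 to 1: squaring the positive part makes the derivative continuous at
  0, which is the regularity asked of test functions. The rational profile keeps the derivative
  explicit, and 1 - ramp t = 1 / (t^2 + 1) for t > 0 is what later absorbs the growth of the cut-off
  derivatives.\<close>

definition ramp :: "real \<Rightarrow> real" where
  "ramp t = (max 0 t)\<^sup>2 / ((max 0 t)\<^sup>2 + 1)"

definition ramp' :: "real \<Rightarrow> real" where
  "ramp' t = 2 * max 0 t / ((max 0 t)\<^sup>2 + 1)\<^sup>2"

text \<open>At the origin the difference quotient is at most |h| in modulus; elsewhere the function
  agrees locally with t^2 or with 0.\<close>

lemma max_power2_deriv: "((\<lambda>t::real. (max 0 t)\<^sup>2) has_real_derivative 2 * max 0 t) (at t)"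
proof (cases "t = 0")
  case True
  have "((\<lambda>h. (max 0 (0 + h))\<^sup>2 / h) \<longlongrightarrow> 0) (at (0::real))"
  proof (rule Lim_null_comparison[where g="\<lambda>h. \<bar>h\<bar>"])
    show "\<forall>\<^sub>F x in at (0::real). norm ((max 0 (0 + x))\<^sup>2 / x) \<le> \<bar>x\<bar>"
      by (auto simp: eventually_at_filter power2_eq_square max_def)
    show "((\<lambda>h. \<bar>h\<bar>) \<longlongrightarrow> 0) (at (0::real))"
      by (rule tendsto_rabs_zero) (simp add: tendsto_ident_at)
  qed
  then show ?thesis using True by (simp add: DERIV_def)
next
  case False
  then consider "t > 0" | "t < 0" by linarith
  then show ?thesis
  proof cases
    case 1
    have "((\<lambda>t::real. t\<^sup>2) has_real_derivative 2 * t) (at t)"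
      by (auto intro!: derivative_eq_intros)
    then have "((\<lambda>t::real. (max 0 t)\<^sup>2) has_real_derivative 2 * t) (at t)"
      by (rule has_field_derivative_transform_within_open[of _ _ _ "{0<..}"]) (use 1 in auto)
    with 1 show ?thesis by simp
  next
    case 2
    have "((\<lambda>t::real. 0) has_real_derivative 0) (at t)" by simp
    then have "((\<lambda>t::real. (max 0 t)\<^sup>2) has_real_derivative 0) (at t)"
      by (rule has_field_derivative_transform_within_open[of _ _ _ "{..<0}"]) (use 2 in auto)
    with 2 show ?thesis by simp
  qed
qed

lemma ramp_denom: "(max 0 t)\<^sup>2 + 1 > (0::real)"
  by (simp add: add_nonneg_pos)

lemma ramp_deriv [derivative_intros]:
  assumes "(f has_real_derivative f') (at x within S)"
  shows "((\<lambda>x. ramp (f x)) has_real_derivative ramp' (f x) * f') (at x within S)"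
proof -
  have "(ramp has_real_derivative ramp' t) (at t)" for t
  proof -
    have "((\<lambda>t. (max 0 t)\<^sup>2 + 1) has_real_derivative 2 * max 0 t) (at t)"
      using DERIV_add[OF max_power2_deriv[of t] DERIV_const[of 1]] by simp
    from DERIV_quotient[OF max_power2_deriv this] ramp_denom[of t] show ?thesis
      unfolding ramp_def[abs_def] ramp'_def
      by (simp add: algebra_simps numeral_2_eq_2)
  qed
  then show ?thesis
    using DERIV_chain2[OF _ assms] by blast
qed

lemma continuous_on_ramp' [continuous_intros]: "continuous_on S f \<Longrightarrow> continuous_on S (\<lambda>x. ramp' (f x))"
  unfolding ramp'_def using ramp_denom
  by (intro continuous_intros continuous_on_max) (auto simp: less_imp_neq[symmetric])

lemma ramp_nonpos: "t \<le> 0 \<Longrightarrow> ramp t = 0" "t \<le> 0 \<Longrightarrow> ramp' t = 0"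
  by (auto simp: ramp_def ramp'_def)

lemma ramp_bounds: "0 \<le> ramp t" "ramp t \<le> 1"
  using ramp_denom[of t] by (auto simp: ramp_def)

lemma ramp_pos: "0 < t \<Longrightarrow> 0 < ramp t"
  using ramp_denom[of t] by (simp add: ramp_def)

lemma ramp_tendsto:
  assumes "t > 0" shows "(\<lambda>k. ramp (real k * t - c)) \<longlonglongrightarrow> 1"
proof -
  have "filterlim (\<lambda>k. real k * t) at_top sequentially"
    using filterlim_tendsto_pos_mult_at_top[OF tendsto_const assms filterlim_real_sequentially]
    by (simp add: mult.commute)
  then have 1: "filterlim (\<lambda>k. real k * t - c) at_top sequentially"
    using filterlim_tendsto_add_at_top[OF tendsto_const[of "-c"]] by fastforce
  have "((\<lambda>s. 1 - ramp s) \<longlongrightarrow> 0) at_top"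
  proof (rule Lim_null_comparison)
    show "\<forall>\<^sub>F s in at_top. norm (1 - ramp s) \<le> inverse s"
    proof (rule eventually_at_top_linorderI[of 1])
      fix s :: real assume "1 \<le> s"
      then have "1 - ramp s = 1 / (s\<^sup>2 + 1)" by (simp add: ramp_def field_simps add_nonneg_eq_0_iff)
      moreover have "s \<le> s\<^sup>2" using \<open>1 \<le> s\<close> by (simp add: power2_eq_square)
      moreover have "1 / (s\<^sup>2 + 1) \<le> 1 / s"
        using \<open>s \<le> s\<^sup>2\<close> \<open>1 \<le> s\<close> by (intro divide_left_mono) (auto intro: mult_pos_pos add_pos_nonneg)
      ultimately show "norm (1 - ramp s) \<le> inverse s" by (simp add: inverse_eq_divide)
    qed
    show "((\<lambda>s::real. inverse s) \<longlongrightarrow> 0) at_top"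
      by (rule tendsto_inverse_0_at_top[OF filterlim_ident])
  qed
  then have "((\<lambda>s. 1 - (1 - ramp s)) \<longlongrightarrow> 1 - 0) at_top" by (intro tendsto_intros)
  then have "(ramp \<longlongrightarrow> 1) at_top" by simp
  from filterlim_compose[OF this 1] show ?thesis .
qed

text \<open>The quadratic (x - c) (d - x) is positive exactly inside (c, d), so for k > 0 composing
  with \<open>ramp\<close> gives a bump that is positive there and supported in the closed
  interval.\<close>

lemma bump_test_fun:
  assumes "{c..d} \<subseteq> I" "0 \<le> k" "c \<le> d"
  shows "(\<lambda>x. complex_of_real (ramp (k * ((x - c) * (d - x))))) \<in> test_fun I"
proof (rule test_funI[OF _ _ _ assms(1)])
  show "((\<lambda>x. complex_of_real (ramp (k * ((x - c) * (d - x))))) has_vector_derivative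
     of_real (ramp' (k * ((x - c) * (d - x))) * (k * ((d - x) - (x - c))))) (at x)" for x
    by (intro has_vector_derivative_of_real) (auto intro!: derivative_eq_intros)
  show "continuous_on UNIV (\<lambda>x. complex_of_real (ramp' (k * ((x - c) * (d - x))) * (k * ((d - x) - (x - c)))))"
    by (intro continuous_intros)
  show "complex_of_real (ramp (k * ((x - c) * (d - x)))) = 0" if "x \<notin> {c..d}" for x
  proof -
    have "(x - c) * (d - x) \<le> 0" using that assms(3) by (auto simp: mult_le_0_iff)
    then show ?thesis using assms(2) by (simp add: ramp_nonpos mult_nonneg_nonpos)
  qed
qed auto

text \<open>A complex density is determined by its integrals over an intersection-stable generator.
  Rational half-lines are enough, so countably many numbers decide whether an integrable function
  vanishes; this later permits exchanging "for every functional" with "for almost every s".\<close>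

lemma AE_zero_if_halfline_integrals_zero:
  fixes h :: "real \<Rightarrow> complex"
  assumes h: "integrable lebesgue h"
    and zero_rat: "\<And>a. a \<in> \<rat> \<Longrightarrow> (\<integral>x. indicator {..<a} x *\<^sub>R h x \<partial>lebesgue) = 0"
  shows "AE x in lebesgue. h x = 0"
proof -
  \<comment> \<open>Rational end points tending to \<open>a\<close> from below, with dominated
    convergence, extend the hypothesis to all real half-lines.\<close>
  have zero: "(\<integral>x. indicator {..<a} x *\<^sub>R h x \<partial>lebesgue) = 0" for a
  proof -
    have "\<exists>q\<in>\<rat>. a - inverse (real (Suc n)) < q \<and> q < a" for n
      using Rats_dense_in_real[of "a - inverse (real (Suc n))" a] by auto
    then obtain q where q: "\<And>n. q n \<in> \<rat>" "\<And>n. a - inverse (real (Suc n)) < q n" "\<And>n. q n < a"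
      by metis
    have "(\<lambda>n. a - inverse (real (Suc n))) \<longlonglongrightarrow> a - 0"
      by (intro tendsto_intros LIMSEQ_inverse_real_of_nat)
    then have lim: "q \<longlonglongrightarrow> a"
      using q(2,3) by (intro real_tendsto_sandwich[of "\<lambda>n. a - inverse (real (Suc n))" q sequentially "\<lambda>_. a"])
        (auto simp: less_imp_le)
    have "(\<lambda>n. \<integral>x. indicator {..<q n} x *\<^sub>R h x \<partial>lebesgue) \<longlonglongrightarrow> (\<integral>x. indicator {..<a} x *\<^sub>R h x \<partial>lebesgue)"
    proof (rule integral_dominated_convergence[where w="\<lambda>x. norm (h x)"])
      show "AE x in lebesgue. (\<lambda>n. indicat_real {..<q n} x *\<^sub>R h x) \<longlonglongrightarrow> indicat_real {..<a} x *\<^sub>R h x"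
      proof (rule AE_I2)
        fix x :: real
        show "(\<lambda>n. indicat_real {..<q n} x *\<^sub>R h x) \<longlonglongrightarrow> indicat_real {..<a} x *\<^sub>R h x"
        proof (cases "x < a")
          case True
          then have "\<forall>\<^sub>F n in sequentially. x < q n" using lim by (simp add: order_tendstoD)
          then have "\<forall>\<^sub>F n in sequentially. indicat_real {..<q n} x *\<^sub>R h x = indicat_real {..<a} x *\<^sub>R h x"
            by eventually_elim (use True in simp)
          then show ?thesis by (rule tendsto_eventually)
        next
          case False
          then have "\<not> x < q n" for n using q(3)[of n] by linarith
          then show ?thesis using False by simp
        qed
      qed
    qed (use h in \<open>auto intro!: borel_measurable_scaleR borel_measurable_indicator split: split_indicator\<close>)
    then show ?thesis using zero_rat[OF q(1)] by (simp add: LIMSEQ_const_iff)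
  qed
  have sint: "set_integrable lebesgue B h" if "B \<in> sets lebesgue" for B
    using h that by (simp add: set_integrable_def integrable_mult_indicator)
  \<comment> \<open>The integral over the whole line is needed for the complement step of the
    induction over Borel sets.\<close>
  have total: "(\<integral>x. h x \<partial>lebesgue) = 0"
  proof -
    have "(\<lambda>n. \<integral>x. indicator {..<real n} x *\<^sub>R h x \<partial>lebesgue) \<longlonglongrightarrow> (\<integral>x. h x \<partial>lebesgue)"
    proof (rule integral_dominated_convergence[where w="\<lambda>x. norm (h x)"])
      show "AE x in lebesgue. (\<lambda>n. indicat_real {..<real n} x *\<^sub>R h x) \<longlonglongrightarrow> h x"
      proof (rule AE_I2)
        fix x :: real
        obtain N where N: "x < real N" using reals_Archimedean2 by blast
        show "(\<lambda>n. indicat_real {..<real n} x *\<^sub>R h x) \<longlonglongrightarrow> h x"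
          by (rule tendsto_eventually, rule eventually_sequentiallyI[of N])
            (use N in \<open>auto simp: indicator_def\<close>)
      qed
    qed (use h in \<open>auto intro!: borel_measurable_scaleR borel_measurable_indicator split: split_indicator\<close>)
    then show ?thesis using zero LIMSEQ_unique by (simp add: LIMSEQ_const_iff)
  qed
  \<comment> \<open>Half-lines form an intersection-stable generator, and the sets with vanishing
    integral are closed under complements and countable disjoint unions.\<close>
  have borel: "set_lebesgue_integral lebesgue B h = 0" if "B \<in> sets borel" for B
  proof -
    have I: "Int_stable (range (lessThan :: real \<Rightarrow> _))"
    proof (rule Int_stableI, safe)
      fix a b :: real
      have "{..<a} \<inter> {..<b} = {..<min a b}" by auto
      then show "{..<a} \<inter> {..<b} \<in> range lessThan" by simp
    qed
    have P: "range (lessThan :: real \<Rightarrow> _) \<subseteq> Pow UNIV" by simp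
    have "B \<in> sigma_sets UNIV (range lessThan)"
      using that by (simp add: borel_Iio)
    from I P this show ?thesis
    proof (induction rule: sigma_sets_induct_disjoint)
      case (basic A) then show ?case using zero by (auto simp: set_lebesgue_integral_def)
    next
      case empty then show ?case by (simp add: set_lebesgue_integral_def)
    next
      case (compl A)
      then have "A \<in> sets borel" by (simp add: borel_Iio)
      then have A: "A \<in> sets lebesgue" by simp
      have "set_lebesgue_integral lebesgue (UNIV - A) h = (\<integral>x. h x - indicator A x *\<^sub>R h x \<partial>lebesgue)"
        unfolding set_lebesgue_integral_def by (rule Bochner_Integration.integral_cong) (auto simp: indicator_def)
      also have "\<dots> = 0"
        using h sint[OF A] compl total by (simp add: set_integrable_def set_lebesgue_integral_def)
      finally show ?case .
    next
      case (union A)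
      then have "A i \<in> sets borel" for i by (auto simp: borel_Iio)
      then have A: "A i \<in> sets lebesgue" for i by simp
      have "set_lebesgue_integral lebesgue (\<Union>i. A i) h = (\<Sum>i. set_lebesgue_integral lebesgue (A i) h)"
        using A union(1) by (intro lebesgue_integral_countable_add sint) (auto simp: disjoint_family_on_def)
      then show ?case using union by simp
    qed
  qed
  have all: "set_lebesgue_integral lebesgue A h = 0" if A: "A \<in> sets lebesgue" for A
  proof -
    obtain B N where BN: "B \<in> sets borel" "N \<in> null_sets lebesgue" "B \<union> N = A"
      using sets_lebesgue_almost_borel[OF A] by (auto simp: negligible_iff_null_sets)
    have "set_lebesgue_integral lebesgue A h = set_lebesgue_integral lebesgue B h"
      unfolding set_lebesgue_integral_def
    proof (rule integral_cong_AE)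
      show "AE x in lebesgue. indicat_real A x *\<^sub>R h x = indicat_real B x *\<^sub>R h x"
        using AE_not_in[OF BN(2)] by eventually_elim (use BN(3) in \<open>auto simp: indicator_def\<close>)
    qed (use h A BN(1) in \<open>auto intro!: borel_measurable_scaleR borel_measurable_indicator\<close>)
    then show ?thesis using borel[OF BN(1)] by simp
  qed
  have "AE x in lebesgue. Re (h x) = 0"
  proof (rule density_unique_real[where f'="\<lambda>_. 0"])
    fix A :: "real set" assume A: "A \<in> sets lebesgue"
    have "(\<integral>x. Re (indicator A x *\<^sub>R h x) \<partial>lebesgue) = Re (set_lebesgue_integral lebesgue A h)"
      using sint[OF A] by (simp add: set_lebesgue_integral_def set_integrable_def del: scaleR_complex.sel)
    then show "(LINT x:A|lebesgue. Re (h x)) = (LINT x:A|lebesgue. 0)"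
      using all[OF A] by (simp add: set_lebesgue_integral_def)
  qed (use h in auto)
  moreover have "AE x in lebesgue. Im (h x) = 0"
  proof (rule density_unique_real[where f'="\<lambda>_. 0"])
    fix A :: "real set" assume A: "A \<in> sets lebesgue"
    have "(\<integral>x. Im (indicator A x *\<^sub>R h x) \<partial>lebesgue) = Im (set_lebesgue_integral lebesgue A h)"
      using sint[OF A] by (simp add: set_lebesgue_integral_def set_integrable_def del: scaleR_complex.sel)
    then show "(LINT x:A|lebesgue. Im (h x)) = (LINT x:A|lebesgue. 0)"
      using all[OF A] by (simp add: set_lebesgue_integral_def)
  qed (use h in auto)
  ultimately show ?thesis by eventually_elim (simp add: complex_eq_iff)
qed

lemma C1_test_fun_mult:
  assumes "\<phi> \<in> test_fun I" and f: "\<And>x. (f has_vector_derivative f' x) (at x)" "continuous_on UNIV f'"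
  shows "(\<lambda>x. f x * \<phi> x) \<in> test_fun I"
proof -
  obtain \<phi>' K where D: "\<And>x. (\<phi> has_vector_derivative \<phi>' x) (at x)" "continuous_on UNIV \<phi>'"
    "compact K" "K \<subseteq> I" "\<And>x. x \<notin> K \<Longrightarrow> \<phi> x = 0" "\<And>x. x \<notin> K \<Longrightarrow> \<phi>' x = 0"
    using test_funE[OF assms(1)] by metis
  have cf: "continuous_on UNIV f" "continuous_on UNIV \<phi>"
    using f(1) D(1) by (meson continuous_at_imp_continuous_on has_vector_derivative_continuous)+
  show ?thesis
    by (rule test_funI[OF has_vector_derivative_mult[OF f(1) D(1)] _ D(3,4)])
      (use cf D f in \<open>auto intro!: continuous_intros\<close>)
qed

text \<open>Multiplying by a bump makes \<open>h\<close> integrable on the whole line. Half-line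
  indicators are limits of C1 ramps whose products with the bump are again test functions, so all
  half-line integrals of the product vanish, and \<open>h\<close> is 0 almost everywhere where the
  bump is positive.\<close>

lemma fundamental_lemma:
  fixes h :: "real \<Rightarrow> complex"
  assumes I: "open I" and meas: "h \<in> borel_measurable (lebesgue_on I)"
    and int: "\<And>\<phi>. \<phi> \<in> test_fun I \<Longrightarrow> integrable (lebesgue_on I) (\<lambda>x. h x * \<phi> x)"
    and zero: "\<And>\<phi>. \<phi> \<in> test_fun I \<Longrightarrow> (\<integral>x. h x * \<phi> x \<partial>lebesgue_on I) = 0"
  shows "AE x in lebesgue_on I. h x = 0"
proof -
  have Is: "I \<inter> space lebesgue \<in> sets lebesgue" using I by auto
  have local: "AE x in lebesgue. x \<in> {c<..<d} \<longrightarrow> h x = 0" if cd: "{c..d} \<subseteq> I" "c \<le> d" for c d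
  proof -
    define b where "b x = complex_of_real (ramp (1 * ((x - c) * (d - x))))" for x
    have b: "b \<in> test_fun I" unfolding b_def by (rule bump_test_fun[OF cd(1) _ cd(2)]) simp
    define h1 where "h1 x = indicator I x *\<^sub>R (h x * b x)" for x
    have h1: "integrable lebesgue h1"
      using int[OF b] by (simp add: integrable_restrict_space[OF Is] h1_def[abs_def])
    have "AE x in lebesgue. h1 x = 0"
    proof (rule AE_zero_if_halfline_integrals_zero[OF h1])
      fix a :: real
      \<comment> \<open>These ramps lie in [0, 1], vanish for x \<ge> a and tend to 1 for x < a as k
        grows; the subtracted 0 matches the form of \<open>ramp_tendsto\<close>.\<close>
      define e where "e k x = complex_of_real (ramp (real k * (a - x) - 0))" for k x
      have e: "(\<lambda>x. e k x * b x) \<in> test_fun I" for k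
      proof (rule C1_test_fun_mult[OF b])
        show "(e k has_vector_derivative of_real (ramp' (real k * (a - x)) * (- real k))) (at x)" for x
          unfolding e_def by (intro has_vector_derivative_of_real) (auto intro!: derivative_eq_intros)
      qed (intro continuous_intros)
      have ek: "e k \<in> borel_measurable lebesgue" for k
      proof -
        have "continuous_on UNIV (e k)" unfolding e_def ramp_def
          by (intro continuous_intros continuous_on_max) (use ramp_denom in \<open>auto simp: less_imp_neq[symmetric]\<close>)
        then show ?thesis by (intro measurable_completion) (simp add: borel_measurable_continuous_onI)
      qed
      have "(\<lambda>k. \<integral>x. e k x * h1 x \<partial>lebesgue) \<longlonglongrightarrow> (\<integral>x. indicator {..<a} x *\<^sub>R h1 x \<partial>lebesgue)"
      proof (rule integral_dominated_convergence[where w="\<lambda>x. norm (h1 x)"])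
        show "AE x in lebesgue. (\<lambda>k. e k x * h1 x) \<longlonglongrightarrow> indicat_real {..<a} x *\<^sub>R h1 x"
        proof (rule AE_I2)
          fix x
          show "(\<lambda>k. e k x * h1 x) \<longlonglongrightarrow> indicat_real {..<a} x *\<^sub>R h1 x"
          proof (cases "x < a")
            case True
            have "(\<lambda>k. e k x * h1 x) \<longlonglongrightarrow> of_real 1 * h1 x" unfolding e_def
              by (intro tendsto_intros ramp_tendsto) (use True in auto)
            then show ?thesis using True by simp
          next
            case False
            then have "e k x = 0" for k unfolding e_def
              by (subst ramp_nonpos) (auto simp: mult_nonneg_nonpos)
            then show ?thesis using False by simp
          qed
        qed
        show "AE x in lebesgue. norm (e k x * h1 x) \<le> norm (h1 x)" for k
          by (auto simp: e_def norm_mult ramp_bounds mult_left_le_one_le)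
        show "(\<lambda>x. e k x * h1 x) \<in> borel_measurable lebesgue" for k
          by (intro borel_measurable_times ek borel_measurable_integrable[OF h1])
      qed (use h1 in \<open>auto intro!: borel_measurable_scaleR borel_measurable_indicator\<close>)
      moreover have "(\<integral>x. e k x * h1 x \<partial>lebesgue) = 0" for k
        using zero[OF e[of k]] by (simp add: integral_restrict_space[OF Is] h1_def algebra_simps)
      ultimately show "(\<integral>x. indicator {..<a} x *\<^sub>R h1 x \<partial>lebesgue) = 0"
        by (simp add: LIMSEQ_const_iff)
    qed
    then show ?thesis
    proof eventually_elim
      case (elim x)
      show ?case
      proof
        assume x: "x \<in> {c<..<d}"
        then have "x \<in> I" using cd by auto
        moreover have "b x \<noteq> 0" using x ramp_pos[of "(x - c) * (d - x)"]
          by (simp add: b_def del: of_real_diff of_real_mult)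
        ultimately show "h x = 0" using elim by (simp add: h1_def)
      qed
    qed
  qed
  \<comment> \<open>Countably many rational intervals cover \<open>I\<close>, so the exceptional
    sets of the local statement add up to a null set.\<close>
  have "AE x in lebesgue. \<forall>p::rat \<times> rat. {of_rat (fst p)..of_rat (snd p)} \<subseteq> I \<and> fst p \<le> snd p \<longrightarrow>
      x \<in> {of_rat (fst p)<..<of_rat (snd p)} \<longrightarrow> h x = 0"
    unfolding AE_all_countable
    using local[of "of_rat _" "of_rat _"] by (auto simp: of_rat_less_eq)
  then have "AE x in lebesgue. x \<in> I \<longrightarrow> h x = 0"
  proof eventually_elim
    case (elim x)
    show ?case
    proof
      assume "x \<in> I"
      then obtain e where e: "e > 0" "\<And>y. \<bar>y - x\<bar> < e \<Longrightarrow> y \<in> I"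
        using I by (auto simp: open_dist dist_real_def)
      obtain p q where pq: "x - e < of_rat p" "of_rat p < x" "x < of_rat q" "of_rat q < x + e"
        using of_rat_dense[of "x - e" x] of_rat_dense[of x "x + e"] e(1) by auto
      have "{of_rat p..of_rat q} \<subseteq> I" using pq e(2) by auto
      moreover have "(of_rat p :: real) \<le> of_rat q" using pq by linarith
      ultimately show "h x = 0" using elim[rule_format, of "(p, q)"] pq
        by (simp add: of_rat_less_eq)
    qed
  qed
  then show ?thesis by (simp add: AE_restrict_space_iff[OF Is])
qed

section \<open>Weak derivatives\<close>

lemma finite_measure_lebesgue_on_interval: "finite_measure (lebesgue_on {a<..<b::real})"
  by (rule finite_measure_lebesgue_on) simp

lemma L2_integrable:
  assumes "h \<in> L2 L" shows "integrable (lebesgue_on {0<..<L}) h"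
proof -
  interpret finite_measure "lebesgue_on {0<..<L}" by (rule finite_measure_lebesgue_on_interval)
  have "norm (h x) \<le> norm (1 + (cmod (h x))\<^sup>2)" for x
  proof -
    have "cmod (h x) \<le> 1 + (cmod (h x))\<^sup>2"
    proof -
      have "2 * cmod (h x) \<le> 1 + (cmod (h x))\<^sup>2"
        using sum_squares_bound[of 1 "cmod (h x)"] by simp
      then show ?thesis using norm_ge_zero[of "h x"] by linarith
    qed
    then show ?thesis by simp
  qed
  then show ?thesis using assms
    by (intro Bochner_Integration.integrable_bound[of _ "\<lambda>x. 1 + (cmod (h x))\<^sup>2" h]) (auto simp: L2_def)
qed

lemma L2_measurable: "h \<in> L2 L \<Longrightarrow> h \<in> borel_measurable (lebesgue_on {0<..<L})"
  by (simp add: L2_def)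

lemma L2_bounded:
  assumes "h \<in> borel_measurable (lebesgue_on {0<..<L})" "\<And>x. x \<in> {0<..<L} \<Longrightarrow> cmod (h x) \<le> B"
  shows "h \<in> L2 L"
proof -
  interpret finite_measure "lebesgue_on {0<..<L}" by (rule finite_measure_lebesgue_on_interval)
  have "integrable (lebesgue_on {0<..<L}) (\<lambda>x. (cmod (h x))\<^sup>2)"
    by (rule integrable_const_bound[where B="B\<^sup>2"])
      (use assms in \<open>auto intro!: AE_I2 power_mono\<close>)
  then show ?thesis using assms(1) by (simp add: L2_def)
qed

lemma continuous_measurable_lebesgue_on:
  assumes "continuous_on UNIV (h::real \<Rightarrow> 'a::topological_space)"
  shows "h \<in> borel_measurable (lebesgue_on S)"
proof -
  have "h \<in> borel_measurable lebesgue"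
    using borel_measurable_continuous_onI[OF assms] by (intro measurable_completion) simp
  then show ?thesis by (simp add: measurable_restrict_space1)
qed

lemma L2_continuous:
  assumes "continuous_on UNIV h" shows "h \<in> L2 L"
proof -
  have "compact (h ` {0..L})"
    using assms by (intro compact_continuous_image) (auto intro: continuous_on_subset)
  then obtain B where B: "\<forall>y\<in>h ` {0..L}. cmod y \<le> B"
    using bounded_iff[THEN iffD1, OF compact_imp_bounded] by blast
  then show ?thesis
    by (intro L2_bounded[where B=B] continuous_measurable_lebesgue_on assms) (use B in auto)
qed

lemma L2_diff: 
  assumes "f \<in> L2 L" "h \<in> L2 L" shows "(\<lambda>x. f x - h x) \<in> L2 L"
proof -
  have m [measurable]: "f \<in> borel_measurable (lebesgue_on {0<..<L})" "h \<in> borel_measurable (lebesgue_on {0<..<L})"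
    using assms by (auto simp: L2_def)
  have "integrable (lebesgue_on {0<..<L}) (\<lambda>x. (cmod (f x - h x))\<^sup>2)"
  proof (rule Bochner_Integration.integrable_bound[of _ "\<lambda>x. 2 * (cmod (f x))\<^sup>2 + 2 * (cmod (h x))\<^sup>2"])
    show "integrable (lebesgue_on {0<..<L}) (\<lambda>x. 2 * (cmod (f x))\<^sup>2 + 2 * (cmod (h x))\<^sup>2)"
      using assms by (simp add: L2_def)
    show "AE x in lebesgue_on {0<..<L}. norm ((cmod (f x - h x))\<^sup>2) \<le> norm (2 * (cmod (f x))\<^sup>2 + 2 * (cmod (h x))\<^sup>2)"
    proof (rule AE_I2)
      fix x
      have "(cmod (f x - h x))\<^sup>2 \<le> (cmod (f x) + cmod (h x))\<^sup>2"
        by (intro power_mono norm_triangle_ineq4) auto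
      also have "\<dots> \<le> 2 * (cmod (f x))\<^sup>2 + 2 * (cmod (h x))\<^sup>2"
        using sum_squares_bound[of "cmod (f x)" "cmod (h x)"] by (simp add: power2_sum)
      finally show "norm ((cmod (f x - h x))\<^sup>2) \<le> norm (2 * (cmod (f x))\<^sup>2 + 2 * (cmod (h x))\<^sup>2)" by simp
    qed
  qed measurable
  then show ?thesis by (simp add: L2_def)
qed

lemma L2_cmult: "f \<in> L2 L \<Longrightarrow> (\<lambda>x. c * f x) \<in> L2 L"
  by (auto simp: L2_def norm_mult power_mult_distrib)

lemma L2_add: "f \<in> L2 L \<Longrightarrow> h \<in> L2 L \<Longrightarrow> (\<lambda>x. f x + h x) \<in> L2 L"
  using L2_diff[OF _ L2_cmult[of h L "-1"]] by simp

lemma L2_norm_eq: "L2_norm L f = sqrt (\<integral>x. (cmod (f x))\<^sup>2 \<partial>lebesgue_on {0<..<L})"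
proof -
  have "(\<lambda>x. f x * cnj (f x)) = (\<lambda>x. complex_of_real ((cmod (f x))\<^sup>2))"
    by (rule ext) (rule complex_norm_square[symmetric])
  then show ?thesis
    unfolding L2_norm_def L2_inner_def by (simp only: integral_complex_of_real Re_complex_of_real)
qed

lemma L2_norm_nonneg [simp]: "0 \<le> L2_norm L f"
  by (simp add: L2_norm_eq)

lemma L2_norm_cong_AE:
  assumes "f \<in> L2 L" "h \<in> L2 L" "AE x in lebesgue_on {0<..<L}. f x = h x"
  shows "L2_norm L f = L2_norm L h"
proof -
  have "(\<integral>x. (cmod (f x))\<^sup>2 \<partial>lebesgue_on {0<..<L}) = (\<integral>x. (cmod (h x))\<^sup>2 \<partial>lebesgue_on {0<..<L})"
    using assms by (intro integral_cong_AE) (auto simp: L2_def)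
  then show ?thesis by (simp add: L2_norm_eq)
qed

text \<open>Cauchy-Schwarz against the constant 1, obtained by integrating the square of |f| - A /
  L, where A / L is the mean value of |f|; expanding leaves B - A^2 / L \<ge> 0.\<close>

lemma L1_le_L2_norm:
  assumes f: "f \<in> L2 L" and "L > 0"
  shows "(\<integral>x. cmod (f x) \<partial>lebesgue_on {0<..<L}) \<le> sqrt L * L2_norm L f"
proof -
  interpret finite_measure "lebesgue_on {0<..<L}" by (rule finite_measure_lebesgue_on_interval)
  define A where "A = (\<integral>x. cmod (f x) \<partial>lebesgue_on {0<..<L})"
  define B where "B = (\<integral>x. (cmod (f x))\<^sup>2 \<partial>lebesgue_on {0<..<L})"
  have i: "integrable (lebesgue_on {0<..<L}) (\<lambda>x. cmod (f x))" "integrable (lebesgue_on {0<..<L}) (\<lambda>x. (cmod (f x))\<^sup>2)"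
    using f L2_integrable[OF f] by (auto simp: L2_def)
  have "measure (lebesgue_on {0<..<L}) {0<..<L} = L"
    using \<open>L > 0\<close> by (simp add: measure_restrict_space)
  then have "(\<integral>x. (cmod (f x))\<^sup>2 - 2 * (A / L) * cmod (f x) + (A/L)\<^sup>2 \<partial>lebesgue_on {0<..<L})
      = B - 2 * (A / L) * A + L * (A / L)\<^sup>2"
    using i by (simp add: A_def B_def)
  moreover have "0 \<le> (\<integral>x. (cmod (f x))\<^sup>2 - 2 * (A / L) * cmod (f x) + (A/L)\<^sup>2 \<partial>lebesgue_on {0<..<L})"
  proof (rule integral_nonneg_AE, rule AE_I2)
    fix x show "0 \<le> (cmod (f x))\<^sup>2 - 2 * (A / L) * cmod (f x) + (A/L)\<^sup>2"
      using zero_le_power2[of "cmod (f x) - A / L"] by (simp add: power2_diff mult_ac)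
  qed
  ultimately have "0 \<le> B - 2 * (A / L) * A + L * (A / L)\<^sup>2" by linarith
  also have "\<dots> = B - A\<^sup>2 / L"
    using \<open>L > 0\<close> by (simp add: power2_eq_square field_simps)
  finally have "A\<^sup>2 \<le> L * B"
    using \<open>L > 0\<close> by (simp add: field_simps)
  then have "A \<le> sqrt (L * B)" by (rule real_le_rsqrt)
  then show ?thesis unfolding L2_norm_eq A_def B_def by (simp add: real_sqrt_mult)
qed

lemma test_fun_bounded:
  assumes "\<phi> \<in> test_fun I" shows "\<exists>B. \<forall>x. cmod (\<phi> x) \<le> B" "continuous_on UNIV \<phi>"
proof -
  obtain \<phi>' K where D: "\<And>x. (\<phi> has_vector_derivative \<phi>' x) (at x)" "compact K" "\<And>x. x \<notin> K \<Longrightarrow> \<phi> x = 0"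
    using test_funE[OF assms] by metis
  show c: "continuous_on UNIV \<phi>"
    using D(1) by (meson continuous_at_imp_continuous_on has_vector_derivative_continuous)
  then have "compact (\<phi> ` K)" by (intro compact_continuous_image D) (auto intro: continuous_on_subset)
  then obtain B where "B > 0" "\<forall>y\<in>\<phi> ` K. cmod y \<le> B"
    using bounded_pos[THEN iffD1, OF compact_imp_bounded] by blast
  then have "cmod (\<phi> x) \<le> B" for x using D(3)[of x] by (cases "x \<in> K") auto
  then show "\<exists>B. \<forall>x. cmod (\<phi> x) \<le> B" by blast
qed

lemma integrable_mult_test_fun:
  assumes "integrable (lebesgue_on S) h" "\<phi> \<in> test_fun I"
  shows "integrable (lebesgue_on S) (\<lambda>x. h x * \<phi> x)"
proof -
  obtain B where B: "\<forall>x. cmod (\<phi> x) \<le> B" using test_fun_bounded(1)[OF assms(2)] ..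
  note c = test_fun_bounded(2)[OF assms(2)]
  have [measurable]: "\<phi> \<in> borel_measurable (lebesgue_on S)"
    by (rule continuous_measurable_lebesgue_on[OF c])
  have "B \<ge> 0" using order_trans[OF norm_ge_zero B[rule_format, of 0]] .
  show ?thesis 
  proof (rule Bochner_Integration.integrable_bound)
    show "integrable (lebesgue_on S) (\<lambda>x. B * norm (h x))"
      using assms(1) by simp
    show "(\<lambda>x. h x * \<phi> x) \<in> borel_measurable (lebesgue_on S)"
      by (intro borel_measurable_times borel_measurable_integrable[OF assms(1)]) measurable
    show "AE x in lebesgue_on S. norm (h x * \<phi> x) \<le> norm (B * norm (h x))"
      using B \<open>B \<ge> 0\<close> 
      by (intro AE_I2) (simp add: norm_mult mult.commute[of B] mult_left_mono)
  qed
qed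

section \<open>Uniqueness and arithmetic of weak derivatives\<close>

lemma weak_deriv_unique:
  assumes h: "h1 \<in> L2 L" "h2 \<in> L2 L" and w: "is_weak_deriv L f h1" "is_weak_deriv L f h2"
  shows "AE x in lebesgue_on {0<..<L}. h1 x = h2 x"
proof -
  have "AE x in lebesgue_on {0<..<L}. h1 x - h2 x = 0"
  proof (rule fundamental_lemma)
    show "(\<lambda>x. h1 x - h2 x) \<in> borel_measurable (lebesgue_on {0<..<L})"
      by (intro borel_measurable_diff L2_measurable h)
    fix \<phi> assume \<phi>: "\<phi> \<in> test_fun {0<..<L}"
    note i = L2_integrable[OF h(1), THEN integrable_mult_test_fun[OF _ \<phi>]]
      L2_integrable[OF h(2), THEN integrable_mult_test_fun[OF _ \<phi>]]
    then show "integrable (lebesgue_on {0<..<L}) (\<lambda>x. (h1 x - h2 x) * \<phi> x)"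
      by (simp add: left_diff_distrib)
    have "(\<integral>x. h1 x * \<phi> x \<partial>lebesgue_on {0<..<L}) = (\<integral>x. h2 x * \<phi> x \<partial>lebesgue_on {0<..<L})"
      using w \<phi> by (simp add: is_weak_deriv_def)
    then show "(\<integral>x. (h1 x - h2 x) * \<phi> x \<partial>lebesgue_on {0<..<L}) = 0"
      using i by (simp add: left_diff_distrib)
  qed auto
  then show ?thesis by simp
qed

text \<open>This is how the choice in \<open>weak_deriv\<close> is opened: one exhibited weak
  derivative in L2 shows that the chosen function is one too, and uniqueness makes the two agree
  almost everywhere.\<close>

lemma weak_derivI:
  assumes "h \<in> L2 L" "is_weak_deriv L f h"
  shows "weak_deriv L f \<in> L2 L" "is_weak_deriv L f (weak_deriv L f)"
    "AE x in lebesgue_on {0<..<L}. weak_deriv L f x = h x"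
proof -
  have *: "weak_deriv L f \<in> L2 L \<and> is_weak_deriv L f (weak_deriv L f)"
    unfolding weak_deriv_def by (rule someI[of _ h]) (use assms in auto)
  then show "weak_deriv L f \<in> L2 L" "is_weak_deriv L f (weak_deriv L f)" by auto
  show "AE x in lebesgue_on {0<..<L}. weak_deriv L f x = h x"
    by (rule weak_deriv_unique) (use * assms in auto)
qed

lemma H1D:
  assumes "f \<in> H1 L"
  shows "f \<in> L2 L" "weak_deriv L f \<in> L2 L" "is_weak_deriv L f (weak_deriv L f)"
  using assms weak_derivI by (auto simp: H1_def)

lemma H1I: "f \<in> L2 L \<Longrightarrow> h \<in> L2 L \<Longrightarrow> is_weak_deriv L f h \<Longrightarrow> f \<in> H1 L"
  by (auto simp: H1_def)

lemma integrable_L2_test_deriv: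
  assumes f: "f \<in> L2 L" and \<phi>: "\<phi> \<in> test_fun I"
  shows "integrable (lebesgue_on {0<..<L}) (\<lambda>x. f x * vector_derivative \<phi> (at x))"
proof -
  obtain \<phi>' K where D: "\<And>x. (\<phi> has_vector_derivative \<phi>' x) (at x)" "continuous_on UNIV \<phi>'"
    "compact K" "\<And>x. x \<notin> K \<Longrightarrow> \<phi>' x = 0"
    using test_funE[OF \<phi>] by metis
  have vd: "vector_derivative \<phi> (at x) = \<phi>' x" for x
    using D(1) vector_derivative_at by blast
  have "compact (\<phi>' ` K)" by (intro compact_continuous_image D) (use D(2) in \<open>auto intro: continuous_on_subset\<close>)
  then obtain B where "B > 0" "\<forall>y\<in>\<phi>' ` K. cmod y \<le> B"
    using bounded_pos[THEN iffD1, OF compact_imp_bounded] by blast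
  then have B: "cmod (\<phi>' x) \<le> B" for x using D(4)[of x] by (cases "x \<in> K") auto
  have [measurable]: "\<phi>' \<in> borel_measurable (lebesgue_on {0<..<L})"
    by (rule continuous_measurable_lebesgue_on[OF D(2)])
  show ?thesis unfolding vd
  proof (rule Bochner_Integration.integrable_bound)
    show "integrable (lebesgue_on {0<..<L}) (\<lambda>x. B * norm (f x))"
      using L2_integrable[OF f] by simp
    show "(\<lambda>x. f x * \<phi>' x) \<in> borel_measurable (lebesgue_on {0<..<L})"
      by (intro borel_measurable_times borel_measurable_integrable[OF L2_integrable[OF f]]) measurable
    show "AE x in lebesgue_on {0<..<L}. norm (f x * \<phi>' x) \<le> norm (B * norm (f x))"
      using B \<open>B > 0\<close> 
      by (intro AE_I2) (simp add: norm_mult mult.commute[of B] mult_left_mono)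
  qed
qed

lemma is_weak_deriv_diff:
  assumes "f1 \<in> L2 L" "f2 \<in> L2 L" "h1 \<in> L2 L" "h2 \<in> L2 L" "is_weak_deriv L f1 h1" "is_weak_deriv L f2 h2"
  shows "is_weak_deriv L (\<lambda>x. f1 x - f2 x) (\<lambda>x. h1 x - h2 x)"
  unfolding is_weak_deriv_def
proof
  fix \<phi> assume \<phi>: "\<phi> \<in> test_fun {0<..<L}"
  note i = assms(1,2)[THEN integrable_L2_test_deriv, OF \<phi>]
    assms(3,4)[THEN L2_integrable, THEN integrable_mult_test_fun, OF \<phi>]
  show "(\<integral>x. (f1 x - f2 x) * vector_derivative \<phi> (at x) \<partial>lebesgue_on {0<..<L}) =
      - (\<integral>x. (h1 x - h2 x) * \<phi> x \<partial>lebesgue_on {0<..<L})"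
    using i assms(5,6) \<phi> by (simp add: left_diff_distrib is_weak_deriv_def)
qed

lemma is_weak_deriv_cmult:
  assumes "is_weak_deriv L f h"
  shows "is_weak_deriv L (\<lambda>x. c * f x) (\<lambda>x. c * h x)"
  using assms by (simp add: is_weak_deriv_def mult.assoc)

text \<open>Needed for the flux, which is known to be a multiple of a smooth function only up to a
  null set.\<close>

lemma is_weak_deriv_cong:
  assumes "f1 \<in> L2 L" "f2 \<in> L2 L" "AE x in lebesgue_on {0<..<L}. f1 x = f2 x" "is_weak_deriv L f1 h"
  shows "is_weak_deriv L f2 h"
  unfolding is_weak_deriv_def
proof
  fix \<phi> assume \<phi>: "\<phi> \<in> test_fun {0<..<L}"
  have "(\<integral>x. f1 x * vector_derivative \<phi> (at x) \<partial>lebesgue_on {0<..<L}) = (\<integral>x. f2 x * vector_derivative \<phi> (at x) \<partial>lebesgue_on {0<..<L})"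
  proof (rule integral_cong_AE)
    show "AE x in lebesgue_on {0<..<L}. f1 x * vector_derivative \<phi> (at x) = f2 x * vector_derivative \<phi> (at x)"
      using assms(3) by eventually_elim simp
  qed (use assms(1,2)[THEN integrable_L2_test_deriv, OF \<phi>] in \<open>auto dest: borel_measurable_integrable\<close>)
  then show "(\<integral>x. f2 x * vector_derivative \<phi> (at x) \<partial>lebesgue_on {0<..<L}) =
      - (\<integral>x. h x * \<phi> x \<partial>lebesgue_on {0<..<L})"
    using assms(4) \<phi> by (simp add: is_weak_deriv_def)
qed

lemma is_weak_deriv_C1:
  assumes "\<And>x. (f has_vector_derivative f' x) (at x)" "continuous_on UNIV f'"
  shows "is_weak_deriv L f f'" "f \<in> L2 L" "f' \<in> L2 L" "f \<in> H1 L"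
proof -
  show *: "is_weak_deriv L f f'"
    unfolding is_weak_deriv_def using compact_support_parts(3)[OF _ _ assms] by auto
  have "continuous_on UNIV f"
    using assms(1) by (meson continuous_at_imp_continuous_on has_vector_derivative_continuous)
  with assms(2) show "f \<in> L2 L" "f' \<in> L2 L" by (auto intro: L2_continuous)
  with * show "f \<in> H1 L" by (auto intro: H1I)
qed

lemma weak_deriv_diff:
  assumes "f1 \<in> H1 L" "f2 \<in> H1 L"
  shows "(\<lambda>x. f1 x - f2 x) \<in> H1 L"
    "AE x in lebesgue_on {0<..<L}. weak_deriv L (\<lambda>x. f1 x - f2 x) x = weak_deriv L f1 x - weak_deriv L f2 x"
proof -
  note D = H1D[OF assms(1)] H1D[OF assms(2)]
  note w = is_weak_deriv_diff[OF D(1,4,2,5,3,6)]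
  show "(\<lambda>x. f1 x - f2 x) \<in> H1 L"
    by (rule H1I[OF _ _ w]) (use D in \<open>auto intro: L2_diff\<close>)
  show "AE x in lebesgue_on {0<..<L}. weak_deriv L (\<lambda>x. f1 x - f2 x) x = weak_deriv L f1 x - weak_deriv L f2 x"
    by (rule weak_derivI(3)[OF _ w]) (use D in \<open>auto intro: L2_diff\<close>)
qed

lemma weak_deriv_cmult:
  assumes "f \<in> H1 L"
  shows "(\<lambda>x. c * f x) \<in> H1 L"
    "AE x in lebesgue_on {0<..<L}. weak_deriv L (\<lambda>x. c * f x) x = c * weak_deriv L f x"
proof -
  note D = H1D[OF assms(1)]
  note w = is_weak_deriv_cmult[OF D(3), of c]
  show "(\<lambda>x. c * f x) \<in> H1 L"
    by (rule H1I[OF _ _ w]) (use D in \<open>auto intro: L2_cmult\<close>)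
  show "AE x in lebesgue_on {0<..<L}. weak_deriv L (\<lambda>x. c * f x) x = c * weak_deriv L f x"
    by (rule weak_derivI(3)[OF _ w]) (use D in \<open>auto intro: L2_cmult\<close>)
qed

section \<open>Membership in the space with zero boundary values\<close>

text \<open>The shift by 1 makes the function vanish where k x (L - x) \<le> 1, hence near both end
  points, so the support is a compact subset of the open interval; at a fixed interior x the values
  tend to 1.\<close>

definition cutoff :: "real \<Rightarrow> nat \<Rightarrow> real \<Rightarrow> real" where
  "cutoff L k x = ramp (real k * (x * (L - x)) - 1)"

definition cutoff' :: "real \<Rightarrow> nat \<Rightarrow> real \<Rightarrow> real" where
  "cutoff' L k x = ramp' (real k * (x * (L - x)) - 1) * (real k * (L - 2 * x))"

lemma cutoff_deriv: "(cutoff L k has_real_derivative cutoff' L k x) (at x)"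
  unfolding cutoff_def[abs_def] cutoff'_def by (auto intro!: derivative_eq_intros)

lemma cutoff_test_fun:
  assumes "L > 0" shows "(\<lambda>x. complex_of_real (cutoff L k x)) \<in> test_fun {0<..<L}"
proof (rule test_funI)
  show "((\<lambda>x. complex_of_real (cutoff L k x)) has_vector_derivative of_real (cutoff' L k x)) (at x)" for x
    by (intro has_vector_derivative_of_real cutoff_deriv)
  show "continuous_on UNIV (\<lambda>x. complex_of_real (cutoff' L k x))"
    unfolding cutoff'_def by (intro continuous_intros)
  show "{x. 1 \<le> real k * (x * (L - x))} \<subseteq> {0<..<L}"
  proof
    fix x assume "x \<in> {x. 1 \<le> real k * (x * (L - x))}"
    then have "0 < real k * (x * (L - x))" by simp
    then have "0 < x * (L - x)" by (simp add: zero_less_mult_iff)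
    then show "x \<in> {0<..<L}"
      using assms by (auto simp: zero_less_mult_iff)
  qed
  then have "bounded {x. 1 \<le> real k * (x * (L - x))}"
    using bounded_subset[OF bounded_box[of 0 L]] by simp
  moreover have "closed {x. 1 \<le> real k * (x * (L - x))}"
    by (intro closed_Collect_le continuous_intros)
  ultimately show "compact {x. 1 \<le> real k * (x * (L - x))}"
    by (simp add: compact_eq_bounded_closed)
  show "complex_of_real (cutoff L k x) = 0" if "x \<notin> {x. 1 \<le> real k * (x * (L - x))}" for x
    using that by (simp add: cutoff_def ramp_nonpos)
qed

text \<open>
  With \<open>t + 1 = k x (L - x)\<close> this controls \<open>\<bar>f x\<bar> * \<bar>cutoff' L k x\<bar>\<close> uniformly in \<open>k\<close> when
  \<open>\<bar>f x\<bar> \<le> B x (L - x)\<close>: the vanishing of \<open>f\<close> at the end points compensates the factor \<open>k\<close>.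
\<close>
lemma ramp'_bound:
  assumes "t \<ge> -1" shows "0 \<le> (t + 1) * ramp' t" "(t + 1) * ramp' t \<le> 4 * (1 - ramp t)"
proof -
  show "0 \<le> (t + 1) * ramp' t" using assms by (simp add: ramp'_def)
  show "(t + 1) * ramp' t \<le> 4 * (1 - ramp t)"
  proof (cases "t \<le> 0")
    case True then show ?thesis by (simp add: ramp_nonpos)
  next
    case False
    define p where "p = t\<^sup>2 + 1"
    have p: "p > 0" by (simp add: p_def add_nonneg_pos)
    have "t \<le> p" using sum_squares_bound[of t 1] False by (simp add: p_def)
    then have "(t + 1) * (2 * t) \<le> 4 * p"
      using False by (simp add: p_def power2_eq_square algebra_simps)
    then have "(t + 1) * (2 * t) / p\<^sup>2 \<le> 4 * p / p\<^sup>2"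
      by (rule divide_right_mono) simp
    moreover have "1 - t\<^sup>2 / p = 1 / p"
      using p by (simp add: p_def field_simps)
    then have "4 * p / p\<^sup>2 = 4 * (1 - t\<^sup>2 / p)"
      using p by (simp add: power2_eq_square)
    ultimately show ?thesis using False by (simp add: ramp_def ramp'_def p_def)
  qed
qed

text \<open>Dominated convergence with bound 1. In \<open>H10_C1\<close> the squared L2 errors of
  the cut-off function and of its derivative are both bounded by multiples of this integral.\<close>

lemma cutoff_defect_tendsto:
  "(\<lambda>k. \<integral>x. (1 - cutoff L k x)\<^sup>2 \<partial>lebesgue_on {0<..<L}) \<longlonglongrightarrow> 0"
  and cutoff_defect_integrable: "integrable (lebesgue_on {0<..<L}) (\<lambda>x. (1 - cutoff L k x)\<^sup>2)"
proof -
  interpret finite_measure "lebesgue_on {0<..<L}" by (rule finite_measure_lebesgue_on_interval)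
  have c: "continuous_on UNIV (cutoff L k)" for k
    using cutoff_deriv by (meson DERIV_continuous continuous_at_imp_continuous_on)
  have m: "(\<lambda>x. (1 - cutoff L k x)\<^sup>2) \<in> borel_measurable (lebesgue_on {0<..<L})" for k
    by (intro continuous_measurable_lebesgue_on continuous_intros c)
  have b: "norm ((1 - cutoff L k x)\<^sup>2) \<le> 1" for k x
    using ramp_bounds by (simp add: cutoff_def power_le_one)
  show "integrable (lebesgue_on {0<..<L}) (\<lambda>x. (1 - cutoff L k x)\<^sup>2)"
    by (rule integrable_const_bound[OF _ m, where B=1]) (use b in auto)
  have "(\<lambda>k. \<integral>x. (1 - cutoff L k x)\<^sup>2 \<partial>lebesgue_on {0<..<L}) \<longlonglongrightarrow> (\<integral>x. 0 \<partial>lebesgue_on {0<..<L})"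
  proof (rule integral_dominated_convergence[OF _ m _ _ AE_I2[OF b]])
    show "AE x in lebesgue_on {0<..<L}. (\<lambda>k. (1 - cutoff L k x)\<^sup>2) \<longlonglongrightarrow> 0"
    proof (rule AE_I2)
      fix x assume "x \<in> space (lebesgue_on {0<..<L})"
      then have "0 < x * (L - x)" by simp
      then have "(\<lambda>k. (1 - cutoff L k x)\<^sup>2) \<longlonglongrightarrow> (1 - 1)\<^sup>2"
        unfolding cutoff_def by (intro tendsto_intros ramp_tendsto)
      then show "(\<lambda>k. (1 - cutoff L k x)\<^sup>2) \<longlonglongrightarrow> 0" by simp
    qed
  qed auto
  then show "(\<lambda>k. \<integral>x. (1 - cutoff L k x)\<^sup>2 \<partial>lebesgue_on {0<..<L}) \<longlonglongrightarrow> 0" by simp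
qed

text \<open>The linear vanishing at both end points is the boundary condition in the form that suits
  cut-offs: \<open>f\<close> times \<open>cutoff'\<close> stays below a multiple of 1 -
  \<open>cutoff\<close>, so the H1 error tends to 0 although \<open>cutoff'\<close> carries a factor
  k.\<close>

lemma H10_C1:
  assumes "L > 0" and f: "\<And>x. (f has_vector_derivative f' x) (at x)" "continuous_on UNIV f'"
    and bd: "\<And>x. x \<in> {0<..<L} \<Longrightarrow> cmod (f x) \<le> B * (x * (L - x))"
  shows "f \<in> H10 L"
proof -
  define D where "D k = (\<integral>x. (1 - cutoff L k x)\<^sup>2 \<partial>lebesgue_on {0<..<L})" for k
  define \<phi> where "\<phi> k x = f x * complex_of_real (cutoff L k x)" for k x
  have \<phi>: "\<phi> k \<in> test_fun {0<..<L}" for k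
    unfolding \<phi>_def[abs_def] by (rule C1_test_fun_mult[OF cutoff_test_fun[OF assms(1)] f])
  define e where "e k x = f x * of_real (1 - cutoff L k x)" for k x
  define e' where "e' k x = f' x * of_real (1 - cutoff L k x) - f x * of_real (cutoff' L k x)" for k x
  have e: "f - \<phi> k = e k" for k by (simp add: e_def \<phi>_def fun_eq_iff right_diff_distrib)
  have e': "(e k has_vector_derivative e' k x) (at x)" for k x
  proof -
    have "((\<lambda>x. complex_of_real (1 - cutoff L k x)) has_vector_derivative of_real (- cutoff' L k x)) (at x)"
      by (intro has_vector_derivative_of_real) (auto intro!: derivative_eq_intros cutoff_deriv)
    from has_vector_derivative_mult[OF f(1) this] show ?thesis
      unfolding e_def[abs_def] e'_def by simp
  qed
  have cf: "continuous_on UNIV f"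
    using f(1) by (meson continuous_at_imp_continuous_on has_vector_derivative_continuous)
  have cc: "continuous_on UNIV (cutoff L k)" for k
    using cutoff_deriv by (meson DERIV_continuous continuous_at_imp_continuous_on)
  have ce': "continuous_on UNIV (e' k)" for k
    unfolding e'_def cutoff'_def by (intro continuous_intros cc f cf)
  note E = is_weak_deriv_C1[OF e' ce']
  have "compact (f ` {0..L})" "compact (f' ` {0..L})"
    by (rule compact_continuous_image[OF continuous_on_subset[OF cf subset_UNIV] compact_Icc],
        rule compact_continuous_image[OF continuous_on_subset[OF f(2) subset_UNIV] compact_Icc])
  then have "bounded (f ` {0..L})" "bounded (f' ` {0..L})" by (simp_all add: compact_imp_bounded)
  then obtain B0 B1 where B0: "\<forall>y\<in>f ` {0..L}. cmod y \<le> B0" and B1: "\<forall>y\<in>f' ` {0..L}. cmod y \<le> B1"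
    by (auto simp: bounded_iff simp del: ball_simps)
  have Bnn: "B0 \<ge> 0" "B1 \<ge> 0" "B \<ge> 0"
  proof -
    show "B0 \<ge> 0" by (rule order_trans[OF norm_ge_zero B0[rule_format, of "f 0"]]) (use \<open>L > 0\<close> in simp)
    show "B1 \<ge> 0" by (rule order_trans[OF norm_ge_zero B1[rule_format, of "f' 0"]]) (use \<open>L > 0\<close> in simp)
    have "0 \<le> B * (L / 2 * (L - L / 2))"
      by (rule order_trans[OF norm_ge_zero bd]) (use \<open>L > 0\<close> in simp)
    moreover have "0 < L / 2 * (L - L / 2)" using \<open>L > 0\<close> by simp
    ultimately show "B \<ge> 0" using mult_neg_pos[of B "L / 2 * (L - L / 2)"] by linarith
  qed
  have N: "L2_norm L h \<le> sqrt (C\<^sup>2 * D k)" if h: "h \<in> L2 L" "\<And>x. x \<in> {0<..<L} \<Longrightarrow> cmod (h x) \<le> C * (1 - cutoff L k x)" for h C k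
  proof -
    have "(\<integral>x. (cmod (h x))\<^sup>2 \<partial>lebesgue_on {0<..<L}) \<le> (\<integral>x. C\<^sup>2 * (1 - cutoff L k x)\<^sup>2 \<partial>lebesgue_on {0<..<L})"
    proof (rule integral_mono)
      show "(cmod (h x))\<^sup>2 \<le> C\<^sup>2 * (1 - cutoff L k x)\<^sup>2" if "x \<in> space (lebesgue_on {0<..<L})" for x
        using power_mono[OF h(2)[of x] norm_ge_zero, of 2] that by (simp add: power_mult_distrib)
    qed (use h(1) cutoff_defect_integrable in \<open>auto simp: L2_def\<close>)
    then show ?thesis by (simp add: L2_norm_eq D_def)
  qed
  have 1: "L2_norm L (e k) \<le> sqrt (B0\<^sup>2 * D k)" for k
  proof (rule N[OF E(2)])
    fix x assume x: "x \<in> {0<..<L}"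
    show "cmod (e k x) \<le> B0 * (1 - cutoff L k x)"
      unfolding e_def norm_mult norm_of_real cutoff_def
      using B0 x Bnn ramp_bounds by (intro mult_mono) auto
  qed
  \<comment> \<open>\<open>B1\<close> bounds f' and goes with the undifferentiated cut-off; 4 B L
    comes from \<open>ramp'_bound\<close>, the hypothesis \<open>bd\<close> and |L - 2 x| \<le>
    L.\<close>
  have 2: "L2_norm L (e' k) \<le> sqrt ((B1 + 4 * B * L)\<^sup>2 * D k)" for k
  proof (rule N[OF E(3)])
    fix x assume x: "x \<in> {0<..<L}"
    define t where "t = real k * (x * (L - x)) - 1"
    have t: "t \<ge> -1" using x by (simp add: t_def)
    have c: "cutoff L k x = ramp t" "cutoff' L k x = ramp' t * (real k * (L - 2 * x))"
      by (simp_all add: cutoff_def cutoff'_def t_def)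
    have rn: "ramp' t \<ge> 0" by (simp add: ramp'_def)
    have "cmod (f x * of_real (cutoff' L k x)) \<le> (B * (x * (L - x))) * (ramp' t * (real k * L))"
      unfolding norm_mult norm_of_real c abs_mult
      using bd[OF x] rn x Bnn by (intro mult_mono mult_nonneg_nonneg) auto
    also have "\<dots> = B * L * ((t + 1) * ramp' t)" by (simp add: t_def)
    also have "\<dots> \<le> B * L * (4 * (1 - ramp t))"
      using ramp'_bound[OF t] Bnn \<open>L > 0\<close> by (intro mult_left_mono) auto
    finally have "cmod (f x * of_real (cutoff' L k x)) \<le> B * L * (4 * (1 - ramp t))" .
    moreover have "cmod (f' x * of_real (1 - cutoff L k x)) \<le> B1 * (1 - ramp t)"
      unfolding norm_mult norm_of_real c
      using B1 x Bnn ramp_bounds by (intro mult_mono) auto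
    ultimately have "cmod (e' k x) \<le> B1 * (1 - ramp t) + B * L * (4 * (1 - ramp t))"
      unfolding e'_def by (intro order_trans[OF norm_triangle_ineq4] add_mono)
    then show "cmod (e' k x) \<le> (B1 + 4 * B * L) * (1 - cutoff L k x)"
      by (simp add: c algebra_simps)
  qed
  have D0: "D k \<ge> 0" for k by (simp add: D_def)
  have 3: "H1_norm L (f - \<phi> k) \<le> sqrt (B0\<^sup>2 * D k + (B1 + 4 * B * L)\<^sup>2 * D k)" for k
  proof -
    have "L2_norm L (weak_deriv L (e k)) = L2_norm L (e' k)"
      by (rule L2_norm_cong_AE[OF _ E(3)]) (use weak_derivI[OF E(3,1)] in auto)
    then have "H1_norm L (f - \<phi> k) = sqrt ((L2_norm L (e k))\<^sup>2 + (L2_norm L (e' k))\<^sup>2)"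
      by (simp add: H1_norm_def e)
    also have "\<dots> \<le> sqrt (B0\<^sup>2 * D k + (B1 + 4 * B * L)\<^sup>2 * D k)"
      using power_mono[OF 1 L2_norm_nonneg, of k 2] power_mono[OF 2 L2_norm_nonneg, of k 2] D0[of k]
      by (intro real_sqrt_le_mono add_mono) (simp_all add: mult_nonneg_nonneg)
    finally show ?thesis .
  qed
  have "(\<lambda>k. H1_norm L (f - \<phi> k)) \<longlonglongrightarrow> 0"
  proof (rule real_tendsto_sandwich[OF _ _ tendsto_const])
    show "\<forall>\<^sub>F k in sequentially. 0 \<le> H1_norm L (f - \<phi> k)" by (simp add: H1_norm_def)
    show "\<forall>\<^sub>F k in sequentially. H1_norm L (f - \<phi> k) \<le> sqrt (B0\<^sup>2 * D k + (B1 + 4 * B * L)\<^sup>2 * D k)"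
      using 3 by simp
    have "D \<longlonglongrightarrow> 0" unfolding D_def by (rule cutoff_defect_tendsto)
    then have "(\<lambda>k. sqrt (B0\<^sup>2 * D k + (B1 + 4 * B * L)\<^sup>2 * D k)) \<longlonglongrightarrow> sqrt (B0\<^sup>2 * 0 + (B1 + 4 * B * L)\<^sup>2 * 0)"
      by (intro tendsto_intros)
    then show "(\<lambda>k. sqrt (B0\<^sup>2 * D k + (B1 + 4 * B * L)\<^sup>2 * D k)) \<longlonglongrightarrow> 0" by simp
  qed
  moreover have "f \<in> H1 L" by (rule is_weak_deriv_C1(4)[OF f])
  ultimately show ?thesis using \<phi> by (auto simp: H10_def)
qed

section \<open>Bochner integrals with values in function spaces\<close>

text \<open>As \<psi> is not identically 0, sending c to c \<psi> is injective. The level sets of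
  the function-valued simple function are therefore those of the scalar one, and the two sums agree
  term by term.\<close>

lemma simple_integral_fun_scalar:
  assumes \<sigma>: "Bochner_Integration.simple_bochner_integrable M \<sigma>" and \<psi>: "\<psi> x0 \<noteq> 0"
  shows "simple_integral_fun M (\<lambda>s x. \<sigma> s * \<psi> x) = (\<lambda>x. (\<integral>s. \<sigma> s \<partial>M) * (\<psi> x :: complex))"
proof
  fix x
  define j where "j c = (\<lambda>x. c * \<psi> x)" for c
  have j: "inj j"
    using \<psi> by (auto simp: inj_def j_def fun_eq_iff)
  have "(\<integral>s. \<sigma> s \<partial>M) = (\<Sum>c\<in>\<sigma> ` space M. measure M {s\<in>space M. \<sigma> s = c} *\<^sub>R c)"
    using has_bochner_integral_integral_eq[OF has_bochner_integral_simple_bochner_integrable[OF \<sigma>]]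
    by (simp add: Bochner_Integration.simple_bochner_integral_def)
  then have "(\<integral>s. \<sigma> s \<partial>M) * \<psi> x = (\<Sum>c\<in>\<sigma> ` space M. measure M {s\<in>space M. \<sigma> s = c} *\<^sub>R (j c x))"
    by (simp add: sum_distrib_right j_def)
  also have "\<dots> = (\<Sum>c\<in>\<sigma> ` space M. measure M {s\<in>space M. j (\<sigma> s) = j c} *\<^sub>R (j c x))"
    using j by (simp add: inj_eq)
  also have "\<dots> = (\<Sum>f\<in>j ` \<sigma> ` space M. measure M {s\<in>space M. j (\<sigma> s) = f} *\<^sub>R (f x))"
    using j by (subst sum.reindex) (auto intro: inj_on_subset)
  finally show "simple_integral_fun M (\<lambda>s x. \<sigma> s * \<psi> x) x = (\<integral>s. \<sigma> s \<partial>M) * \<psi> x"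
    by (simp add: simple_integral_fun_def j_def image_image)
qed

text \<open>The values \<open>F s\<close> need not be literally h(s) \<psi>: only their distances to
  multiples of \<psi> are prescribed. This covers representatives picked by \<open>SOME\<close>,
  which have the expected form only almost everywhere in x.\<close>

lemma bochner_measurable_scalar:
  fixes h :: "real \<Rightarrow> complex"
  assumes S: "\<And>c. (\<lambda>x. c * \<psi> x) \<in> S"
    and N: "\<And>s c. s \<in> space M \<Longrightarrow> N (F s - (\<lambda>x. c * \<psi> x)) = cmod (h s - c) * \<kappa>"
    and h: "h \<in> borel_measurable M"
  shows "bochner_measurable S N M F"
proof -
  obtain \<sigma> where \<sigma>: "\<And>i. simple_function M (\<sigma> i)" "\<And>s. s \<in> space M \<Longrightarrow> (\<lambda>i. \<sigma> i s) \<longlonglongrightarrow> h s"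
    using borel_measurable_implies_sequence_metric[OF h] by metis
  have "(\<lambda>n. N (F s - (\<lambda>x. \<sigma> n s * \<psi> x))) \<longlonglongrightarrow> 0" if s: "s \<in> space M" for s
  proof -
    have "(\<lambda>n. cmod (h s - \<sigma> n s) * \<kappa>) \<longlonglongrightarrow> cmod (h s - h s) * \<kappa>"
      by (intro tendsto_intros \<sigma> s)
    then show ?thesis using N[OF s] by simp
  qed
  moreover have "simple_function M (\<lambda>s x. \<sigma> n s * \<psi> x)" for n
    by (rule simple_function_compose1[OF \<sigma>(1), of "\<lambda>c x. c * \<psi> x"])
  ultimately show ?thesis unfolding bochner_measurable_def using S
    by (intro exI[of _ "\<lambda>n s x. \<sigma> n s * \<psi> x"]) auto
qed

text \<open>Everything is carried by the scalar \<open>h\<close>: its simple approximants times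
  \<psi> take values in the line spanned by \<psi>, on which the distance in \<open>N\<close> is
  \<kappa> times the distance of the coefficients.\<close>

lemma has_bochner_fun_scalar:
  fixes h :: "real \<Rightarrow> complex"
  assumes S: "\<And>c. (\<lambda>x. c * \<psi> x) \<in> S" and F: "\<And>s. s \<in> space M \<Longrightarrow> F s \<in> S"
    and N: "\<And>s c. s \<in> space M \<Longrightarrow> N (F s - (\<lambda>x. c * \<psi> x)) = cmod (h s - c) * \<kappa>"
    and N2: "\<And>c d. N ((\<lambda>x. c * \<psi> x) - (\<lambda>x. d * \<psi> x)) = cmod (c - d) * \<kappa>"
    and \<psi>: "\<psi> x0 \<noteq> 0" and h: "integrable M h"
  shows "has_bochner_fun S N M F (\<lambda>x. (\<integral>s. h s \<partial>M) * \<psi> x)"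
proof -
  obtain \<sigma> where \<sigma>: "\<And>i. simple_function M (\<sigma> i)" "\<And>i. emeasure M {y \<in> space M. \<sigma> i y \<noteq> 0} \<noteq> \<infinity>"
    "\<And>x. x \<in> space M \<Longrightarrow> (\<lambda>i. \<sigma> i x) \<longlonglongrightarrow> h x" "\<And>x i. x \<in> space M \<Longrightarrow> norm (\<sigma> i x) \<le> 2 * norm (h x)"
    by (rule integrable_implies_simple_function_sequence[OF h], rule that)
  have sb: "Bochner_Integration.simple_bochner_integrable M (\<sigma> n)" for n
    using \<sigma>(1,2) by (intro Bochner_Integration.simple_bochner_integrable.intros)
  have ints: "integrable M (\<sigma> n)" for n
    by (rule integrable_simple_function[OF \<sigma>(1,2)])
  have int: "integrable M (\<lambda>s. N (F s - (\<lambda>x. \<sigma> n s * \<psi> x)))" for n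
  proof -
    have "integrable M (\<lambda>s. cmod (h s - \<sigma> n s) * \<kappa>)" using ints h by simp
    then show ?thesis by (rule Bochner_Integration.integrable_cong[THEN iffD1, rotated -1]) (simp_all add: N)
  qed
  have eq: "(\<integral>s. N (F s - (\<lambda>x. \<sigma> n s * \<psi> x)) \<partial>M) = (\<integral>s. cmod (h s - \<sigma> n s) * \<kappa> \<partial>M)" for n
    by (rule Bochner_Integration.integral_cong) (simp_all add: N)
  have "(\<lambda>n. \<integral>s. cmod (h s - \<sigma> n s) * \<kappa> \<partial>M) \<longlonglongrightarrow> (\<integral>s. 0 \<partial>M)"
  proof (rule integral_dominated_convergence[where w="\<lambda>s. 3 * cmod (h s) * \<bar>\<kappa>\<bar>"])
    show "AE s in M. (\<lambda>n. cmod (h s - \<sigma> n s) * \<kappa>) \<longlonglongrightarrow> 0"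
    proof (rule AE_I2)
      fix s assume "s \<in> space M"
      then have "(\<lambda>n. cmod (h s - \<sigma> n s) * \<kappa>) \<longlonglongrightarrow> cmod (h s - h s) * \<kappa>"
        by (intro tendsto_intros \<sigma>)
      then show "(\<lambda>n. cmod (h s - \<sigma> n s) * \<kappa>) \<longlonglongrightarrow> 0" by simp
    qed
    show "AE s in M. norm (cmod (h s - \<sigma> n s) * \<kappa>) \<le> 3 * cmod (h s) * \<bar>\<kappa>\<bar>" for n
    proof (rule AE_I2)
      fix s assume s: "s \<in> space M"
      \<comment> \<open>The factor 3 combines |h| with the bound 2 |h| for the approximants.\<close>
      have "cmod (h s - \<sigma> n s) \<le> 3 * cmod (h s)"
        using norm_triangle_ineq4[of "h s" "\<sigma> n s"] \<sigma>(4)[OF s, of n] by linarith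
      then show "norm (cmod (h s - \<sigma> n s) * \<kappa>) \<le> 3 * cmod (h s) * \<bar>\<kappa>\<bar>"
        by (simp add: abs_mult mult_right_mono)
    qed
    show "(\<lambda>s. cmod (h s - \<sigma> n s) * \<kappa>) \<in> borel_measurable M" for n
      using ints[of n] h by (intro borel_measurable_times borel_measurable_norm borel_measurable_diff) auto
    show "integrable M (\<lambda>s. 3 * cmod (h s) * \<bar>\<kappa>\<bar>)" using h by simp
  qed simp
  then have 1: "(\<lambda>n. \<integral>s. N (F s - (\<lambda>x. \<sigma> n s * \<psi> x)) \<partial>M) \<longlonglongrightarrow> 0" by (simp add: eq)
  have "(\<lambda>n. \<integral>s. \<sigma> n s \<partial>M) \<longlonglongrightarrow> (\<integral>s. h s \<partial>M)"
    by (rule integral_dominated_convergence[where w="\<lambda>s. 2 * norm (h s)"])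
      (use \<sigma> h ints in \<open>auto intro: borel_measurable_integrable\<close>)
  then have "(\<lambda>n. cmod ((\<integral>s. h s \<partial>M) - (\<integral>s. \<sigma> n s \<partial>M)) * \<kappa>) \<longlonglongrightarrow> cmod ((\<integral>s. h s \<partial>M) - (\<integral>s. h s \<partial>M)) * \<kappa>"
    by (intro tendsto_intros)
  then have 2: "(\<lambda>n. N ((\<lambda>x. (\<integral>s. h s \<partial>M) * \<psi> x) - simple_integral_fun M (\<lambda>s x. \<sigma> n s * \<psi> x))) \<longlonglongrightarrow> 0"
    by (simp add: N2 simple_integral_fun_scalar[where \<psi>=\<psi>, OF sb \<psi>])
  have 3: "simple_function M (\<lambda>s x. \<sigma> n s * \<psi> x)" for n
    by (rule simple_function_compose1[OF \<sigma>(1), of "\<lambda>c x. c * \<psi> x"])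
  have 4: "emeasure M {s \<in> space M. (\<lambda>x. \<sigma> n s * \<psi> x) \<noteq> (\<lambda>_. 0)} \<noteq> \<infinity>" for n
  proof -
    have "{s \<in> space M. (\<lambda>x. \<sigma> n s * \<psi> x) \<noteq> (\<lambda>_. 0)} = {s \<in> space M. \<sigma> n s \<noteq> 0}"
      using \<psi> by (auto simp: fun_eq_iff)
    then show ?thesis using \<sigma>(2)[of n] by simp
  qed
  have 5: "bochner_measurable S N M F"
    by (rule bochner_measurable_scalar[OF S N]) (use h in auto)
  show ?thesis unfolding has_bochner_fun_def
  proof (intro conjI exI[of _ "\<lambda>n s x. \<sigma> n s * \<psi> x"] allI)
    show "AE s in M. F s \<in> S" using F by (rule AE_I2)
    show "(\<lambda>s x. \<sigma> n s * \<psi> x) ` space M \<subseteq> S" for n using S by blast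
  qed (fact 1 2 3 4 5 int S)+
qed

text \<open>
  A bounded functional maps a Bochner integral to the library's integral of scalars; this is how
  the objects selected with \<open>SOME\<close> are identified below.
\<close>
locale bounded_functional =
  fixes V :: "(real \<Rightarrow> complex) set" and N :: "(real \<Rightarrow> complex) \<Rightarrow> real"
    and l :: "(real \<Rightarrow> complex) \<Rightarrow> complex" and K :: real
  assumes diff: "f \<in> V \<Longrightarrow> h \<in> V \<Longrightarrow> f - h \<in> V" "f \<in> V \<Longrightarrow> h \<in> V \<Longrightarrow> l (f - h) = l f - l h"
    and cmult: "f \<in> V \<Longrightarrow> (\<lambda>x. c * f x) \<in> V" "f \<in> V \<Longrightarrow> l (\<lambda>x. c * f x) = c * l f"
    and zero: "(\<lambda>_. 0) \<in> V"
    and bound: "f \<in> V \<Longrightarrow> cmod (l f) \<le> K * N f"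
begin

lemma l_zero: "l (\<lambda>_. 0) = 0"
  using cmult(2)[OF zero, of 0] by simp

lemma combination:
  assumes "finite A" "A \<subseteq> V"
  shows "(\<lambda>x. \<Sum>f\<in>A. c f *\<^sub>R f x) \<in> V" "l (\<lambda>x. \<Sum>f\<in>A. c f *\<^sub>R f x) = (\<Sum>f\<in>A. c f *\<^sub>R l f)"
proof -
  have "(\<lambda>x. \<Sum>f\<in>A. c f *\<^sub>R f x) \<in> V \<and> l (\<lambda>x. \<Sum>f\<in>A. c f *\<^sub>R f x) = (\<Sum>f\<in>A. c f *\<^sub>R l f)"
    using assms
  proof (induction A rule: finite_induct)
    case empty then show ?case by (simp add: zero l_zero)
  next
    case (insert f A)
    define P where "P = (\<lambda>x. \<Sum>f\<in>A. c f *\<^sub>R f x)"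
    have f: "f \<in> V" and P: "P \<in> V" "l P = (\<Sum>f\<in>A. c f *\<^sub>R l f)" using insert by (auto simp: P_def)
    have eq: "(\<lambda>x. \<Sum>f\<in>insert f A. c f *\<^sub>R f x) = P - (\<lambda>x. (- of_real (c f)) * f x)"
      using insert(1,2) by (auto simp: P_def fun_eq_iff scaleR_conv_of_real)
    show ?case unfolding eq
      using diff[OF P(1) cmult(1)[OF f, of "- of_real (c f)"]] cmult(2)[OF f, of "- of_real (c f)"] P(2) insert(1,2)
      by (simp add: scaleR_conv_of_real)
  qed
  then show "(\<lambda>x. \<Sum>f\<in>A. c f *\<^sub>R f x) \<in> V" "l (\<lambda>x. \<Sum>f\<in>A. c f *\<^sub>R f x) = (\<Sum>f\<in>A. c f *\<^sub>R l f)"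
    by auto
qed

text \<open>The functional commutes with the finite sums that define simple integrals, and its bound
  turns both convergences in the seminorm into convergence of scalars; uniqueness of limits gives
  the formula. Values lie in \<open>S\<close> and the functional lives on a possibly larger
  \<open>V\<close>, which allows H10-valued integrals to be tested by functionals on H1.\<close>

lemma bochner_functional:
  assumes B: "has_bochner_fun S N M F P" and S: "S \<subseteq> V"
    and h: "h \<in> borel_measurable M" "AE s in M. l (F s) = h s"
  shows "integrable M h" "l P = (\<integral>s. h s \<partial>M)"
proof -
  obtain \<sigma> where \<sigma>: "\<And>n. simple_function M (\<sigma> n)" "\<And>n. \<sigma> n ` space M \<subseteq> S"
    "\<And>n. emeasure M {s \<in> space M. \<sigma> n s \<noteq> (\<lambda>_. 0)} \<noteq> \<infinity>"
    "\<And>n. integrable M (\<lambda>s. N (F s - \<sigma> n s))"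
    "(\<lambda>n. \<integral>s. N (F s - \<sigma> n s) \<partial>M) \<longlonglongrightarrow> 0"
    "(\<lambda>n. N (P - simple_integral_fun M (\<sigma> n))) \<longlonglongrightarrow> 0"
    and F: "AE s in M. F s \<in> S" and P: "P \<in> S"
    using B unfolding has_bochner_fun_def by blast
  have sf: "simple_function M (\<lambda>s. l (\<sigma> n s))" for n
    by (rule simple_function_compose1[OF \<sigma>(1)])
  have fin: "emeasure M {s \<in> space M. l (\<sigma> n s) \<noteq> 0} \<noteq> \<infinity>" for n
  proof -
    have "{s \<in> space M. \<sigma> n s \<noteq> (\<lambda>_. 0)} \<in> sets M"
    proof -
      have "{s \<in> space M. \<sigma> n s \<noteq> (\<lambda>_. 0)} = space M - (\<sigma> n -` {\<lambda>_. 0} \<inter> space M)" by auto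
      then show ?thesis using simple_functionD(2)[OF \<sigma>(1)] by simp
    qed
    then have "emeasure M {s \<in> space M. l (\<sigma> n s) \<noteq> 0} \<le> emeasure M {s \<in> space M. \<sigma> n s \<noteq> (\<lambda>_. 0)}"
      by (intro emeasure_mono) (auto simp: l_zero)
    then show ?thesis using \<sigma>(3)[of n] by (auto simp: top_unique)
  qed
  have sb: "Bochner_Integration.simple_bochner_integrable M (\<lambda>s. l (\<sigma> n s))" for n
    by (intro Bochner_Integration.simple_bochner_integrable.intros sf fin)
  have ints: "integrable M (\<lambda>s. l (\<sigma> n s))" for n
    by (rule integrable_simple_function[OF sf fin])
  have SI: "simple_integral_fun M (\<sigma> n) \<in> V" "l (simple_integral_fun M (\<sigma> n)) = (\<integral>s. l (\<sigma> n s) \<partial>M)" for n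
  proof -
    have fi: "finite (\<sigma> n ` space M)" "\<sigma> n ` space M \<subseteq> V"
      using simple_functionD(1)[OF \<sigma>(1)] \<sigma>(2)[of n] S by auto
    show "simple_integral_fun M (\<sigma> n) \<in> V"
      unfolding simple_integral_fun_def by (rule combination(1)[OF fi])
    have "(\<integral>s. l (\<sigma> n s) \<partial>M) = Bochner_Integration.simple_bochner_integral M (\<lambda>s. l (\<sigma> n s))"
      by (rule has_bochner_integral_integral_eq[OF has_bochner_integral_simple_bochner_integrable[OF sb]])
    also have "\<dots> = (\<Sum>f\<in>\<sigma> n ` space M. measure M {s \<in> space M. \<sigma> n s = f} *\<^sub>R l f)"
      by (rule Bochner_Integration.simple_bochner_integral_partition[OF sb \<sigma>(1)]) auto
    also have "\<dots> = l (simple_integral_fun M (\<sigma> n))"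
      unfolding simple_integral_fun_def by (rule combination(2)[OF fi, symmetric])
    finally show "l (simple_integral_fun M (\<sigma> n)) = (\<integral>s. l (\<sigma> n s) \<partial>M)" ..
  qed
  have bd: "AE s in M. norm (h s - l (\<sigma> n s)) \<le> K * N (F s - \<sigma> n s)" for n
    using F h(2) AE_space
  proof eventually_elim
    case (elim s)
    then have "F s \<in> V" "\<sigma> n s \<in> V" using S \<sigma>(2)[of n] by auto
    then show ?case using bound[OF diff(1), of "F s" "\<sigma> n s"] diff(2)[of "F s" "\<sigma> n s"] elim by simp
  qed
  have intd: "integrable M (\<lambda>s. h s - l (\<sigma> n s))" for n
  proof (rule Bochner_Integration.integrable_bound[of _ "\<lambda>s. K * N (F s - \<sigma> n s)"])
    show "AE s in M. norm (h s - l (\<sigma> n s)) \<le> norm (K * N (F s - \<sigma> n s))"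
      using bd[of n] by eventually_elim simp
  qed (use \<sigma>(4) h(1) ints in \<open>auto intro: borel_measurable_diff borel_measurable_integrable\<close>)
  show hi: "integrable M h"
    using Bochner_Integration.integrable_add[OF intd ints, of 0 0] by simp
  have "(\<lambda>n. l (simple_integral_fun M (\<sigma> n))) \<longlonglongrightarrow> (\<integral>s. h s \<partial>M)"
  proof (rule LIM_zero_cancel, rule Lim_null_comparison)
    show "\<forall>\<^sub>F n in sequentially. norm (l (simple_integral_fun M (\<sigma> n)) - (\<integral>s. h s \<partial>M)) \<le> K * (\<integral>s. N (F s - \<sigma> n s) \<partial>M)"
    proof (rule always_eventually, rule allI)
      fix n
      have "norm (l (simple_integral_fun M (\<sigma> n)) - (\<integral>s. h s \<partial>M)) = norm (\<integral>s. h s - l (\<sigma> n s) \<partial>M)"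
        using hi ints by (simp add: SI norm_minus_commute)
      also have "\<dots> \<le> (\<integral>s. norm (h s - l (\<sigma> n s)) \<partial>M)" by (rule integral_norm_bound)
      also have "\<dots> \<le> (\<integral>s. K * N (F s - \<sigma> n s) \<partial>M)"
        by (rule integral_mono_AE) (use intd \<sigma>(4) bd in auto)
      finally show "norm (l (simple_integral_fun M (\<sigma> n)) - (\<integral>s. h s \<partial>M)) \<le> K * (\<integral>s. N (F s - \<sigma> n s) \<partial>M)"
        by simp
    qed
    show "(\<lambda>n. K * (\<integral>s. N (F s - \<sigma> n s) \<partial>M)) \<longlonglongrightarrow> 0"
      using tendsto_mult_right_zero[OF \<sigma>(5)] by simp
  qed
  moreover have "(\<lambda>n. l (simple_integral_fun M (\<sigma> n))) \<longlonglongrightarrow> l P"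
  proof (rule LIM_zero_cancel, rule Lim_null_comparison)
    show "\<forall>\<^sub>F n in sequentially. norm (l (simple_integral_fun M (\<sigma> n)) - l P) \<le> K * N (P - simple_integral_fun M (\<sigma> n))"
    proof (rule always_eventually, rule allI)
      fix n
      have PV: "P \<in> V" using P S by auto
      show "norm (l (simple_integral_fun M (\<sigma> n)) - l P) \<le> K * N (P - simple_integral_fun M (\<sigma> n))"
        using bound[OF diff(1)[OF PV SI(1)[of n]]] diff(2)[OF PV SI(1), of n] by (simp add: norm_minus_commute)
    qed
    show "(\<lambda>n. K * N (P - simple_integral_fun M (\<sigma> n))) \<longlonglongrightarrow> 0"
      using tendsto_mult_right_zero[OF \<sigma>(6)] by simp
  qed
  ultimately show "l P = (\<integral>s. h s \<partial>M)" using LIMSEQ_unique by blast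
qed

end

section \<open>Sine modes\<close>

text \<open>Completeness of Lebesgue measure. Norms of chosen representatives are computed only
  almost everywhere, so their measurability has to be inherited from an explicit formula.\<close>

lemma AE_measurable_lebesgue_on:
  fixes f h :: "'a::euclidean_space \<Rightarrow> 'b::euclidean_space"
  assumes f: "f \<in> borel_measurable (lebesgue_on S)" and S: "S \<in> sets lebesgue"
    and ae: "AE x in lebesgue_on S. f x = h x"
  shows "h \<in> borel_measurable (lebesgue_on S)"
proof -
  have "(\<lambda>x. if x \<in> S then h x else 0) \<in> borel_measurable lebesgue"
  proof (rule borel_measurable_AE)
    show "(\<lambda>x. if x \<in> S then f x else 0) \<in> borel_measurable lebesgue"
      using f borel_measurable_if[OF S] by blast
    have "AE x in lebesgue. x \<in> S \<longrightarrow> f x = h x"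
      using ae S by (simp add: AE_restrict_space_iff)
    then show "AE x in lebesgue. (if x \<in> S then f x else 0) = (if x \<in> S then h x else 0)"
      by eventually_elim auto
  qed
  then show ?thesis using borel_measurable_if[OF S] by blast
qed

text \<open>
  The functionals with rational \<open>q\<close> separate \<open>L2 L\<close>. That they are countably many allows
  identities for almost every \<open>s\<close> to be proved one functional at a time.
\<close>
definition half_int :: "real \<Rightarrow> real \<Rightarrow> (real \<Rightarrow> complex) \<Rightarrow> complex" where
  "half_int L q f = (\<integral>x. indicator {..<q} x *\<^sub>R f x \<partial>lebesgue_on {0<..<L})"

lemma integrable_half:
  assumes "f \<in> L2 L"
  shows "integrable (lebesgue_on {0<..<L}) (\<lambda>x. indicator {..<q} x *\<^sub>R f x)"
proof -
  have "{..<q} \<inter> {0<..<L} \<in> sets (lebesgue_on {0<..<L})"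
    by (simp add: sets_restrict_space_iff)
  then have "integrable (lebesgue_on {0<..<L}) (\<lambda>x. indicator ({..<q} \<inter> {0<..<L}) x *\<^sub>R f x)"
    by (rule integrable_mult_indicator[OF _ L2_integrable[OF assms]])
  then show ?thesis
    by (rule Bochner_Integration.integrable_cong[THEN iffD1, rotated -1]) (auto simp: indicator_def)
qed

lemma L2_eq_halflines:
  assumes f: "f1 \<in> L2 L" "f2 \<in> L2 L" and eq: "\<And>q. q \<in> \<rat> \<Longrightarrow> half_int L q f1 = half_int L q f2"
  shows "AE x in lebesgue_on {0<..<L}. f1 x = f2 x"
proof -
  define d where "d x = indicator {0<..<L} x *\<^sub>R (f1 x - f2 x)" for x
  have "AE x in lebesgue. d x = 0"
  proof (rule AE_zero_if_halfline_integrals_zero)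
    show "integrable lebesgue d"
      using L2_integrable[OF L2_diff[OF f]] by (simp add: integrable_restrict_space d_def[abs_def])
    fix q :: real assume "q \<in> \<rat>"
    have "(\<integral>x. indicator {..<q} x *\<^sub>R d x \<partial>lebesgue) = (\<integral>x. indicator {..<q} x *\<^sub>R (f1 x - f2 x) \<partial>lebesgue_on {0<..<L})"
      by (simp add: integral_restrict_space d_def mult.commute)
    also have "\<dots> = half_int L q f1 - half_int L q f2"
      using integrable_half[OF f(1)] integrable_half[OF f(2)] by (simp add: half_int_def scaleR_diff_right)
    finally show "(\<integral>x. indicator {..<q} x *\<^sub>R d x \<partial>lebesgue) = 0" using eq[OF \<open>q \<in> \<rat>\<close>] by simp
  qed
  then have "AE x in lebesgue. x \<in> {0<..<L} \<longrightarrow> f1 x = f2 x"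
    by eventually_elim (auto simp: d_def)
  then show ?thesis by (simp add: AE_restrict_space_iff)
qed

lemma half_int_bound:
  assumes "f \<in> L2 L" "L > 0"
  shows "cmod (half_int L q f) \<le> sqrt L * L2_norm L f"
proof -
  have "cmod (half_int L q f) \<le> (\<integral>x. norm (indicator {..<q} x *\<^sub>R f x) \<partial>lebesgue_on {0<..<L})"
    unfolding half_int_def by (rule integral_norm_bound)
  also have "\<dots> \<le> (\<integral>x. cmod (f x) \<partial>lebesgue_on {0<..<L})"
    by (rule integral_mono[OF integrable_norm[OF integrable_half[OF assms(1)]] integrable_norm[OF L2_integrable[OF assms(1)]]])
      (simp add: indicator_def)
  finally show ?thesis using L1_le_L2_norm[OF assms] by linarith
qed

lemma half_int_cong_AE:
  assumes "f \<in> L2 L" "h \<in> L2 L" "AE x in lebesgue_on {0<..<L}. f x = h x"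
  shows "half_int L q f = half_int L q h"
  unfolding half_int_def
  by (rule integral_cong_AE)
    (use assms integrable_half[of f L q] integrable_half[of h L q] in \<open>auto intro: borel_measurable_integrable\<close>)

lemma bounded_functional_L2:
  assumes "L > 0" shows "bounded_functional (L2 L) (L2_norm L) (half_int L q) (sqrt L)"
proof
  fix f h assume fh: "f \<in> L2 L" "h \<in> L2 L"
  show "f - h \<in> L2 L" using L2_diff[OF fh] by (simp add: fun_diff_def)
  show "half_int L q (f - h) = half_int L q f - half_int L q h"
    using integrable_half[OF fh(1), of q] integrable_half[OF fh(2), of q]
    by (simp add: half_int_def scaleR_diff_right)
next
  fix f c assume f: "f \<in> L2 L"
  show "(\<lambda>x. c * f x) \<in> L2 L" by (rule L2_cmult[OF f])
  show "half_int L q (\<lambda>x. c * f x) = c * half_int L q f"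
  proof -
    have "(\<lambda>x. indicat_real {..<q} x *\<^sub>R (c * f x)) = (\<lambda>x. c * (indicat_real {..<q} x *\<^sub>R f x))" by simp
    then show ?thesis unfolding half_int_def by (simp only: integral_mult_right_zero)
  qed
  show "cmod (half_int L q f) \<le> sqrt L * L2_norm L f" by (rule half_int_bound[OF f assms])
next
  show "(\<lambda>_. 0) \<in> L2 L" by (rule L2_continuous) auto
qed

text \<open>The functional sees \<open>f\<close> only through its weak derivative, so the seminorm
  \<open>H10_norm\<close> bounds it on all of H1. It is exactly linear although
  \<open>weak_deriv\<close> is linear only almost everywhere, because integrals ignore null
  sets.\<close>

lemma bounded_functional_H1:
  assumes "L > 0"
  shows "bounded_functional (H1 L) (H10_norm L) (\<lambda>f. half_int L q (weak_deriv L f)) (sqrt L)"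
proof -
  interpret l: bounded_functional "L2 L" "L2_norm L" "half_int L q" "sqrt L"
    by (rule bounded_functional_L2[OF assms])
  show ?thesis
  proof
    fix f h assume fh: "f \<in> H1 L" "h \<in> H1 L"
    show *: "f - h \<in> H1 L" using weak_deriv_diff(1)[OF fh] by (simp add: fun_diff_def)
    have "half_int L q (weak_deriv L (f - h)) = half_int L q (weak_deriv L f - weak_deriv L h)"
      using weak_deriv_diff(2)[OF fh]
      by (intro half_int_cong_AE H1D(2)[OF *] l.diff H1D(2) fh) (simp add: fun_diff_def)
    then show "half_int L q (weak_deriv L (f - h)) = half_int L q (weak_deriv L f) - half_int L q (weak_deriv L h)"
      using l.diff(2) H1D(2) fh by simp
  next
    fix f c assume f: "f \<in> H1 L"
    show *: "(\<lambda>x. c * f x) \<in> H1 L" by (rule weak_deriv_cmult(1)[OF f])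
    have "half_int L q (weak_deriv L (\<lambda>x. c * f x)) = half_int L q (\<lambda>x. c * weak_deriv L f x)"
      using weak_deriv_cmult(2)[OF f] by (intro half_int_cong_AE H1D(2)[OF *] l.cmult H1D(2) f)
    then show "half_int L q (weak_deriv L (\<lambda>x. c * f x)) = c * half_int L q (weak_deriv L f)"
      using l.cmult(2)[OF H1D(2)[OF f]] by simp
    show "cmod (half_int L q (weak_deriv L f)) \<le> sqrt L * H10_norm L f"
      unfolding H10_norm_def by (rule l.bound[OF H1D(2)[OF f]])
  next
    show "(\<lambda>_. 0) \<in> H1 L" by (rule is_weak_deriv_C1(4)[of _ "\<lambda>_. 0"]) auto
  qed
qed

lemma H10_subset: "H10 L \<subseteq> H1 L" by (auto simp: H10_def)

text \<open>The condition on the sine encodes \<mu> = n \<pi> / L without naming n.\<close>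

locale sine_mode =
  fixes L \<mu> :: real
  assumes L: "L > 0" and \<mu>: "\<mu> > 0" and sinL: "sin (\<mu> * L) = 0"
begin

definition S :: "real \<Rightarrow> complex" where "S x = of_real (sin (\<mu> * x))"
definition C :: "real \<Rightarrow> complex" where "C x = of_real (\<mu> * cos (\<mu> * x))"

lemma S_deriv: "(S has_vector_derivative C x) (at x)"
  unfolding S_def[abs_def] C_def
  by (intro has_vector_derivative_of_real) (auto intro!: derivative_eq_intros)

lemma C_deriv: "(C has_vector_derivative - (of_real \<mu>)\<^sup>2 * S x) (at x)"
proof -
  have "(C has_vector_derivative of_real (\<mu> * (- sin (\<mu> * x) * \<mu>))) (at x)"
    unfolding C_def[abs_def]
    by (intro has_vector_derivative_of_real) (auto intro!: derivative_eq_intros)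
  then show ?thesis by (simp add: S_def power2_eq_square mult_ac)
qed

lemma continuous_S: "continuous_on UNIV S" and continuous_C: "continuous_on UNIV C"
  unfolding S_def[abs_def] C_def[abs_def] by (intro continuous_intros)+

lemma scaled_S_deriv: "((\<lambda>x. c * S x) has_vector_derivative c * C x) (at x)"
  by (rule has_vector_derivative_mult_right[OF S_deriv])

lemma scaled_C_deriv: "((\<lambda>x. c * C x) has_vector_derivative c * (- (of_real \<mu>)\<^sup>2 * S x)) (at x)"
  by (rule has_vector_derivative_mult_right[OF C_deriv])

lemma continuous_scaled: "continuous_on UNIV (\<lambda>x. c * C x)" "continuous_on UNIV (\<lambda>x. c * S x)"
  by (intro continuous_intros continuous_S continuous_C)+

text \<open>Left of the midpoint |sin t| \<le> |t| is used directly; right of it, sin (\<mu> L) = 0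
  allows reflecting to L - x. In each half the other factor is at least L / 2, which is the origin
  of 2 / L in the constant.\<close>

lemma abs_sin_mode_le:
  assumes "x \<in> {0<..<L}" shows "\<bar>sin (\<mu> * x)\<bar> \<le> 2 * \<mu> / L * (x * (L - x))"
proof (cases "x \<le> L / 2")
  case True
  have "\<bar>sin (\<mu> * x)\<bar> \<le> \<bar>\<mu> * x\<bar>" by (rule abs_sin_x_le_abs_x)
  also have "\<dots> = 2 * \<mu> / L * (x * (L / 2))" using assms \<mu> L by (simp add: field_simps)
  also have "\<dots> \<le> 2 * \<mu> / L * (x * (L - x))"
    using True assms \<mu> L by (intro mult_left_mono) auto
  finally show ?thesis .
next
  case False
  have "sin (\<mu> * x) = sin (\<mu> * L - \<mu> * (L - x))" by (simp add: algebra_simps)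
  then have "\<bar>sin (\<mu> * x)\<bar> = \<bar>cos (\<mu> * L)\<bar> * \<bar>sin (\<mu> * (L - x))\<bar>"
    by (simp add: sin_diff sinL abs_mult)
  also have "\<dots> \<le> 1 * \<bar>\<mu> * (L - x)\<bar>"
    by (intro mult_mono abs_sin_x_le_abs_x) auto
  also have "\<dots> = 2 * \<mu> / L * (L / 2 * (L - x))" using assms \<mu> L by (simp add: field_simps)
  also have "\<dots> \<le> 2 * \<mu> / L * (x * (L - x))"
    using False assms \<mu> L by (intro mult_left_mono mult_right_mono) auto
  finally show ?thesis .
qed

lemma scaled_S_H10: "(\<lambda>x. c * S x) \<in> H10 L"
proof (rule H10_C1[OF L scaled_S_deriv continuous_scaled(1)])
  fix x assume x: "x \<in> {0<..<L}"
  have "cmod (c * S x) = cmod c * \<bar>sin (\<mu> * x)\<bar>" by (simp add: S_def norm_mult)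
  also have "\<dots> \<le> cmod c * (2 * \<mu> / L * (x * (L - x)))"
    by (intro mult_left_mono abs_sin_mode_le x) auto
  finally show "cmod (c * S x) \<le> cmod c * (2 * \<mu> / L) * (x * (L - x))" by (simp add: mult.assoc)
qed

definition \<kappa> where "\<kappa> = L2_norm L C"
definition \<rho> where "\<rho> = L2_norm L S"

text \<open>sin (2 \<mu> L) = 0 makes the integral of the squared sine equal to L / 2. Positivity is
  what later allows the norm of the eigenvector to be cancelled.\<close>

lemma \<rho>_pos: "\<rho> > 0"
proof -
  have "((\<lambda>x. (sin (\<mu> * x))\<^sup>2) has_integral ((L / 2 - sin (2 * \<mu> * L) / (4 * \<mu>)) - (0 / 2 - sin (2 * \<mu> * 0) / (4 * \<mu>)))) {0..L}"
  proof (rule fundamental_theorem_of_calculus)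
    fix x assume "x \<in> {0..L}"
    have "((\<lambda>x. x / 2 - sin (2 * \<mu> * x) / (4 * \<mu>)) has_real_derivative (1/2 - cos (2 * \<mu> * x) * (2 * \<mu>) / (4 * \<mu>))) (at x within {0..L})"
      by (auto intro!: derivative_eq_intros)
    moreover have "1/2 - cos (2 * \<mu> * x) * (2 * \<mu>) / (4 * \<mu>) = (sin (\<mu> * x))\<^sup>2"
      using \<mu> cos_double_sin[of "\<mu> * x"] by (simp add: field_simps)
    ultimately show "((\<lambda>x. x / 2 - sin (2 * \<mu> * x) / (4 * \<mu>)) has_vector_derivative (sin (\<mu> * x))\<^sup>2) (at x within {0..L})"
      by (simp add: has_real_derivative_iff_has_vector_derivative)
  qed (use L in simp)
  moreover have "sin (2 * \<mu> * L) = 0"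
    using sin_double[of "\<mu> * L"] sinL by (simp add: mult.assoc)
  ultimately have "((\<lambda>x. (sin (\<mu> * x))\<^sup>2) has_integral L / 2) {0<..<L}"
    by (simp add: has_integral_Icc_iff_Ioo)
  moreover have "integrable (lebesgue_on {0<..<L}) (\<lambda>x. (sin (\<mu> * x))\<^sup>2)"
    using L2_continuous[OF continuous_S, of L] by (simp add: L2_def S_def)
  ultimately have "(\<integral>x. (sin (\<mu> * x))\<^sup>2 \<partial>lebesgue_on {0<..<L}) = L / 2"
    using lebesgue_integral_eq_integral by (metis integral_unique lmeasurable_interval(2) fmeasurableD)
  then show ?thesis using L by (simp add: \<rho>_def L2_norm_eq S_def)
qed

text \<open>Only the weak derivative is pinned down, which fixes \<open>f\<close> up to an additive
  constant: \<open>H10_norm\<close> sees nothing else, and the derivative is all that the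
  functionals can identify.\<close>

definition repH :: "(real \<Rightarrow> complex) \<Rightarrow> complex \<Rightarrow> bool" where
  "repH f c \<longleftrightarrow> f \<in> H1 L \<and> (AE x in lebesgue_on {0<..<L}. weak_deriv L f x = c * C x)"

definition repL :: "(real \<Rightarrow> complex) \<Rightarrow> complex \<Rightarrow> bool" where
  "repL f c \<longleftrightarrow> f \<in> L2 L \<and> (AE x in lebesgue_on {0<..<L}. f x = c * S x)"

lemma repH_S: "repH (\<lambda>x. c * S x) c"
  using is_weak_deriv_C1[OF scaled_S_deriv continuous_scaled(1), where L=L] weak_derivI(3)
  by (auto simp: repH_def)

lemma repL_S: "repL (\<lambda>x. c * S x) c"
  using L2_continuous[OF continuous_scaled(2)] by (auto simp: repL_def)

lemma repH_diff:
  assumes "repH f c" "repH h d" shows "repH (f - h) (c - d)"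
proof -
  have H: "f \<in> H1 L" "h \<in> H1 L" using assms by (auto simp: repH_def)
  have "AE x in lebesgue_on {0<..<L}. weak_deriv L f x = c * C x" "AE x in lebesgue_on {0<..<L}. weak_deriv L h x = d * C x"
    using assms by (auto simp: repH_def)
  with weak_deriv_diff(2)[OF H] have "AE x in lebesgue_on {0<..<L}. weak_deriv L (\<lambda>x. f x - h x) x = (c - d) * C x"
    by eventually_elim (simp add: left_diff_distrib)
  with weak_deriv_diff(1)[OF H] show ?thesis by (simp add: repH_def fun_diff_def)
qed

lemma repH_cmult:
  assumes "repH f c" shows "repH (\<lambda>x. a * f x) (a * c)"
proof -
  have H: "f \<in> H1 L" "AE x in lebesgue_on {0<..<L}. weak_deriv L f x = c * C x"
    using assms by (auto simp: repH_def)
  from H(2) weak_deriv_cmult(2)[OF H(1), of a] have "AE x in lebesgue_on {0<..<L}. weak_deriv L (\<lambda>x. a * f x) x = a * c * C x"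
    by eventually_elim simp
  with weak_deriv_cmult(1)[OF H(1)] show ?thesis by (simp add: repH_def)
qed

lemma repL_diff:
  assumes "repL f c" "repL h d" shows "repL (f - h) (c - d)"
proof -
  have "AE x in lebesgue_on {0<..<L}. f x = c * S x" "AE x in lebesgue_on {0<..<L}. h x = d * S x"
    using assms by (auto simp: repL_def)
  then have "AE x in lebesgue_on {0<..<L}. f x - h x = (c - d) * S x"
    by eventually_elim (simp add: left_diff_distrib)
  then show ?thesis using assms L2_diff[of f L h] by (simp add: repL_def fun_diff_def)
qed

lemma repL_cmult:
  assumes "repL f c" shows "repL (\<lambda>x. a * f x) (a * c)"
proof -
  have "AE x in lebesgue_on {0<..<L}. f x = c * S x" using assms by (auto simp: repL_def)
  then have "AE x in lebesgue_on {0<..<L}. a * f x = a * c * S x" by eventually_elim simp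
  then show ?thesis using assms L2_cmult[of f L a] by (simp add: repL_def)
qed

lemma L2_norm_scaled: "L2_norm L (\<lambda>x. c * f x) = cmod c * L2_norm L f"
  by (simp add: L2_norm_eq norm_mult power_mult_distrib real_sqrt_mult)

lemma repH_norm: "repH f c \<Longrightarrow> H10_norm L f = cmod c * \<kappa>"
  using L2_norm_cong_AE[of "weak_deriv L f" L "\<lambda>x. c * C x"] H1D(2)[of f L]
    L2_continuous[OF continuous_scaled(1)]
  by (simp add: repH_def H10_norm_def \<kappa>_def L2_norm_scaled)

lemma repL_norm: "repL f c \<Longrightarrow> L2_norm L f = cmod c * \<rho>"
  using L2_norm_cong_AE[of f L "\<lambda>x. c * S x"] L2_continuous[OF continuous_scaled(2)]
  by (simp add: repL_def \<rho>_def L2_norm_scaled)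

lemma H10_norm_diff_S: "H10_norm L ((\<lambda>x. c * S x) - (\<lambda>x. d * S x)) = cmod (c - d) * \<kappa>"
  by (intro repH_norm repH_diff repH_S)

lemma C_nonzero: "C 0 \<noteq> 0" and S_nonzero: "S (pi / (2 * \<mu>)) \<noteq> 0"
  using \<mu> by (auto simp: C_def S_def)

end

lemma borel_measurable_weight:
  "borel_measurable (weight_measure g) = borel_measurable (lebesgue_on {0<..})"
  by (rule measurable_cong_sets) (simp_all add: weight_measure_def)

section \<open>Histories whose values are multiples of one sine mode\<close>

locale weighted_sine_mode = sine_mode +
  fixes g :: "real \<Rightarrow> real"
  assumes g_int: "integrable (lebesgue_on {0<..}) g" and g_pos: "\<And>s. s > 0 \<Longrightarrow> g s > 0"
begin

abbreviation "wm \<equiv> weight_measure g"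

lemma space_wm [simp]: "space wm = {0<..}" by (simp add: weight_measure_def)

lemma AE_wm: "(AE s in wm. P s) \<longleftrightarrow> (AE s in lebesgue_on {0<..}. P s)"
proof -
  have "(AE s in wm. P s) \<longleftrightarrow> (AE s in lebesgue_on {0<..}. 0 < ennreal (g s) \<longrightarrow> P s)"
    unfolding weight_measure_def using g_int by (intro AE_density) auto
  also have "\<dots> \<longleftrightarrow> (AE s in lebesgue_on {0<..}. P s)"
    by (rule AE_cong) (simp add: g_pos)
  finally show ?thesis .
qed

lemma AE_measurable_wm:
  fixes f h :: "real \<Rightarrow> 'b::euclidean_space"
  assumes "f \<in> borel_measurable wm" "AE s in wm. f s = h s" shows "h \<in> borel_measurable wm"
  using AE_measurable_lebesgue_on[of f "{0<..}" h] assms by (simp add: AE_wm borel_measurable_weight)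

definition repW :: "(real \<Rightarrow> real \<Rightarrow> complex) \<Rightarrow> (real \<Rightarrow> complex) \<Rightarrow> bool" where
  "repW \<omega> h \<longleftrightarrow> (AE s in wm. repH (\<omega> s) (h s))"

text \<open>The integrand on the left involves chosen weak derivatives; its measurability is
  inherited from the explicit right-hand side through an almost-everywhere identity.\<close>

lemma repW_norm_integral:
  assumes "repW \<omega> h" "h \<in> borel_measurable wm"
  shows "(\<integral>s. (H10_norm L (\<omega> s))\<^sup>2 \<partial>wm) = \<kappa>\<^sup>2 * (\<integral>s. (cmod (h s))\<^sup>2 \<partial>wm)"
proof -
  have m: "(\<lambda>s. (cmod (h s) * \<kappa>)\<^sup>2) \<in> borel_measurable wm"
    using assms(2) by measurable
  have ae: "AE s in wm. (cmod (h s) * \<kappa>)\<^sup>2 = (H10_norm L (\<omega> s))\<^sup>2"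
    using assms(1)[unfolded repW_def] by eventually_elim (simp add: repH_norm)
  have "(\<integral>s. (H10_norm L (\<omega> s))\<^sup>2 \<partial>wm) = (\<integral>s. (cmod (h s) * \<kappa>)\<^sup>2 \<partial>wm)"
    by (rule integral_cong_AE[symmetric, OF m AE_measurable_wm[OF m ae] ae])
  then show ?thesis by (simp add: power_mult_distrib mult.commute)
qed

lemma scaled_history_L2g:
  assumes h: "h \<in> borel_measurable wm" "integrable wm (\<lambda>s. (cmod (h s))\<^sup>2)"
  shows "(\<lambda>s x. h s * S x) \<in> L2g L g"
proof -
  have "bochner_measurable (H10 L) (H10_norm L) wm (\<lambda>s x. h s * S x)"
    by (rule bochner_measurable_scalar[where \<psi>=S and h=h and \<kappa>=\<kappa>]) (use h scaled_S_H10 H10_norm_diff_S in auto)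
  moreover have "integrable wm (\<lambda>s. (H10_norm L (\<lambda>x. h s * S x))\<^sup>2)"
    using h(2) by (simp add: repH_norm[OF repH_S] power_mult_distrib)
  ultimately show ?thesis by (simp add: L2g_def scaled_S_H10)
qed

text \<open>The scalar case provides one Bochner integral, so the choice in
  \<open>memory_int\<close> satisfies the predicate; applying the separating functionals to whatever
  was chosen identifies it up to a null set.\<close>

lemma memory_int_scaled:
  assumes h: "integrable wm h"
  shows "memory_int L g (\<lambda>s x. h s * S x) \<in> L2 L"
    "AE x in lebesgue_on {0<..<L}. memory_int L g (\<lambda>s x. h s * S x) x = (\<integral>s. h s \<partial>wm) * C x"
proof -
  define F where "F s = weak_deriv L (\<lambda>x. h s * S x)" for s
  have FL2: "F s \<in> L2 L" and FAE: "AE x in lebesgue_on {0<..<L}. F s x = h s * C x" for s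
    using repH_S[of "h s"] H1D(2) by (auto simp: repH_def F_def)
  have CL2: "(\<lambda>x. c * C x) \<in> L2 L" for c by (rule L2_continuous[OF continuous_scaled(1)])
  have Ndiff: "L2_norm L ((\<lambda>x. c * C x) - (\<lambda>x. d * C x)) = cmod (c - d) * \<kappa>" for c d
    using L2_norm_scaled[of "c - d" C] by (simp add: fun_diff_def \<kappa>_def left_diff_distrib)
  have N: "L2_norm L (F s - (\<lambda>x. c * C x)) = cmod (h s - c) * \<kappa>" for s c
  proof -
    have "L2_norm L (F s - (\<lambda>x. c * C x)) = L2_norm L ((\<lambda>x. h s * C x) - (\<lambda>x. c * C x))"
    proof (rule L2_norm_cong_AE)
      show "F s - (\<lambda>x. c * C x) \<in> L2 L" "(\<lambda>x. h s * C x) - (\<lambda>x. c * C x) \<in> L2 L"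
        using L2_diff[OF FL2 CL2] L2_diff[OF CL2 CL2] by (simp_all add: fun_diff_def)
      show "AE x in lebesgue_on {0<..<L}. (F s - (\<lambda>x. c * C x)) x = ((\<lambda>x. h s * C x) - (\<lambda>x. c * C x)) x"
        using FAE by eventually_elim simp
    qed
    then show ?thesis by (simp add: Ndiff)
  qed
  have "has_bochner_fun (L2 L) (L2_norm L) wm F (\<lambda>x. (\<integral>s. h s \<partial>wm) * C x)"
    by (rule has_bochner_fun_scalar[where \<kappa>=\<kappa>, OF CL2 FL2 N Ndiff C_nonzero h])
  then have B: "has_bochner_fun (L2 L) (L2_norm L) wm F (memory_int L g (\<lambda>s x. h s * S x))"
    unfolding memory_int_def F_def
    by (rule someI[where P="has_bochner_fun (L2 L) (L2_norm L) wm (\<lambda>s. weak_deriv L (\<lambda>x. h s * S x))"])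
  then show P: "memory_int L g (\<lambda>s x. h s * S x) \<in> L2 L" by (simp add: has_bochner_fun_def)
  show "AE x in lebesgue_on {0<..<L}. memory_int L g (\<lambda>s x. h s * S x) x = (\<integral>s. h s \<partial>wm) * C x"
  proof (rule L2_eq_halflines[OF P CL2])
    fix q :: real
    interpret l: bounded_functional "L2 L" "L2_norm L" "half_int L q" "sqrt L"
      by (rule bounded_functional_L2[OF L])
    have C: "C \<in> L2 L" using CL2[of 1] by simp
    have lF: "half_int L q (F s) = h s * half_int L q C" for s
      using half_int_cong_AE[OF FL2 CL2 FAE] l.cmult(2)[OF C] by simp
    have "half_int L q (memory_int L g (\<lambda>s x. h s * S x)) = (\<integral>s. h s * half_int L q C \<partial>wm)"
      by (rule l.bochner_functional(2)[OF B]) (use h lF in auto)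
    then show "half_int L q (memory_int L g (\<lambda>s x. h s * S x)) = half_int L q (\<lambda>x. (\<integral>s. h s \<partial>wm) * C x)"
      using l.cmult(2)[OF C] h by simp
  qed
qed

text \<open>On the simple approximants the functional is a simple scalar function, and pointwise
  limits of these are measurable. Convergence to the value at \<eta> s holds only almost everywhere,
  so completeness finishes the argument.\<close>

lemma L2g_functional_measurable:
  assumes \<eta>: "\<eta> \<in> L2g L g"
  shows "(\<lambda>s. half_int L q (weak_deriv L (\<eta> s))) \<in> borel_measurable wm"
proof -
  interpret l: bounded_functional "H1 L" "H10_norm L" "\<lambda>f. half_int L q (weak_deriv L f)" "sqrt L"
    by (rule bounded_functional_H1[OF L])
  obtain \<tau> where \<tau>: "\<And>n. simple_function wm (\<tau> n)" "\<And>n. \<tau> n ` space wm \<subseteq> H10 L"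
    "AE s in wm. (\<lambda>n. H10_norm L (\<eta> s - \<tau> n s)) \<longlonglongrightarrow> 0" and \<eta>H: "AE s in wm. \<eta> s \<in> H10 L"
    using \<eta> unfolding L2g_def bochner_measurable_def by blast
  define k where "k n s = half_int L q (weak_deriv L (\<tau> n s))" for n s
  have k: "k n \<in> borel_measurable wm" for n
    unfolding k_def
    by (rule borel_measurable_simple_function, rule simple_function_compose1[OF \<tau>(1)])
  show ?thesis
  proof (rule AE_measurable_wm)
    show "(\<lambda>s. lim (\<lambda>n. k n s)) \<in> borel_measurable wm"
      by (rule borel_measurable_lim_metric[OF k])
    show "AE s in wm. lim (\<lambda>n. k n s) = half_int L q (weak_deriv L (\<eta> s))"
      using \<tau>(3) \<eta>H AE_space
    proof eventually_elim
      case (elim s)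
      have "(\<lambda>n. k n s) \<longlonglongrightarrow> half_int L q (weak_deriv L (\<eta> s))"
      proof (rule LIM_zero_cancel, rule Lim_null_comparison)
        show "\<forall>\<^sub>F n in sequentially. norm (k n s - half_int L q (weak_deriv L (\<eta> s))) \<le> sqrt L * H10_norm L (\<eta> s - \<tau> n s)"
        proof (rule always_eventually, rule allI)
          fix n
          have "\<eta> s \<in> H1 L" "\<tau> n s \<in> H1 L" using elim \<tau>(2)[of n] H10_subset by auto
          then show "norm (k n s - half_int L q (weak_deriv L (\<eta> s))) \<le> sqrt L * H10_norm L (\<eta> s - \<tau> n s)"
            using l.bound[OF l.diff(1), of "\<eta> s" "\<tau> n s"] l.diff(2)[of "\<eta> s" "\<tau> n s"]
            by (simp add: k_def norm_minus_commute)
        qed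
        show "(\<lambda>n. sqrt L * H10_norm L (\<eta> s - \<tau> n s)) \<longlonglongrightarrow> 0"
          using tendsto_mult_right_zero[OF elim(1)] by simp
      qed
      then show ?case by (rule limI)
    qed
  qed
qed

text \<open>A test function times the history is a scalar function of s times the fixed mode, so
  both Bochner integrals are scalar integrals times \<open>S\<close>, and scalar integration by
  parts applies.\<close>

lemma weak_ds_scaled:
  assumes h: "\<And>s. (h has_vector_derivative h' s) (at s)" "continuous_on UNIV h'"
  shows "is_weak_ds L (\<lambda>s x. h s * S x) (\<lambda>s x. h' s * S x)"
  unfolding is_weak_ds_def
proof
  fix \<phi> :: "real \<Rightarrow> complex" assume \<phi>: "\<phi> \<in> test_fun {0<..}"
  have I: "{0::real<..} \<in> sets lebesgue" by simp
  note parts = compact_support_parts[OF \<phi> I h]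
  let ?M = "lebesgue_on {0<..}"
  have i1: "integrable ?M (\<lambda>s. vector_derivative \<phi> (at s) * h s)"
    and i2: "integrable ?M (\<lambda>s. \<phi> s * h' s)"
    using parts(1,2) by (simp_all add: mult.commute)
  let ?P = "\<lambda>x. (\<integral>s. vector_derivative \<phi> (at s) * h s \<partial>?M) * S x"
  have "has_bochner_fun (H10 L) (H10_norm L) ?M (\<lambda>s x. (vector_derivative \<phi> (at s) * h s) * S x) ?P"
    by (rule has_bochner_fun_scalar[where \<kappa>=\<kappa>, OF scaled_S_H10 scaled_S_H10 H10_norm_diff_S H10_norm_diff_S S_nonzero i1])
  moreover have "has_bochner_fun (H10 L) (H10_norm L) ?M (\<lambda>s x. (\<phi> s * h' s) * S x) (\<lambda>x. (\<integral>s. \<phi> s * h' s \<partial>?M) * S x)"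
    by (rule has_bochner_fun_scalar[where \<kappa>=\<kappa>, OF scaled_S_H10 scaled_S_H10 H10_norm_diff_S H10_norm_diff_S S_nonzero i2])
  moreover have "(\<lambda>x. (\<integral>s. \<phi> s * h' s \<partial>?M) * S x) = - ?P"
    using parts(3) by (simp add: fun_eq_iff mult.commute)
  ultimately show "\<exists>P. has_bochner_fun (H10 L) (H10_norm L) ?M (\<lambda>s x. vector_derivative \<phi> (at s) * (h s * S x)) P \<and>
      has_bochner_fun (H10 L) (H10_norm L) ?M (\<lambda>s x. \<phi> s * (h' s * S x)) (- P)"
    by (intro exI[of _ ?P]) (simp add: mult.assoc)
qed

text \<open>\<eta> is arbitrary, so the choice in \<open>weak_ds\<close> is covered. Each functional
  turns the weak equation into a scalar one, which the fundamental lemma solves in s. Countability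
  of the rationals gives one null set of s for all functionals, and for the remaining s they
  determine the weak derivative in x.\<close>

lemma weak_ds_unique:
  assumes h: "\<And>s. (h has_vector_derivative h' s) (at s)" "continuous_on UNIV h'"
    and \<eta>: "\<eta> \<in> L2g L g" "is_weak_ds L (\<lambda>s x. h s * S x) \<eta>"
  shows "repW \<eta> h'"
proof -
  let ?M = "lebesgue_on {0<..}"
  have \<eta>H: "AE s in ?M. \<eta> s \<in> H1 L"
    using \<eta>(1) H10_subset unfolding L2g_def AE_wm[symmetric] by (auto elim: eventually_mono)
  have key: "AE s in ?M. half_int L q (weak_deriv L (\<eta> s)) = h' s * half_int L q (weak_deriv L S)" for q
  proof -
    interpret l: bounded_functional "H1 L" "H10_norm L" "\<lambda>f. half_int L q (weak_deriv L f)" "sqrt L"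
      by (rule bounded_functional_H1[OF L])
    define k where "k s = half_int L q (weak_deriv L (\<eta> s))" for s
    define c where "c = half_int L q (weak_deriv L S)"
    have km: "k \<in> borel_measurable ?M"
      using L2g_functional_measurable[OF \<eta>(1), of q] by (simp add: k_def[abs_def] borel_measurable_weight)
    have hm: "h' \<in> borel_measurable ?M" by (rule continuous_measurable_lebesgue_on[OF h(2)])
    have SH1: "S \<in> H1 L" using repH_S[of 1] by (simp add: repH_def)
    have *: "integrable ?M (\<lambda>s. (k s - h' s * c) * \<phi> s)" "(\<integral>s. (k s - h' s * c) * \<phi> s \<partial>?M) = 0"
      if \<phi>: "\<phi> \<in> test_fun {0<..}" for \<phi>
    proof -
      have I: "{0::real<..} \<in> sets lebesgue" by simp
      note parts = compact_support_parts[OF \<phi> I h]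
      obtain P where P: "has_bochner_fun (H10 L) (H10_norm L) ?M (\<lambda>s x. vector_derivative \<phi> (at s) * (h s * S x)) P"
        "has_bochner_fun (H10 L) (H10_norm L) ?M (\<lambda>s x. \<phi> s * \<eta> s x) (- P)"
        using \<eta>(2) \<phi> unfolding is_weak_ds_def by blast
      have \<phi>m: "\<phi> \<in> borel_measurable ?M"
        by (rule continuous_measurable_lebesgue_on[OF test_fun_bounded(2)[OF \<phi>]])
      have 1: "half_int L q (weak_deriv L P) = (\<integral>s. h s * vector_derivative \<phi> (at s) * c \<partial>?M)"
      proof (rule l.bochner_functional(2)[OF P(1) H10_subset])
        show "AE s in ?M. half_int L q (weak_deriv L (\<lambda>x. vector_derivative \<phi> (at s) * (h s * S x))) = h s * vector_derivative \<phi> (at s) * c"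
        proof (rule AE_I2)
          fix s
          have "(\<lambda>x. vector_derivative \<phi> (at s) * (h s * S x)) = (\<lambda>x. (h s * vector_derivative \<phi> (at s)) * S x)"
            by (simp add: mult_ac)
          then show "half_int L q (weak_deriv L (\<lambda>x. vector_derivative \<phi> (at s) * (h s * S x))) = h s * vector_derivative \<phi> (at s) * c"
            unfolding c_def by (simp only: l.cmult(2)[OF SH1])
        qed
        show "(\<lambda>s. h s * vector_derivative \<phi> (at s) * c) \<in> borel_measurable ?M"
          by (rule borel_measurable_integrable[OF integrable_mult_left[OF parts(1)]])
      qed
      have ae: "AE s in ?M. half_int L q (weak_deriv L (\<lambda>x. \<phi> s * \<eta> s x)) = \<phi> s * k s"
        using \<eta>H by eventually_elim (simp add: l.cmult(2) k_def)
      have m: "(\<lambda>s. \<phi> s * k s) \<in> borel_measurable ?M" by (rule borel_measurable_times[OF \<phi>m km])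
      \<comment> \<open>Integrability of the scalar product is a consequence of the existence of the
        Bochner integral of \<phi> times \<eta>.\<close>
      have 2: "integrable ?M (\<lambda>s. \<phi> s * k s)" "half_int L q (weak_deriv L (- P)) = (\<integral>s. \<phi> s * k s \<partial>?M)"
        by (rule l.bochner_functional[OF P(2) H10_subset m ae])+
      have "P \<in> H1 L" using P(1) H10_subset by (auto simp: has_bochner_fun_def)
      from l.cmult(2)[OF this, of "-1"] have "half_int L q (weak_deriv L (- P)) = - half_int L q (weak_deriv L P)"
        by (simp add: fun_Compl_def)
      then have "(\<integral>s. \<phi> s * k s \<partial>?M) = (\<integral>s. h' s * \<phi> s \<partial>?M) * c"
        using 1 2(2) parts(3) by simp
      moreover have eq: "(\<lambda>s. (k s - h' s * c) * \<phi> s) = (\<lambda>s. \<phi> s * k s - h' s * \<phi> s * c)"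
        by (simp add: fun_eq_iff algebra_simps)
      moreover note i = integrable_mult_left[OF parts(2), of c]
      ultimately show "integrable ?M (\<lambda>s. (k s - h' s * c) * \<phi> s)" "(\<integral>s. (k s - h' s * c) * \<phi> s \<partial>?M) = 0"
        unfolding eq using Bochner_Integration.integrable_diff[OF 2(1) i] Bochner_Integration.integral_diff[OF 2(1) i]
        by simp_all
    qed
    have "AE s in ?M. k s - h' s * c = 0"
    proof (rule fundamental_lemma[OF _ _ *])
      show "(\<lambda>s. k s - h' s * c) \<in> borel_measurable ?M"
        by (intro borel_measurable_diff borel_measurable_times borel_measurable_const km hm)
    qed simp_all
    then show ?thesis by (simp add: k_def c_def)
  qed
  have "AE s in ?M. \<forall>q\<in>\<rat>. half_int L q (weak_deriv L (\<eta> s)) = h' s * half_int L q (weak_deriv L S)"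
    using key by (intro AE_ball_countable[THEN iffD2]) (auto simp: countable_rat)
  then have "AE s in ?M. repH (\<eta> s) (h' s)"
    using \<eta>H
  proof eventually_elim
    case (elim s)
    have "AE x in lebesgue_on {0<..<L}. weak_deriv L (\<eta> s) x = h' s * C x"
    proof (rule L2_eq_halflines)
      show "weak_deriv L (\<eta> s) \<in> L2 L" by (rule H1D(2)[OF elim(2)])
      show CL2: "(\<lambda>x. h' s * C x) \<in> L2 L" by (rule L2_continuous[OF continuous_scaled(1)])
      fix q :: real assume "q \<in> \<rat>"
      interpret l: bounded_functional "L2 L" "L2_norm L" "half_int L q" "sqrt L"
        by (rule bounded_functional_L2[OF L])
      have W: "weak_deriv L S \<in> L2 L" "AE x in lebesgue_on {0<..<L}. weak_deriv L S x = C x"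
        using repH_S[of 1] H1D(2) by (auto simp: repH_def)
      have CL: "C \<in> L2 L" by (rule L2_continuous[OF continuous_C])
      show "half_int L q (weak_deriv L (\<eta> s)) = half_int L q (\<lambda>x. h' s * C x)"
        using elim(1) \<open>q \<in> \<rat>\<close> half_int_cong_AE[OF W(1) CL W(2)] l.cmult(2)[OF CL] by simp
    qed
    with elim show ?case by (simp add: repH_def)
  qed
  then show ?thesis by (simp add: repW_def AE_wm)
qed

end

section \<open>Exponential solutions\<close>

lemma scale_state_of_real:
  "scale_state c (u, v, y, z, \<omega>) = ((\<lambda>x. of_real c * u x), (\<lambda>x. of_real c * v x),
     (\<lambda>x. of_real c * y x), (\<lambda>x. of_real c * z x), (\<lambda>s x. of_real c * \<omega> s x))"
  by (simp add: scaleR_conv_of_real)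

context weighted_sine_mode
begin

text \<open>Applied to the weak derivative of y and to the flux: both equal multiples of the cosine
  only almost everywhere, yet one more differentiation gives -\<mu>^2 times the sine.\<close>

lemma C_multiple_H1:
  assumes f: "f \<in> L2 L" and ae: "AE x in lebesgue_on {0<..<L}. f x = c * C x"
  shows "f \<in> H1 L" "repL (weak_deriv L f) (- (of_real \<mu>)\<^sup>2 * c)"
proof -
  have d: "((\<lambda>x. c * C x) has_vector_derivative - (of_real \<mu>)\<^sup>2 * c * S x) (at x)" for x
    using scaled_C_deriv[of c x] by (simp add: mult_ac)
  note D = is_weak_deriv_C1[OF d continuous_scaled(2), where L=L]
  have w: "is_weak_deriv L f (\<lambda>x. - (of_real \<mu>)\<^sup>2 * c * S x)"
    by (rule is_weak_deriv_cong[OF D(2) f _ D(1)]) (use ae in eventually_elim, simp)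
  show "f \<in> H1 L" by (rule H1I[OF f D(3) w])
  show "repL (weak_deriv L f) (- (of_real \<mu>)\<^sup>2 * c)"
    using weak_derivI[OF D(3) w] by (simp add: repL_def)
qed

lemma flux_scaled:
  assumes "integrable wm h"
  shows "flux L a g (\<lambda>x. c * S x) (\<lambda>s x. h s * S x) \<in> L2 L"
    "AE x in lebesgue_on {0<..<L}. flux L a g (\<lambda>x. c * S x) (\<lambda>s x. h s * S x) x = (of_real (a_tilde a g) * c + (\<integral>s. h s \<partial>wm)) * C x"
proof -
  have W: "weak_deriv L (\<lambda>x. c * S x) \<in> L2 L" "AE x in lebesgue_on {0<..<L}. weak_deriv L (\<lambda>x. c * S x) x = c * C x"
    using repH_S[of c] H1D(2) by (auto simp: repH_def)
  note m = memory_int_scaled[OF assms]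
  show "flux L a g (\<lambda>x. c * S x) (\<lambda>s x. h s * S x) \<in> L2 L"
    unfolding flux_def by (intro L2_add L2_cmult W m)
  show "AE x in lebesgue_on {0<..<L}. flux L a g (\<lambda>x. c * S x) (\<lambda>s x. h s * S x) x = (of_real (a_tilde a g) * c + (\<integral>s. h s \<partial>wm)) * C x"
    using W(2) m(2) by eventually_elim (simp add: flux_def distrib_right)
qed

lemma zero_trace_scaled:
  assumes "continuous_on UNIV h" "h 0 = 0"
  shows "zero_trace L (\<lambda>s x. h s * S x)"
  unfolding zero_trace_def
proof (intro exI[of _ "\<lambda>s x. h s * S x"] conjI allI impI)
  show "((\<lambda>r. H10_norm L ((\<lambda>x. h r * S x) - (\<lambda>x. h s * S x))) \<longlongrightarrow> 0) (at s within {0..})" for s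
  proof -
    have "(h \<longlongrightarrow> h s) (at s within {0..})"
      using assms(1) by (meson continuous_on_def continuous_on_subset subset_UNIV UNIV_I tendsto_within_subset)
    then have "((\<lambda>r. cmod (h r - h s) * \<kappa>) \<longlongrightarrow> cmod (h s - h s) * \<kappa>) (at s within {0..})"
      by (intro tendsto_intros)
    then show ?thesis by (simp add: H10_norm_diff_S)
  qed
  show "H10_norm L (\<lambda>x. h 0 * S x) = 0" using repH_norm[OF repH_S, of 0] by (simp add: assms(2))
  show "AE s in lebesgue_on {0<..}. (\<lambda>x. h s * S x) \<in> H10 L \<and> H10_norm L ((\<lambda>x. h s * S x) - (\<lambda>x. h s * S x)) = 0"
    by (simp add: H10_norm_diff_S scaled_S_H10)
qed (rule scaled_S_H10)

end

text \<open>\<open>eq1\<close> and \<open>eq2\<close> are the second and fourth components of the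
  eigenvalue equation for the state (\<alpha> S, \<sigma> \<alpha> S, S, \<sigma> S, hist S). The
  first and third hold by the form of the state, the fifth by that of \<open>hist\<close>.\<close>

locale eigenmode = weighted_sine_mode +
  fixes a :: real and \<alpha> \<sigma> :: complex
  assumes at_pos: "a_tilde a g > 0"
    and exp_int: "integrable wm (\<lambda>s. exp (- \<sigma> * of_real s))"
    and hist_int: "integrable wm (\<lambda>s. (cmod (1 - exp (- \<sigma> * of_real s)))\<^sup>2)"
    and one_int: "integrable wm (\<lambda>s. 1 :: real)"
    and \<sigma>: "\<sigma> \<noteq> 0"
    and eq1: "- (of_real \<mu>)\<^sup>2 * (of_real (a_tilde a g) * \<alpha> + \<alpha> * (\<integral>s. 1 - exp (- \<sigma> * of_real s) \<partial>wm)) - \<sigma> = \<sigma>\<^sup>2 * \<alpha>"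
    and eq2: "- (of_real \<mu>)\<^sup>2 + \<sigma> * \<alpha> = \<sigma>\<^sup>2"
begin

text \<open>The solution of h' = \<sigma> (\<alpha> - h), h(0) = 0, which is the fifth component of
  the eigenvalue equation with v = \<sigma> \<alpha> S.\<close>

definition hist :: "real \<Rightarrow> complex" where "hist s = \<alpha> * (1 - exp (- \<sigma> * of_real s))"

lemma hist_deriv: "((\<lambda>s. z * hist s) has_vector_derivative z * (\<alpha> * \<sigma> * exp (- \<sigma> * of_real s))) (at s)"
proof -
  have "((\<lambda>w. z * (\<alpha> * (1 - exp (- \<sigma> * w)))) has_field_derivative z * (\<alpha> * \<sigma> * exp (- \<sigma> * of_real s))) (at (of_real s))"
    by (auto intro!: derivative_eq_intros)
  then show ?thesis unfolding hist_def by (rule has_vector_derivative_real_field)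
qed

lemma continuous_hist: "continuous_on UNIV (\<lambda>s. z * hist s)" "continuous_on UNIV (\<lambda>s. z * (\<alpha> * \<sigma> * exp (- \<sigma> * of_real s)))"
  unfolding hist_def by (intro continuous_intros)+

lemma hist_measurable: "(\<lambda>s. z * hist s) \<in> borel_measurable wm"
  unfolding borel_measurable_weight by (rule continuous_measurable_lebesgue_on[OF continuous_hist(1)])

lemma hist_integrable: "integrable wm (\<lambda>s. z * hist s)"
proof -
  have "integrable wm (\<lambda>s. complex_of_real 1)" using one_int by (rule integrable_of_real)
  then show ?thesis unfolding hist_def using exp_int by simp
qed

lemma hist_square_integrable: "integrable wm (\<lambda>s. (cmod (z * hist s))\<^sup>2)"
  using hist_int by (simp add: hist_def norm_mult power_mult_distrib)

definition St :: "complex \<Rightarrow> state" where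
  "St z = ((\<lambda>x. z * \<alpha> * S x), (\<lambda>x. z * (\<sigma> * \<alpha>) * S x), (\<lambda>x. z * S x), (\<lambda>x. z * \<sigma> * S x), (\<lambda>s x. (z * hist s) * S x))"

text \<open>Equality with \<open>w\<close> times the eigenvector in the energy space, that is, up to null sets.\<close>
definition represents :: "state \<Rightarrow> complex \<Rightarrow> bool" where
  "represents W w = (case W of (u, v, y, z, \<omega>) \<Rightarrow> repH u (w * \<alpha>) \<and> repL v (w * (\<sigma> * \<alpha>)) \<and> repH y w \<and> repL z (w * \<sigma>)
     \<and> repW \<omega> (\<lambda>s. w * hist s))"

text \<open>The energy norm of \<open>St 1\<close>, with summands in the order u, v, y, z, history.
  All norms below are scalar factors times \<open>Q\<close>.\<close>

definition Q where
  "Q = sqrt (a_tilde a g * (cmod \<alpha> * \<kappa>)\<^sup>2 + (cmod (\<sigma> * \<alpha>) * \<rho>)\<^sup>2 + \<kappa>\<^sup>2 + (cmod \<sigma> * \<rho>)\<^sup>2 + \<kappa>\<^sup>2 * (\<integral>s. (cmod (hist s))\<^sup>2 \<partial>wm))"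

lemma Q_square: "Q\<^sup>2 = a_tilde a g * (cmod \<alpha> * \<kappa>)\<^sup>2 + (cmod (\<sigma> * \<alpha>) * \<rho>)\<^sup>2 + \<kappa>\<^sup>2 + (cmod \<sigma> * \<rho>)\<^sup>2 + \<kappa>\<^sup>2 * (\<integral>s. (cmod (hist s))\<^sup>2 \<partial>wm)"
  unfolding Q_def using at_pos by (intro real_sqrt_pow2 add_nonneg_nonneg mult_nonneg_nonneg) auto

lemma Q_pos: "Q > 0"
proof -
  have "0 < (cmod \<sigma> * \<rho>)\<^sup>2" using \<sigma> \<rho>_pos by simp
  moreover have "0 \<le> a_tilde a g * (cmod \<alpha> * \<kappa>)\<^sup>2" "0 \<le> (cmod (\<sigma> * \<alpha>) * \<rho>)\<^sup>2" "0 \<le> \<kappa>\<^sup>2" "0 \<le> \<kappa>\<^sup>2 * (\<integral>s. (cmod (hist s))\<^sup>2 \<partial>wm)"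
    using at_pos by auto
  ultimately have "0 < a_tilde a g * (cmod \<alpha> * \<kappa>)\<^sup>2 + (cmod (\<sigma> * \<alpha>) * \<rho>)\<^sup>2 + \<kappa>\<^sup>2 + (cmod \<sigma> * \<rho>)\<^sup>2 + \<kappa>\<^sup>2 * (\<integral>s. (cmod (hist s))\<^sup>2 \<partial>wm)"
    by linarith
  then show ?thesis unfolding Q_def by simp
qed

lemma L2_inner_self: "L2_inner L f f = of_real ((L2_norm L f)\<^sup>2)"
proof -
  have "(\<lambda>x. f x * cnj (f x)) = (\<lambda>x. complex_of_real ((cmod (f x))\<^sup>2))"
    by (rule ext) (rule complex_norm_square[symmetric])
  then show ?thesis
    unfolding L2_norm_eq L2_inner_def by (simp only: integral_complex_of_real) simp
qed

text \<open>Stated for anything that represents a multiple of the eigenvector, so that one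
  computation covers the states, their images under \<open>AG\<close> and all differences in the
  definition of a solution.\<close>

lemma HG_norm_represents:
  assumes "represents W w" shows "HG_norm L a g W = cmod w * Q"
proof -
  obtain u v y z \<omega> where W: "W = (u, v, y, z, \<omega>)" by (cases W) auto
  have r: "repH u (w * \<alpha>)" "repL v (w * (\<sigma> * \<alpha>))" "repH y w" "repL z (w * \<sigma>)" "repW \<omega> (\<lambda>s. w * hist s)"
    using assms by (auto simp: represents_def W)
  have i: "(\<integral>s. (L2_norm L (weak_deriv L (\<omega> s)))\<^sup>2 \<partial>wm) = \<kappa>\<^sup>2 * (\<integral>s. (cmod (w * hist s))\<^sup>2 \<partial>wm)"
    using repW_norm_integral[OF r(5) hist_measurable] by (simp add: H10_norm_def)
  have "HG_norm L a g W = sqrt (a_tilde a g * (cmod (w * \<alpha>) * \<kappa>)\<^sup>2 + (cmod (w * (\<sigma> * \<alpha>)) * \<rho>)\<^sup>2 + (cmod w * \<kappa>)\<^sup>2 + (cmod (w * \<sigma>) * \<rho>)\<^sup>2 + \<kappa>\<^sup>2 * (\<integral>s. (cmod (w * hist s))\<^sup>2 \<partial>wm))"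
    unfolding HG_norm_def W HG_inner.simps L2_inner_self integral_complex_of_real i
    using repH_norm[OF r(1)] repL_norm[OF r(2)] repH_norm[OF r(3)] repL_norm[OF r(4)]
    by (simp add: H10_norm_def)
  also have "\<dots> = sqrt ((cmod w)\<^sup>2 * Q\<^sup>2)"
    unfolding Q_square by (simp add: norm_mult power_mult_distrib algebra_simps)
  also have "\<dots> = cmod w * Q" using Q_pos by (simp add: real_sqrt_mult)
  finally show ?thesis .
qed

lemma represents_St: "represents (St z) z"
  using repH_S[of "z * hist _"] unfolding represents_def St_def repW_def by (auto intro: repH_S repL_S)

lemma represents_diff:
  assumes "represents W w" "represents W' w'" shows "represents (W - W') (w - w')"
proof -
  obtain u v y z \<omega> u' v' y' z' \<omega>' where W: "W = (u, v, y, z, \<omega>)" "W' = (u', v', y', z', \<omega>')"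
    by (cases W, cases W') auto
  have "AE s in wm. repH (\<omega> s) (w * hist s)" "AE s in wm. repH (\<omega>' s) (w' * hist s)"
    using assms by (auto simp: W represents_def repW_def)
  then have "AE s in wm. repH ((\<omega> - \<omega>') s) ((w - w') * hist s)"
    by eventually_elim (use repH_diff in \<open>simp add: left_diff_distrib\<close>)
  then show ?thesis
    using assms repH_diff repL_diff by (simp add: W represents_def repW_def left_diff_distrib)
qed

lemma represents_scale:
  assumes "represents W w" shows "represents (scale_state c W) (of_real c * w)"
proof -
  obtain u v y z \<omega> where W: "W = (u, v, y, z, \<omega>)" by (cases W) auto
  have "AE s in wm. repH (\<omega> s) (w * hist s)"
    using assms by (auto simp: W represents_def repW_def)
  then have "AE s in wm. repH (\<lambda>x. of_real c * \<omega> s x) (of_real c * w * hist s)"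
    by eventually_elim (use repH_cmult in \<open>simp add: mult.assoc\<close>)
  then show ?thesis
    using assms repH_cmult repL_cmult unfolding W scale_state_of_real
    by (simp add: represents_def repW_def mult.assoc)
qed

lemma St_domain: "St z \<in> D_AG L a g"
proof -
  have y: "(\<lambda>x. z * S x) \<in> H2 L"
  proof -
    have "weak_deriv L (\<lambda>x. z * S x) \<in> H1 L"
      by (rule C_multiple_H1(1)[where c=z]) (use repH_S[of z] H1D(2) in \<open>auto simp: repH_def\<close>)
    then show ?thesis using repH_S[of z] by (simp add: H2_def repH_def)
  qed
  have f: "flux L a g (\<lambda>x. z * \<alpha> * S x) (\<lambda>s x. (z * hist s) * S x) \<in> H1 L"
    by (rule C_multiple_H1(1)[OF flux_scaled[OF hist_integrable]])
  have \<omega>: "(\<lambda>s x. (z * hist s) * S x) \<in> L2g L g"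
    by (rule scaled_history_L2g[OF hist_measurable hist_square_integrable])
  have e: "(\<lambda>s x. (z * (\<alpha> * \<sigma> * exp (- \<sigma> * of_real s))) * S x) \<in> L2g L g"
  proof (rule scaled_history_L2g)
    show "(\<lambda>s. z * (\<alpha> * \<sigma> * exp (- \<sigma> * of_real s))) \<in> borel_measurable wm"
      unfolding borel_measurable_weight by (rule continuous_measurable_lebesgue_on[OF continuous_hist(2)])
    \<comment> \<open>Square integrability of the exponential e follows from that of the history by
      |e| \<le> 1 + |1 - e|.\<close>
    have "integrable wm (\<lambda>s. (cmod (exp (- \<sigma> * of_real s)))\<^sup>2)"
    proof (rule Bochner_Integration.integrable_bound)
      show "integrable wm (\<lambda>s. 2 + 2 * (cmod (1 - exp (- \<sigma> * of_real s)))\<^sup>2)"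
        using one_int hist_int integrable_mult_right[OF one_int, of 2] by simp
      show "(\<lambda>s. (cmod (exp (- \<sigma> * of_real s)))\<^sup>2) \<in> borel_measurable wm"
        unfolding borel_measurable_weight
        by (intro continuous_measurable_lebesgue_on continuous_intros)
      show "AE s in wm. norm ((cmod (exp (- \<sigma> * of_real s)))\<^sup>2) \<le> norm (2 + 2 * (cmod (1 - exp (- \<sigma> * of_real s)))\<^sup>2)"
      proof (rule AE_I2)
        fix s
        let ?e = "exp (- \<sigma> * of_real s)"
        have "cmod ?e \<le> 1 + cmod (1 - ?e)" using norm_triangle_ineq2[of ?e 1] by (simp add: norm_minus_commute)
        then have "(cmod ?e)\<^sup>2 \<le> (1 + cmod (1 - ?e))\<^sup>2" by (intro power_mono) auto
        also have "\<dots> \<le> 2 + 2 * (cmod (1 - ?e))\<^sup>2"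
          using sum_squares_bound[of 1 "cmod (1 - ?e)"] by (simp add: power2_sum)
        finally show "norm ((cmod ?e)\<^sup>2) \<le> norm (2 + 2 * (cmod (1 - ?e))\<^sup>2)" by simp
      qed
    qed
    then show "integrable wm (\<lambda>s. (cmod (z * (\<alpha> * \<sigma> * exp (- \<sigma> * of_real s))))\<^sup>2)"
      by (simp add: norm_mult power_mult_distrib)
  qed
  have ds: "is_weak_ds L (\<lambda>s x. (z * hist s) * S x) (\<lambda>s x. (z * (\<alpha> * \<sigma> * exp (- \<sigma> * of_real s))) * S x)"
    by (rule weak_ds_scaled[OF hist_deriv continuous_hist(2)])
  have zt: "zero_trace L (\<lambda>s x. (z * hist s) * S x)"
    by (rule zero_trace_scaled[OF continuous_hist(1)]) (simp add: hist_def)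
  have l2: "(\<lambda>x. c * S x) \<in> L2 L" for c by (rule L2_continuous[OF continuous_scaled(2)])
  show ?thesis unfolding D_AG_def St_def HG_def
    using y f \<omega> e ds zt l2 scaled_S_H10 by auto
qed

text \<open>The eigenvector equation up to null sets; equality of functions cannot be expected,
  because \<open>AG\<close> contains chosen weak derivatives.\<close>

lemma AG_St: "represents (AG L a g (St z)) (\<sigma> * z)"
proof -
  let ?\<omega> = "\<lambda>s x. (z * hist s) * S x"
  let ?u = "\<lambda>x. (z * \<alpha>) * S x"
  let ?h' = "\<lambda>s. z * (\<alpha> * \<sigma> * exp (- \<sigma> * of_real s))"
  have "\<exists>\<eta>. \<eta> \<in> L2g L g \<and> is_weak_ds L ?\<omega> \<eta>"
    using St_domain[of z] by (auto simp: D_AG_def St_def)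
  then have "weak_ds L g ?\<omega> \<in> L2g L g \<and> is_weak_ds L ?\<omega> (weak_ds L g ?\<omega>)"
    unfolding weak_ds_def by (rule someI_ex)
  then have "repW (weak_ds L g ?\<omega>) ?h'"
    using weak_ds_unique[OF hist_deriv continuous_hist(2)] by blast
  then have "AE s in wm. repH (weak_ds L g ?\<omega> s) (?h' s)" by (simp add: repW_def)
  then have 5: "repW (\<lambda>s x. - weak_ds L g ?\<omega> s x + z * (\<sigma> * \<alpha>) * S x) (\<lambda>s. \<sigma> * z * hist s)"
    unfolding repW_def
  proof eventually_elim
    case (elim s)
    have "(\<lambda>x. - weak_ds L g ?\<omega> s x + z * (\<sigma> * \<alpha>) * S x) = (\<lambda>x. z * (\<sigma> * \<alpha>) * S x) - weak_ds L g ?\<omega> s"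
      by (simp add: fun_eq_iff)
    \<comment> \<open>This is the differential equation of \<open>hist\<close>, multiplied by
      z.\<close>
    moreover have "z * (\<sigma> * \<alpha>) - ?h' s = \<sigma> * z * hist s" by (simp add: hist_def algebra_simps)
    ultimately show ?case using repH_diff[OF repH_S elim, of "z * (\<sigma> * \<alpha>)"] by simp
  qed
  have hi: "(\<integral>s. z * hist s \<partial>wm) = z * (\<alpha> * (\<integral>s. 1 - exp (- \<sigma> * of_real s) \<partial>wm))"
    by (simp add: hist_def)
  note fl = C_multiple_H1(2)[OF flux_scaled[OF hist_integrable[of z], of a "z * \<alpha>"]]
  have 2: "repL (\<lambda>x. weak_deriv L (flux L a g ?u ?\<omega>) x - z * \<sigma> * S x) (\<sigma> * z * (\<sigma> * \<alpha>))"
  proof -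
    have e: "- (of_real \<mu>)\<^sup>2 * (of_real (a_tilde a g) * (z * \<alpha>) + (\<integral>s. z * hist s \<partial>wm)) - z * \<sigma> = \<sigma> * z * (\<sigma> * \<alpha>)"
    proof -
      have "- (of_real \<mu>)\<^sup>2 * (of_real (a_tilde a g) * (z * \<alpha>) + (\<integral>s. z * hist s \<partial>wm)) - z * \<sigma>
        = z * (- (of_real \<mu>)\<^sup>2 * (of_real (a_tilde a g) * \<alpha> + \<alpha> * (\<integral>s. 1 - exp (- \<sigma> * of_real s) \<partial>wm)) - \<sigma>)"
        unfolding hi by (simp add: algebra_simps)
      also have "\<dots> = \<sigma> * z * (\<sigma> * \<alpha>)" unfolding eq1 by (simp add: power2_eq_square)
      finally show ?thesis .
    qed
    show ?thesis using repL_diff[OF fl repL_S, of "z * \<sigma>"] unfolding e by (simp add: fun_diff_def)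
  qed
  have 4: "repL (\<lambda>x. weak_deriv L (weak_deriv L (\<lambda>x. z * S x)) x + z * (\<sigma> * \<alpha>) * S x) (\<sigma> * z * \<sigma>)"
  proof -
    have "repL (weak_deriv L (weak_deriv L (\<lambda>x. z * S x))) (- (of_real \<mu>)\<^sup>2 * z)"
      by (rule C_multiple_H1(2)) (use repH_S[of z] H1D(2) in \<open>auto simp: repH_def\<close>)
    from repL_diff[OF this repL_S, of "- (z * (\<sigma> * \<alpha>))"]
    have "repL (\<lambda>x. weak_deriv L (weak_deriv L (\<lambda>x. z * S x)) x + z * (\<sigma> * \<alpha>) * S x) (- (of_real \<mu>)\<^sup>2 * z + z * (\<sigma> * \<alpha>))"
      by (simp add: fun_diff_def)
    moreover have "- (of_real \<mu>)\<^sup>2 * z + z * (\<sigma> * \<alpha>) = z * (- (of_real \<mu>)\<^sup>2 + \<sigma> * \<alpha>)" by (simp add: algebra_simps)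
    ultimately show ?thesis unfolding eq2 by (simp add: power2_eq_square mult_ac)
  qed
  have 1: "repH (\<lambda>x. z * (\<sigma> * \<alpha>) * S x) (\<sigma> * z * \<alpha>)" using repH_S[of "z * (\<sigma> * \<alpha>)"] by (simp add: mult_ac)
  have 3: "repH (\<lambda>x. z * \<sigma> * S x) (\<sigma> * z)" using repH_S[of "z * \<sigma>"] by (simp add: mult_ac)
  show ?thesis unfolding represents_def St_def AG.simps prod.case
    by (intro conjI 1 2 3 4 5)
qed

text \<open>By \<open>HG_norm_represents\<close> the limit of the difference quotient and the
  continuity of the derivative reduce to statements about the scalar exponential, multiplied by the
  constant \<open>Q\<close>.\<close>

lemma exp_solution: "is_solution L a g (St 1) (\<lambda>t. St (exp (\<sigma> * of_real t)))"
proof -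
  let ?e = "\<lambda>t::real. exp (\<sigma> * of_real t)"
  have deriv: "(?e has_vector_derivative \<sigma> * ?e t) (at t within {0..})" for t
  proof -
    have "((\<lambda>w. exp (\<sigma> * w)) has_field_derivative \<sigma> * ?e t) (at (of_real t))"
      by (auto intro!: derivative_eq_intros)
    then have "(?e has_vector_derivative \<sigma> * ?e t) (at t)" by (rule has_vector_derivative_real_field)
    then show ?thesis by (rule has_vector_derivative_at_within)
  qed
  have 1: "((\<lambda>r. HG_norm L a g (scale_state (1 / (r - t)) (St (?e r) - St (?e t)) - AG L a g (St (?e t)))) \<longlongrightarrow> 0) (at t within {0..})" for t
  proof -
    let ?d = "\<lambda>r. (1 / norm (r - t)) *\<^sub>R (?e r - (?e t + (r - t) *\<^sub>R (\<sigma> * ?e t)))"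
    have "(?d \<longlongrightarrow> 0) (at t within {0..})"
      using deriv[of t] unfolding has_vector_derivative_def has_derivative_within by blast
    then have "((\<lambda>r. norm (?d r) * Q) \<longlongrightarrow> norm (0::complex) * Q) (at t within {0..})"
      by (intro tendsto_intros)
    \<comment> \<open>The derivative divides by the absolute value of r - t, the definition of a
      solution by r - t itself; under the norm the sign disappears.\<close>
    moreover have "\<forall>\<^sub>F r in at t within {0..}. norm (?d r) * Q = cmod (of_real (1 / (r - t)) * (?e r - ?e t) - \<sigma> * ?e t) * Q"
      unfolding eventually_at_filter
    proof (rule always_eventually, intro allI impI)
      fix r assume "r \<noteq> t"
      then have "of_real (1 / (r - t)) * (?e r - ?e t) - \<sigma> * ?e t = (1 / (r - t)) *\<^sub>R (?e r - (?e t + (r - t) *\<^sub>R (\<sigma> * ?e t)))"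
        by (simp add: scaleR_conv_of_real algebra_simps flip: of_real_diff)
      then show "norm (?d r) * Q = cmod (of_real (1 / (r - t)) * (?e r - ?e t) - \<sigma> * ?e t) * Q"
        by simp
    qed
    ultimately have "((\<lambda>r. cmod (of_real (1 / (r - t)) * (?e r - ?e t) - \<sigma> * ?e t) * Q) \<longlongrightarrow> norm (0::complex) * Q) (at t within {0..})"
      by (rule Lim_transform_eventually)
    moreover have "HG_norm L a g (scale_state (1 / (r - t)) (St (?e r) - St (?e t)) - AG L a g (St (?e t)))
        = cmod (of_real (1 / (r - t)) * (?e r - ?e t) - \<sigma> * ?e t) * Q" for r
      by (intro HG_norm_represents represents_diff represents_scale represents_St AG_St)
    ultimately show ?thesis by simp
  qed
  have 2: "((\<lambda>r. HG_norm L a g (AG L a g (St (?e r)) - AG L a g (St (?e t)))) \<longlongrightarrow> 0) (at t within {0..})" for t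
  proof -
    have "((\<lambda>r. cmod (\<sigma> * ?e r - \<sigma> * ?e t) * Q) \<longlongrightarrow> cmod (\<sigma> * ?e t - \<sigma> * ?e t) * Q) (at t within {0..})"
      by (intro tendsto_intros)
    moreover have "HG_norm L a g (AG L a g (St (?e r)) - AG L a g (St (?e t))) = cmod (\<sigma> * ?e r - \<sigma> * ?e t) * Q" for r
      by (intro HG_norm_represents represents_diff AG_St)
    ultimately show ?thesis by simp
  qed
  show ?thesis unfolding is_solution_def using St_domain 1 2 by simp
qed

lemma graph_norm_St: "graph_norm L a g (St 1) = (1 + cmod \<sigma>) * Q"
  using HG_norm_represents[OF represents_St, of 1] HG_norm_represents[OF AG_St, of 1]
  by (simp add: graph_norm_def algebra_simps)

lemma energy_St: "energy L a g (St z) = 1/2 * (cmod z * Q)\<^sup>2"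
proof -
  have sq: "(\<integral>x. (cmod (f x))\<^sup>2 \<partial>lebesgue_on {0<..<L}) = (L2_norm L f)\<^sup>2" for f
    by (simp add: L2_norm_eq)
  have i: "integrable (lebesgue_on {0<..<L}) (\<lambda>x. (cmod (f x))\<^sup>2)" if "f \<in> L2 L" for f
    using that by (simp add: L2_def)
  have l2: "(\<lambda>x. c * S x) \<in> L2 L" "weak_deriv L (\<lambda>x. c * S x) \<in> L2 L" for c
    using L2_continuous[OF continuous_scaled(2)] repH_S[of c] H1D(2) by (auto simp: repH_def)
  have wd: "L2_norm L (weak_deriv L (\<lambda>x. c * S x)) = cmod c * \<kappa>" for c
    using repH_norm[OF repH_S] by (simp add: H10_norm_def)
  have x: "(\<integral>x. (cmod (z * (\<sigma> * \<alpha>) * S x))\<^sup>2 + a_tilde a g * (cmod (weak_deriv L (\<lambda>x. z * \<alpha> * S x) x))\<^sup>2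
      + (cmod (z * \<sigma> * S x))\<^sup>2 + (cmod (weak_deriv L (\<lambda>x. z * S x) x))\<^sup>2 \<partial>lebesgue_on {0<..<L})
     = (cmod (z * (\<sigma> * \<alpha>)) * \<rho>)\<^sup>2 + a_tilde a g * (cmod (z * \<alpha>) * \<kappa>)\<^sup>2 + (cmod (z * \<sigma>) * \<rho>)\<^sup>2 + (cmod z * \<kappa>)\<^sup>2"
    using i[OF l2(1)[of "z * (\<sigma> * \<alpha>)"]] i[OF l2(2)[of "z * \<alpha>"]] i[OF l2(1)[of "z * \<sigma>"]] i[OF l2(2)[of z]]
    by (simp only: Bochner_Integration.integral_add Bochner_Integration.integrable_add integrable_mult_right
        integral_mult_right_zero sq repL_norm[OF repL_S] wd)
  show ?thesis
    unfolding St_def energy.simps x sq wd power_mult_distrib[of "cmod z" Q] Q_square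
    by (simp add: norm_mult power_mult_distrib algebra_simps)
qed

end

section \<open>The Laplace transform of the memory kernel\<close>

text \<open>Passage to \<open>lborel\<close>, on which the fundamental theorem for improper
  intervals is formulated; continuity on the open half-line supplies Borel measurability.\<close>

lemma lebesgue_on_Ioi_iff:
  fixes f :: "real \<Rightarrow> 'a::euclidean_space"
  assumes "continuous_on {0<..} f"
  shows "integrable (lebesgue_on {0<..}) f \<longleftrightarrow> set_integrable lborel {0<..} f"
    "(\<integral>s. f s \<partial>lebesgue_on {0<..}) = (LBINT s:{0<..}. f s)"
proof -
  have m: "(\<lambda>x. indicat_real {0<..} x *\<^sub>R f x) \<in> borel_measurable lborel"
    using borel_measurable_continuous_on_indicator[OF _ assms] by simp
  show "integrable (lebesgue_on {0<..}) f \<longleftrightarrow> set_integrable lborel {0<..} f"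
    using integrable_completion[OF m] by (simp add: integrable_restrict_space set_integrable_def)
  show "(\<integral>s. f s \<partial>lebesgue_on {0<..}) = (LBINT s:{0<..}. f s)"
    using integral_completion[OF m] by (simp add: integral_restrict_space set_lebesgue_integral_def)
qed

locale memory_kernel =
  fixes g g' :: "real \<Rightarrow> real" and m :: real
  assumes deriv: "\<And>s. s \<ge> 0 \<Longrightarrow> (g has_real_derivative g' s) (at s within {0..})"
    and cont': "continuous_on {0..} g'"
    and pos: "\<And>s. s \<ge> 0 \<Longrightarrow> g s > 0"
    and m: "m > 0"
    and decay: "\<And>s. s \<ge> 0 \<Longrightarrow> g' s \<le> - m * g s"
begin

section \<open>Exponential decay and weighted integrability of the kernel\<close>

lemma deriv_at: "s > 0 \<Longrightarrow> (g has_real_derivative g' s) (at s)"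
  using deriv[of s] by (simp add: at_within_interior[of s "{0..}"])

lemma cont: "continuous_on {0..} g"
  using deriv by (meson DERIV_continuous_on atLeast_iff)

lemma isCont_g: "s > 0 \<Longrightarrow> isCont g s" and isCont_g': "s > 0 \<Longrightarrow> isCont g' s"
  using continuous_on_interior[OF cont] continuous_on_interior[OF cont'] by auto

text \<open>The decay condition says that g(s) e^(m s) has nonpositive derivative.\<close>

lemma exp_decay: assumes "s \<ge> 0" shows "g s \<le> g 0 * exp (- m * s)"
proof -
  have "g s * exp (m * s) \<le> g 0 * exp (m * 0)"
  proof (rule DERIV_nonpos_imp_decreasing_open[OF assms])
    fix x :: real assume x: "0 < x" "x < s"
    have "DERIV (\<lambda>x. g x * exp (m * x)) x :> (g' x + m * g x) * exp (m * x)"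
      using deriv_at[OF x(1)] by (auto intro!: derivative_eq_intros simp: algebra_simps)
    moreover have "(g' x + m * g x) * exp (m * x) \<le> 0"
      using decay[of x] x by (simp add: mult_nonpos_nonneg)
    ultimately show "\<exists>y. DERIV (\<lambda>x. g x * exp (m * x)) x :> y \<and> y \<le> 0" by blast
  next
    show "continuous_on {0..s} (\<lambda>x. g x * exp (m * x))"
      by (intro continuous_intros continuous_on_subset[OF cont]) auto
  qed
  then show ?thesis by (simp add: exp_minus field_simps)
qed

lemma weighted_tendsto_0:
  assumes "\<rho> < m" shows "((\<lambda>s. g s * exp (\<rho> * s)) \<longlongrightarrow> 0) at_top"
proof (rule Lim_null_comparison)
  show "\<forall>\<^sub>F s in at_top. norm (g s * exp (\<rho> * s)) \<le> g 0 * exp (- (m - \<rho>) * s)"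
  proof (rule eventually_at_top_linorderI[of 0])
    fix s :: real assume s: "0 \<le> s"
    have "norm (g s * exp (\<rho> * s)) = g s * exp (\<rho> * s)" using pos[OF s] by simp
    also have "\<dots> \<le> g 0 * exp (- m * s) * exp (\<rho> * s)" by (intro mult_right_mono exp_decay s) simp
    also have "\<dots> = g 0 * exp (- (m - \<rho>) * s)" by (simp add: algebra_simps flip: exp_add)
    finally show "norm (g s * exp (\<rho> * s)) \<le> g 0 * exp (- (m - \<rho>) * s)" .
  qed
  have "filterlim (\<lambda>s. (m - \<rho>) * s) at_top at_top"
    using assms by (intro filterlim_tendsto_pos_mult_at_top[OF tendsto_const _ filterlim_ident]) simp
  then have "((\<lambda>s. exp (- ((m - \<rho>) * s))) \<longlongrightarrow> 0) at_top"
    using filterlim_compose[OF exp_at_bot filterlim_compose[OF filterlim_uminus_at_bot_at_top]] by blast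
  then have "((\<lambda>s. g 0 * exp (- ((m - \<rho>) * s))) \<longlongrightarrow> g 0 * 0) at_top" by (intro tendsto_intros)
  then show "((\<lambda>s. g 0 * exp (- (m - \<rho>) * s)) \<longlongrightarrow> 0) at_top"
    by (simp only: mult_minus_left mult_zero_right)
qed

lemma g_right_0: "(g \<longlongrightarrow> g 0) (at_right 0)"
proof -
  have "(g \<longlongrightarrow> g 0) (at 0 within {0..})" using cont by (simp add: continuous_on_def)
  then show ?thesis by (rule tendsto_within_subset) auto
qed

text \<open>The integrand is the derivative of -g(s) e^(\<rho> s), and the decay condition makes it
  nonnegative for \<rho> < m. The fundamental theorem for nonnegative integrands then delivers
  integrability together with the value.\<close>

lemma weighted_deriv_integrable:
  assumes "\<rho> < m"
  shows "set_integrable lborel {0<..} (\<lambda>s. (- g' s - \<rho> * g s) * exp (\<rho> * s))"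
    "(LBINT s:{0<..}. (- g' s - \<rho> * g s) * exp (\<rho> * s)) = g 0"
proof -
  let ?F = "\<lambda>s. - (g s * exp (\<rho> * s))"
  let ?f = "\<lambda>s. (- g' s - \<rho> * g s) * exp (\<rho> * s)"
  have 1: "DERIV ?F s :> ?f s" if "ereal 0 < ereal s" for s
  proof -
    have "DERIV ?F s :> - (g' s * exp (\<rho> * s) + exp (\<rho> * s) * \<rho> * g s)"
      using deriv_at[of s] that by (auto intro!: derivative_eq_intros)
    then show ?thesis by (simp add: algebra_simps)
  qed
  have 2: "isCont ?f s" if "ereal 0 < ereal s" for s
    using isCont_g isCont_g' that by (intro continuous_intros) auto
  have 3: "AE s in lborel. ereal 0 < ereal s \<longrightarrow> ereal s < \<infinity> \<longrightarrow> 0 \<le> ?f s"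
  proof (rule AE_I2, intro impI)
    fix s assume "ereal 0 < ereal s"
    then have s: "s \<ge> 0" by simp
    have "\<rho> * g s \<le> m * g s" using assms pos[OF s] by simp
    then have "0 \<le> - g' s - \<rho> * g s" using decay[OF s] by linarith
    then show "0 \<le> ?f s" by simp
  qed
  have 4: "((?F \<circ> real_of_ereal) \<longlongrightarrow> - (g 0 * exp (\<rho> * 0))) (at_right (ereal 0))"
    unfolding ereal_tendsto_simps by (intro tendsto_intros g_right_0)
  have 5: "((?F \<circ> real_of_ereal) \<longlongrightarrow> - 0) (at_left \<infinity>)"
    unfolding ereal_tendsto_simps by (intro tendsto_minus weighted_tendsto_0 assms)
  note FTC = interval_integral_FTC_nonneg[OF _ 1 2 3 4 5]
  show "set_integrable lborel {0<..} ?f" using FTC(1) by simp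
  show "(LBINT s:{0<..}. ?f s) = g 0" using FTC(2) by (simp add: interval_lebesgue_integral_def)
qed

lemma continuous_on_Ioi: "continuous_on {0<..} g" "continuous_on {0<..} g'"
  using cont cont' by (auto intro: continuous_on_subset)

text \<open>Multiplied by m - \<rho> > 0, the integrand is dominated by that of
  \<open>weighted_deriv_integrable\<close>, again by the decay condition. Positive \<rho> gives room
  for a strip to the left of the imaginary axis.\<close>

lemma weighted_g_integrable:
  assumes "\<rho> < m" shows "set_integrable lborel {0<..} (\<lambda>s. g s * exp (\<rho> * s))"
proof -
  have "set_integrable lborel {0<..} (\<lambda>s. (m - \<rho>) * (g s * exp (\<rho> * s)))"
  proof (rule set_integrable_bound[OF weighted_deriv_integrable(1)[OF assms]])
    show "set_borel_measurable lborel {0<..} (\<lambda>s. (m - \<rho>) * (g s * exp (\<rho> * s)))"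
      unfolding set_borel_measurable_def measurable_lborel2
      by (intro borel_measurable_continuous_on_indicator continuous_intros continuous_on_Ioi) simp
    show "AE s in lborel. s \<in> {0<..} \<longrightarrow> norm ((m - \<rho>) * (g s * exp (\<rho> * s))) \<le> norm ((- g' s - \<rho> * g s) * exp (\<rho> * s))"
    proof (rule AE_I2, rule impI)
      fix s :: real assume "s \<in> {0<..}"
      then have s: "s \<ge> 0" by simp
      have "(m - \<rho>) * (g s * exp (\<rho> * s)) = ((m - \<rho>) * g s) * exp (\<rho> * s)" by simp
      also have "\<dots> \<le> (- g' s - \<rho> * g s) * exp (\<rho> * s)"
        using decay[OF s] by (intro mult_right_mono) (auto simp: algebra_simps)
      finally have "(m - \<rho>) * (g s * exp (\<rho> * s)) \<le> (- g' s - \<rho> * g s) * exp (\<rho> * s)" .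
      moreover have "0 \<le> (m - \<rho>) * (g s * exp (\<rho> * s))" using assms pos[OF s] by simp
      ultimately show "norm ((m - \<rho>) * (g s * exp (\<rho> * s))) \<le> norm ((- g' s - \<rho> * g s) * exp (\<rho> * s))"
        by (simp only: real_norm_def)
    qed
  qed
  then show ?thesis using assms by simp
qed

section \<open>The transform on a vertical strip\<close>

definition laplace :: "complex \<Rightarrow> complex" where
  "laplace z = (\<integral>s. exp (- z * of_real s) \<partial>weight_measure g)"

lemma g_lebesgue_measurable: "g \<in> borel_measurable (lebesgue_on {0<..})"
proof -
  have "(\<lambda>x. indicat_real {0<..} x *\<^sub>R g x) \<in> borel_measurable lborel"
    using borel_measurable_continuous_on_indicator[OF _ continuous_on_Ioi(1)] by simp
  then have "(\<lambda>x. indicat_real {0<..} x *\<^sub>R g x) \<in> borel_measurable lebesgue" by (rule measurable_completion)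
  then have "(\<lambda>x. indicat_real {0<..} x *\<^sub>R g x) \<in> borel_measurable (lebesgue_on {0<..})"
    by (rule measurable_restrict_space1)
  then show ?thesis by (rule measurable_cong[THEN iffD1, rotated]) (simp add: indicator_def)
qed

lemma weight_iff:
  fixes f :: "real \<Rightarrow> 'a::euclidean_space"
  assumes f: "continuous_on UNIV f"
  shows "integrable (weight_measure g) f \<longleftrightarrow> set_integrable lborel {0<..} (\<lambda>s. g s *\<^sub>R f s)"
    "(\<integral>s. f s \<partial>weight_measure g) = (LBINT s:{0<..}. g s *\<^sub>R f s)"
proof -
  have c: "continuous_on {0<..} (\<lambda>s. g s *\<^sub>R f s)"
    by (intro continuous_intros continuous_on_Ioi continuous_on_subset[OF f]) simp
  have fm: "f \<in> borel_measurable (lebesgue_on {0<..})" by (rule continuous_measurable_lebesgue_on[OF f])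
  have nn: "AE s in lebesgue_on {0<..}. 0 \<le> g s" by (rule AE_I2) (simp add: less_imp_le pos)
  show "integrable (weight_measure g) f \<longleftrightarrow> set_integrable lborel {0<..} (\<lambda>s. g s *\<^sub>R f s)"
    unfolding weight_measure_def integrable_density[OF fm g_lebesgue_measurable nn] by (rule lebesgue_on_Ioi_iff(1)[OF c])
  show "(\<integral>s. f s \<partial>weight_measure g) = (LBINT s:{0<..}. g s *\<^sub>R f s)"
    unfolding weight_measure_def integral_density[OF fm g_lebesgue_measurable nn] by (rule lebesgue_on_Ioi_iff(2)[OF c])
qed

lemma exp_weight_integrable: "\<rho> < m \<Longrightarrow> integrable (weight_measure g) (\<lambda>s. exp (\<rho> * s))"
  using weighted_g_integrable[of \<rho>] by (subst weight_iff) (auto intro!: continuous_intros)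

lemma cexp_weight_measurable: "(\<lambda>s. exp (- z * complex_of_real s)) \<in> borel_measurable (weight_measure g)"
  unfolding borel_measurable_weight by (intro continuous_measurable_lebesgue_on continuous_intros)

lemma cexp_bound: "s > 0 \<Longrightarrow> \<bar>Re z\<bar> \<le> r \<Longrightarrow> cmod (exp (- z * complex_of_real s)) \<le> exp (r * s)"
  by (simp add: norm_exp_eq_Re) (metis abs_le_D2 mult.commute mult_minus_left mult_right_mono less_imp_le)

lemma space_weight: "space (weight_measure g) = {0<..}" by (simp add: weight_measure_def)

lemma cexp_weight_integrable:
  assumes "\<bar>Re z\<bar> < m" shows "integrable (weight_measure g) (\<lambda>s. exp (- z * complex_of_real s))"
proof (rule Bochner_Integration.integrable_bound[OF exp_weight_integrable[OF assms] cexp_weight_measurable], rule AE_I2)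
  fix s assume "s \<in> space (weight_measure g)"
  then show "norm (exp (- z * complex_of_real s)) \<le> norm (exp (\<bar>Re z\<bar> * s))"
    using cexp_bound[of s z "\<bar>Re z\<bar>"] by (simp add: space_weight)
qed

lemma one_weight_integrable: "integrable (weight_measure g) (\<lambda>s. 1::real)"
  using exp_weight_integrable[of 0] m by simp

lemma continuous_on_laplace:
  assumes "r < m" shows "continuous_on {z. \<bar>Re z\<bar> \<le> r} laplace"
  unfolding continuous_on_sequentially comp_def
proof (intro allI ballI impI)
  fix x and z assume z: "z \<in> {z. \<bar>Re z\<bar> \<le> r}" and x: "(\<forall>n. x n \<in> {z. \<bar>Re z\<bar> \<le> r}) \<and> x \<longlonglongrightarrow> z"
  show "(\<lambda>n. laplace (x n)) \<longlonglongrightarrow> laplace z"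
    unfolding laplace_def
  proof (rule integral_dominated_convergence[OF cexp_weight_measurable cexp_weight_measurable exp_weight_integrable[OF assms]])
    show "AE s in weight_measure g. (\<lambda>n. exp (- x n * complex_of_real s)) \<longlonglongrightarrow> exp (- z * complex_of_real s)"
      using x by (intro AE_I2 tendsto_intros) auto
    show "AE s in weight_measure g. cmod (exp (- x n * complex_of_real s)) \<le> exp (r * s)" for n
      using x cexp_bound by (intro AE_I2) (simp add: space_weight)
  qed
qed

text \<open>Integration by parts: z times the transform is g(0) plus the integral of g' e^(-z s).
  Since g' \<le> 0, the modulus of the latter is at most the integral of -g' e^(r s), which is g(0)
  + r times that of g e^(r s); the bound is therefore uniform on the closed strip.\<close>

lemma laplace_bound:
  assumes "r < m" "0 \<le> r"
  obtains K where "\<And>z. \<bar>Re z\<bar> \<le> r \<Longrightarrow> cmod z * cmod (laplace z) \<le> K"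
proof
  define G where "G = (LBINT s:{0<..}. g s * exp (r * s))"
  fix z :: complex assume z: "\<bar>Re z\<bar> \<le> r"
  let ?e = "\<lambda>s. exp (- z * complex_of_real s)"
  have ce: "continuous_on {0<..} ?e" by (intro continuous_intros)
  have c1: "continuous_on {0<..} (\<lambda>s. complex_of_real (g' s))" "continuous_on {0<..} (\<lambda>s. complex_of_real (g s))"
    by (intro continuous_intros continuous_on_Ioi)+
  note W = weighted_deriv_integrable[OF assms(1)] weighted_g_integrable[OF assms(1)]
  \<comment> \<open>The weighted -g' is split into two functions whose integrability is already
    known.\<close>
  have i0: "set_integrable lborel {0<..} (\<lambda>s. (- g' s - r * g s) * exp (r * s) + r * (g s * exp (r * s)))"
    using W by (intro set_integral_add) auto
  have eb: "(LBINT s:{0<..}. (- g' s - r * g s) * exp (r * s) + r * (g s * exp (r * s))) = g 0 + r * G"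
    using W by (subst set_integral_add) (auto simp: G_def)
  have bd: "norm (of_real (g' s) * ?e s) \<le> (- g' s - r * g s) * exp (r * s) + r * (g s * exp (r * s))" if "s > 0" for s
  proof -
    have "0 \<le> m * g s" using pos[of s] m that by simp
    then have "g' s \<le> 0" using decay[of s] that by simp
    then have "norm (of_real (g' s) * ?e s) \<le> - g' s * exp (r * s)"
      unfolding norm_mult norm_of_real using cexp_bound[OF that z] by (intro mult_mono) auto
    then show ?thesis by (simp add: algebra_simps)
  qed
  have i1: "set_integrable lborel {0<..} (\<lambda>s. of_real (g' s) * ?e s)"
  proof (rule set_integrable_bound[OF i0])
    show "set_borel_measurable lborel {0<..} (\<lambda>s. of_real (g' s) * ?e s)"
      unfolding set_borel_measurable_def measurable_lborel2
      by (intro borel_measurable_continuous_on_indicator continuous_on_mult c1 ce) simp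
    show "AE s in lborel. s \<in> {0<..} \<longrightarrow> norm (of_real (g' s) * ?e s) \<le> norm ((- g' s - r * g s) * exp (r * s) + r * (g s * exp (r * s)))"
    proof (rule AE_I2, rule impI)
      fix s :: real assume "s \<in> {0<..}"
      then have "s > 0" by simp
      from order_trans[OF bd[OF this] abs_ge_self]
      show "norm (of_real (g' s) * ?e s) \<le> norm ((- g' s - r * g s) * exp (r * s) + r * (g s * exp (r * s)))"
        by (simp only: real_norm_def)
    qed
  qed
  have n1: "norm (LBINT s:{0<..}. of_real (g' s) * ?e s) \<le> g 0 + r * G"
  proof -
    have "norm (LBINT s:{0<..}. of_real (g' s) * ?e s) \<le> (LBINT s:{0<..}. norm (of_real (g' s) * ?e s))"
      by (rule set_integral_norm_bound[OF i1])
    also have "\<dots> \<le> (LBINT s:{0<..}. (- g' s - r * g s) * exp (r * s) + r * (g s * exp (r * s)))"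
      using bd by (intro set_integral_mono set_integrable_norm i1 i0) auto
    finally show ?thesis unfolding eb .
  qed
  have ez: "continuous_on UNIV ?e" by (intro continuous_intros)
  have "\<bar>Re z\<bar> < m" using z assms by linarith
  note I = cexp_weight_integrable[OF this, unfolded weight_iff(1)[OF ez]]
  have i2: "set_integrable lborel {0<..} (\<lambda>s. of_real (g s) * ?e s)"
    and l2: "laplace z = (LBINT s:{0<..}. of_real (g s) * ?e s)"
    using I weight_iff(2)[OF ez] by (simp_all add: laplace_def scaleR_conv_of_real)
  let ?F = "\<lambda>s. of_real (g s) * ?e s"
  let ?f = "\<lambda>s. of_real (g' s) * ?e s - z * (of_real (g s) * ?e s)"
  \<comment> \<open>The lower end contributes -g(0); at infinity the product is killed by
    \<open>weighted_tendsto_0\<close>.\<close>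
  have "(LBINT s=ereal 0..\<infinity>. ?f s) = 0 - of_real (g 0) * ?e 0"
  proof (rule interval_integral_FTC_integrable)
    show "(?F has_vector_derivative ?f s) (at s)" if "ereal 0 < ereal s" for s
    proof -
      have "(?e has_vector_derivative - z * ?e s) (at s)"
      proof -
        have "((\<lambda>w. exp (- z * w)) has_field_derivative - z * ?e s) (at (of_real s))"
          by (auto intro!: derivative_eq_intros)
        then show ?thesis by (rule has_vector_derivative_real_field)
      qed
      then have "((\<lambda>s. complex_of_real (g s) * ?e s) has_vector_derivative (of_real (g s) * (- z * ?e s) + of_real (g' s) * ?e s)) (at s)"
        if "((\<lambda>s. complex_of_real (g s)) has_vector_derivative of_real (g' s)) (at s)"
        using has_vector_derivative_mult[OF that] by blast
      moreover have "((\<lambda>s. complex_of_real (g s)) has_vector_derivative of_real (g' s)) (at s)"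
        using deriv_at that by (intro has_vector_derivative_of_real) auto
      moreover have "of_real (g s) * (- z * ?e s) + of_real (g' s) * ?e s = ?f s" by (simp add: mult_ac)
      ultimately show ?thesis by metis
    qed
    show "isCont ?f s" if "ereal 0 < ereal s" for s
      using isCont_g isCont_g' that by (intro continuous_intros) auto
    show "set_integrable lborel (einterval (ereal 0) \<infinity>) ?f"
      using i1 i2 by simp
    show "((?F \<circ> real_of_ereal) \<longlongrightarrow> of_real (g 0) * ?e 0) (at_right (ereal 0))"
      unfolding ereal_tendsto_simps by (intro tendsto_intros g_right_0)
    show "((?F \<circ> real_of_ereal) \<longlongrightarrow> 0) (at_left \<infinity>)"
      unfolding ereal_tendsto_simps
    proof (rule Lim_null_comparison[OF _ weighted_tendsto_0[OF assms(1)]])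
      show "\<forall>\<^sub>F s in at_top. norm (?F s) \<le> g s * exp (r * s)"
      proof (rule eventually_at_top_linorderI[of 1])
        fix s :: real assume "1 \<le> s"
        then show "norm (?F s) \<le> g s * exp (r * s)"
          unfolding norm_mult norm_of_real using cexp_bound[OF _ z, of s] pos[of s] by (intro mult_mono) auto
      qed
    qed
  qed simp
  then have "(LBINT s:{0<..}. of_real (g' s) * ?e s) - z * laplace z = - of_real (g 0)"
    using i1 i2 by (simp add: interval_lebesgue_integral_def l2)
  then have e: "z * laplace z = (LBINT s:{0<..}. of_real (g' s) * ?e s) + of_real (g 0)" by (simp add: algebra_simps)
  have "cmod (z * laplace z) \<le> cmod (LBINT s:{0<..}. of_real (g' s) * ?e s) + cmod (of_real (g 0))"
    unfolding e by (rule norm_triangle_ineq)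
  also have "\<dots> \<le> g 0 + r * G + g 0" using n1 pos[of 0] by simp
  finally show "cmod z * cmod (laplace z) \<le> g 0 + r * G + g 0" by (simp add: norm_mult)
qed

end

section \<open>Roots of the characteristic equation\<close>

text \<open>With z^2 = w - \<mu>^2 the equation becomes w (a - 1 - lap z + w / \<mu>^2) = 1 - w /
  \<mu>^2, that is w = T w, where \<open>T\<close> is close to the constant 1 / (a - 1) on a fixed
  ball. Brouwer's theorem asks for continuity alone, so no derivative of \<open>lap\<close> has to
  be estimated.\<close>

lemma high_frequency_root:
  fixes lap :: "complex \<Rightarrow> complex" and a K r :: real
  assumes a: "a \<noteq> 1" and r: "r > 0" and cont: "continuous_on {z. \<bar>Re z\<bar> \<le> r} lap"
    and K: "\<And>z. \<bar>Re z\<bar> \<le> r \<Longrightarrow> cmod z * cmod (lap z) \<le> K"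
  obtains M C where "\<And>\<mu>. \<mu> \<ge> M \<Longrightarrow> \<exists>z. \<bar>Re z\<bar> \<le> r \<and> \<bar>Re z\<bar> * \<mu>\<^sup>2 \<le> C \<and> z \<noteq> 0 \<and> cmod z \<le> 2 * \<mu> \<and>
      (z\<^sup>2 + (of_real \<mu>)\<^sup>2 * (of_real a - lap z)) * (z\<^sup>2 + (of_real \<mu>)\<^sup>2) = - z\<^sup>2"
proof
  define b where "b = a - 1"
  \<comment> \<open>The radius is twice the expected modulus 1 / |b|; with |q| \<le> 3/2 and |d|
    \<ge> 3/4 |b| the ball is mapped into itself.\<close>
  define R where "R = 2 / \<bar>b\<bar>"
  \<comment> \<open>The four bounds serve, in order, \<mu> \<le> \<mu>^2, |w| / \<mu>^2 \<le> 1/2,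
    containment of the root in the strip, and |d - b| \<le> |b| / 4.\<close>
  define M where "M = Max {1, 2 * R, R / r, (8 * K + 4 * R) / \<bar>b\<bar>}"
  define C where "C = (R + R * (2 * K + R)) / \<bar>b\<bar>"
  have b: "\<bar>b\<bar> > 0" and R: "R > 0" "R * \<bar>b\<bar> = 2" using a by (auto simp: b_def R_def)
  have K0: "K \<ge> 0" using K[of 0] r by simp
  fix \<mu> :: real assume "\<mu> \<ge> M"
  then have \<mu>: "\<mu> \<ge> 1" "\<mu> \<ge> 2 * R" "R / r \<le> \<mu>" "(8 * K + 4 * R) / \<bar>b\<bar> \<le> \<mu>"
    by (auto simp: M_def)
  have \<mu>2: "\<mu>\<^sup>2 \<ge> \<mu>" using \<mu>(1) by (simp add: power2_eq_square)
  have R\<mu>: "R / \<mu>\<^sup>2 \<le> R / \<mu>" using \<mu> \<mu>2 R by (intro divide_left_mono) auto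
  have Rhalf: "R / \<mu> \<le> 1 / 2" using \<mu> by (simp add: field_simps)
  define q where "q w = 1 - w / (of_real \<mu>)\<^sup>2" for w :: complex
  \<comment> \<open>The square root of w - \<mu>^2 near i \<mu>. On the ball the real part of
    \<open>q\<close> is at least 1/2, away from the branch cut, so the principal branch is
    continuous.\<close>
  define s where "s w = \<i> * of_real \<mu> * csqrt (q w)" for w
  define d where "d w = of_real b - lap (s w) + w / (of_real \<mu>)\<^sup>2" for w
  define T where "T w = q w / d w" for w
  have nw: "cmod (w / (of_real \<mu>)\<^sup>2) \<le> R / \<mu>\<^sup>2" if "cmod w \<le> R" for w
    using that by (simp add: norm_divide norm_power divide_right_mono)
  have q: "cmod (q w) \<le> 3/2" "Re (q w) \<ge> 1/2" if w: "cmod w \<le> R" for w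
  proof -
    have n: "cmod (w / (of_real \<mu>)\<^sup>2) \<le> 1/2" using nw[OF w] R\<mu> Rhalf by linarith
    show "cmod (q w) \<le> 3/2" using norm_triangle_ineq4[of 1 "w / (of_real \<mu>)\<^sup>2"] n by (simp add: q_def)
    have "Re (q w) = 1 - Re (w / (of_real \<mu>)\<^sup>2)" by (simp add: q_def)
    then show "Re (q w) \<ge> 1/2" using complex_Re_le_cmod[of "w / (of_real \<mu>)\<^sup>2"] n by linarith
  qed
  have c: "Re (csqrt (q w)) \<ge> 1/2" "cmod (csqrt (q w)) \<le> 2" "\<bar>Im (csqrt (q w))\<bar> \<le> \<bar>Im w\<bar> / \<mu>\<^sup>2" if w: "cmod w \<le> R" for w
  proof -
    define p where "p = csqrt (q w)"
    have p: "p\<^sup>2 = q w" by (simp add: p_def)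
    have "Re (q w) = (Re p)\<^sup>2 - (Im p)\<^sup>2" using arg_cong[OF p, of Re] by (simp add: power2_eq_square)
    moreover have "(1/2::real)\<^sup>2 = 1/4" by (simp add: power2_eq_square)
    ultimately have "(1/2)\<^sup>2 \<le> (Re p)\<^sup>2" using q(2)[OF w] zero_le_power2[of "Im p"] by linarith
    moreover have "Re p \<ge> 0" unfolding p_def by (rule Re_csqrt)
    ultimately have 1: "Re p \<ge> 1/2" using power2_le_imp_le by blast
    then show "Re (csqrt (q w)) \<ge> 1/2" by (simp add: p_def)
    have "(cmod p)\<^sup>2 = cmod (q w)" unfolding p[symmetric] norm_power ..
    then have "(cmod p)\<^sup>2 \<le> 2\<^sup>2" using q(1)[OF w] by simp
    then have "cmod p \<le> 2" by (rule power2_le_imp_le) simp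
    then show "cmod (csqrt (q w)) \<le> 2" by (simp add: p_def)
    \<comment> \<open>As Re p \<ge> 1/2, the imaginary part of p, which becomes the real part of the
      root up to the factor -\<mu>, is controlled by that of \<open>q w\<close>.\<close>
    have "Im (q w) = 2 * Re p * Im p" using arg_cong[OF p, of Im] by (simp add: power2_eq_square mult_ac)
    moreover have "Im (q w) = - (Im w / \<mu>\<^sup>2)" by (simp add: q_def flip: of_real_power)
    ultimately have "\<bar>Im w / \<mu>\<^sup>2\<bar> = \<bar>2 * Re p * Im p\<bar>" by linarith
    then have e: "\<bar>Im w\<bar> / \<mu>\<^sup>2 = 2 * Re p * \<bar>Im p\<bar>"
      using 1 by (simp only: abs_mult abs_divide abs_power2)
    have "1 * \<bar>Im p\<bar> \<le> 2 * Re p * \<bar>Im p\<bar>" using 1 by (intro mult_right_mono) auto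
    then show "\<bar>Im (csqrt (q w))\<bar> \<le> \<bar>Im w\<bar> / \<mu>\<^sup>2" unfolding e by (simp add: p_def)
  qed
  have s2: "(s w)\<^sup>2 = w - (of_real \<mu>)\<^sup>2" for w
    using \<mu> by (simp add: s_def q_def power_mult_distrib field_simps)
  have sre: "\<bar>Re (s w)\<bar> \<le> \<bar>Im w\<bar> / \<mu>" if w: "cmod w \<le> R" for w
  proof -
    have "\<bar>Re (s w)\<bar> = \<mu> * \<bar>Im (csqrt (q w))\<bar>" using \<mu> by (simp add: s_def abs_mult)
    also have "\<dots> \<le> \<mu> * (\<bar>Im w\<bar> / \<mu>\<^sup>2)" using c(3)[OF w] \<mu> by (intro mult_left_mono) auto
    also have "\<dots> = \<bar>Im w\<bar> / \<mu>" using \<mu> by (simp add: power2_eq_square)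
    finally show ?thesis .
  qed
  have strip: "\<bar>Re (s w)\<bar> \<le> r" if w: "cmod w \<le> R" for w
  proof -
    have "\<bar>Im w\<bar> / \<mu> \<le> R / \<mu>" using abs_Im_le_cmod[of w] w \<mu> by (intro divide_right_mono) auto
    also have "\<dots> \<le> r" using \<mu> r by (simp add: field_simps)
    finally show ?thesis using sre[OF w] by linarith
  qed
  have snorm: "cmod (s w) \<ge> \<mu> / 2" "cmod (s w) \<le> 2 * \<mu>" if w: "cmod w \<le> R" for w
  proof -
    have "1/2 \<le> cmod (csqrt (q w))" using complex_Re_le_cmod[of "csqrt (q w)"] c(1)[OF w] by linarith
    then have "\<mu> * (1/2) \<le> \<mu> * cmod (csqrt (q w))" using \<mu> by (intro mult_left_mono) auto
    then show "cmod (s w) \<ge> \<mu> / 2" using \<mu> by (simp add: s_def norm_mult)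
    have "\<mu> * cmod (csqrt (q w)) \<le> \<mu> * 2" using \<mu> c(2)[OF w] by (intro mult_left_mono) auto
    then show "cmod (s w) \<le> 2 * \<mu>" using \<mu> by (simp add: s_def norm_mult)
  qed
  have db: "cmod (d w - of_real b) \<le> (2 * K + R) / \<mu>" if w: "cmod w \<le> R" for w
  proof -
    have "\<mu> / 2 * cmod (lap (s w)) \<le> cmod (s w) * cmod (lap (s w))"
      using snorm(1)[OF w] by (intro mult_right_mono) auto
    also have "\<dots> \<le> K" by (rule K[OF strip[OF w]])
    finally have 1: "cmod (lap (s w)) \<le> 2 * K / \<mu>" using \<mu> by (simp add: field_simps)
    have "cmod (d w - of_real b) = cmod (w / (of_real \<mu>)\<^sup>2 - lap (s w))" by (simp add: d_def)
    also have "\<dots> \<le> R / \<mu> + 2 * K / \<mu>"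
      using norm_triangle_ineq4[of "w / (of_real \<mu>)\<^sup>2" "lap (s w)"] nw[OF w] R\<mu> 1 by linarith
    also have "\<dots> = (2 * K + R) / \<mu>" by (simp add: add_divide_distrib)
    finally show ?thesis .
  qed
  have small: "(2 * K + R) / \<mu> \<le> \<bar>b\<bar> / 4" using \<mu> b by (simp add: field_simps)
  have dnorm: "cmod (d w) \<ge> 3/4 * \<bar>b\<bar>" if w: "cmod w \<le> R" for w
  proof -
    have "\<bar>b\<bar> - cmod (d w - of_real b) \<le> cmod (d w)"
      using norm_triangle_ineq2[of "of_real b" "of_real b - d w"] by (simp add: norm_minus_commute)
    then show ?thesis using db[OF w] small by linarith
  qed
  have T_ball: "cmod (T w) \<le> R" if w: "cmod w \<le> R" for w
  proof -
    have "cmod (T w) = cmod (q w) / cmod (d w)" by (simp add: T_def norm_divide)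
    also have "\<dots> \<le> (3/2) / (3/4 * \<bar>b\<bar>)"
      using q(1)[OF w] dnorm[OF w] b by (intro frac_le) auto
    also have "\<dots> = R" using b by (simp add: R_def field_simps)
    finally show ?thesis .
  qed
  have cq: "continuous_on (cball 0 R) q"
    unfolding q_def by (intro continuous_intros) (use \<mu> in auto)
  have "q ` cball 0 R \<subseteq> - \<real>\<^sub>\<le>\<^sub>0"
    using q(2) by (force simp: complex_nonpos_Reals_iff)
  then have "continuous_on (cball 0 R) (\<lambda>w. csqrt (q w))"
    by (rule continuous_on_compose2[OF continuous_on_csqrt cq])
  then have cs: "continuous_on (cball 0 R) s"
    unfolding s_def by (intro continuous_intros)
  have cl: "continuous_on (cball 0 R) (\<lambda>w. lap (s w))"
    by (rule continuous_on_compose2[OF cont cs]) (use strip in auto)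
  have "continuous_on (cball 0 R) T"
    unfolding T_def
  proof (rule continuous_on_divide)
    show "continuous_on (cball 0 R) q" by (rule cq)
    show "continuous_on (cball 0 R) d" unfolding d_def by (intro continuous_intros cl) (use \<mu> in auto)
    show "\<forall>w\<in>cball 0 R. d w \<noteq> 0" using dnorm b by fastforce
  qed
  then obtain w where "w \<in> cball 0 R" and fix': "T w = w"
  proof (rule brouwer_ball[OF R(1)])
    show "T \<in> cball 0 R \<rightarrow> cball 0 R" using T_ball by auto
  qed (rule that)
  then have w: "cmod w \<le> R" by simp
  have dw: "d w \<noteq> 0" using dnorm[OF w] b by auto
  have eq: "w * d w = q w" using fix' dw by (simp add: T_def field_simps)
  \<comment> \<open>Subtracting 1 removes the real leading term of w b, so this modulus bounds |b|
    |Im w|.\<close>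
  have "cmod (w * of_real b - 1) \<le> (R + R * (2 * K + R)) / \<mu>"
  proof -
    have "w * of_real b - 1 = - (w / (of_real \<mu>)\<^sup>2) - w * (d w - of_real b)"
      using eq by (simp add: q_def algebra_simps)
    then have "cmod (w * of_real b - 1) \<le> cmod (w / (of_real \<mu>)\<^sup>2) + cmod w * cmod (d w - of_real b)"
      using norm_triangle_ineq4[of "- (w / (of_real \<mu>)\<^sup>2)" "w * (d w - of_real b)"] by (simp add: norm_mult)
    also have "\<dots> \<le> R / \<mu> + R * ((2 * K + R) / \<mu>)"
      using nw[OF w] R\<mu> db[OF w] w R by (intro add_mono mult_mono) auto
    also have "\<dots> = (R + R * (2 * K + R)) / \<mu>" using \<mu> by (simp add: field_simps)
    finally show ?thesis .
  qed
  moreover have "\<bar>Im w\<bar> * \<bar>b\<bar> \<le> cmod (w * of_real b - 1)"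
    using abs_Im_le_cmod[of "w * of_real b - 1"] by (simp add: abs_mult)
  ultimately have "\<bar>Im w\<bar> * \<bar>b\<bar> \<le> (R + R * (2 * K + R)) / \<mu>" by linarith
  then have imw: "\<bar>Im w\<bar> * \<mu> \<le> C" using b \<mu> by (simp add: C_def field_simps)
  have "\<bar>Re (s w)\<bar> * \<mu>\<^sup>2 \<le> \<bar>Im w\<bar> / \<mu> * \<mu>\<^sup>2" using sre[OF w] by (intro mult_right_mono) auto
  also have "\<dots> = \<bar>Im w\<bar> * \<mu>" using \<mu> by (simp add: power2_eq_square)
  finally have "\<bar>Re (s w)\<bar> * \<mu>\<^sup>2 \<le> C" using imw by linarith
  moreover have "s w \<noteq> 0" using snorm(1)[OF w] \<mu> by auto
  moreover have "((s w)\<^sup>2 + (of_real \<mu>)\<^sup>2 * (of_real a - lap (s w))) * ((s w)\<^sup>2 + (of_real \<mu>)\<^sup>2) = - (s w)\<^sup>2"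
  proof -
    have \<mu>0: "(of_real \<mu> :: complex) \<noteq> 0" using \<mu> by auto
    have "(s w)\<^sup>2 + (of_real \<mu>)\<^sup>2 * (of_real a - lap (s w)) = (of_real \<mu>)\<^sup>2 * d w"
      unfolding s2 d_def b_def using \<mu>0 by (simp add: algebra_simps)
    moreover have "(s w)\<^sup>2 + (of_real \<mu>)\<^sup>2 = w" by (simp add: s2)
    moreover have "(of_real \<mu>)\<^sup>2 * d w * w = - (s w)\<^sup>2"
    proof -
      have "(of_real \<mu>)\<^sup>2 * d w * w = (of_real \<mu>)\<^sup>2 * q w" using eq by (simp add: mult_ac)
      also have "\<dots> = - (s w)\<^sup>2" unfolding s2 q_def using \<mu>0 by (simp add: field_simps)
      finally show ?thesis .
    qed
    ultimately show ?thesis by simp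
  qed
  ultimately show "\<exists>z. \<bar>Re z\<bar> \<le> r \<and> \<bar>Re z\<bar> * \<mu>\<^sup>2 \<le> C \<and> z \<noteq> 0 \<and> cmod z \<le> 2 * \<mu> \<and>
      (z\<^sup>2 + (of_real \<mu>)\<^sup>2 * (of_real a - lap z)) * (z\<^sup>2 + (of_real \<mu>)\<^sup>2) = - z\<^sup>2"
    using strip[OF w] snorm(2)[OF w] by blast
qed

section \<open>Absence of the decay rate\<close>

theorem theorem5p1:
  fixes L a m \<epsilon> :: real and g g' :: "real \<Rightarrow> real"
  assumes "L > 0" and "a > 0"
    and "integrable (lebesgue_on {0..}) g"
    and "\<And>s. s \<ge> 0 \<Longrightarrow> (g has_real_derivative g' s) (at s within {0..})"
    and "continuous_on {0..} g'"
    and "\<And>s. s \<ge> 0 \<Longrightarrow> g s > 0"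
    and "a_tilde a g > 0"
    and "m > 0" and "\<And>s. s \<ge> 0 \<Longrightarrow> g' s \<le> - m * g s"
    and "a \<noteq> 1"
    and "0 < \<epsilon>" and "\<epsilon> < 2"
  shows "\<not> (\<exists>C>0. \<forall>U0\<in>D_AG L a g. \<forall>U. is_solution L a g U0 U \<longrightarrow>
           (\<forall>t>0. energy L a g (U t) \<le> C / t powr (2 / (2 - \<epsilon>)) * (graph_norm L a g U0)\<^sup>2))"
proof
  assume "\<exists>C>0. \<forall>U0\<in>D_AG L a g. \<forall>U. is_solution L a g U0 U \<longrightarrow>
           (\<forall>t>0. energy L a g (U t) \<le> C / t powr (2 / (2 - \<epsilon>)) * (graph_norm L a g U0)\<^sup>2)"
  then obtain C where "C > 0" and C: "\<And>U0 U t. U0 \<in> D_AG L a g \<Longrightarrow> is_solution L a g U0 U \<Longrightarrow> t > 0 \<Longrightarrow>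
      energy L a g (U t) \<le> C / t powr (2 / (2 - \<epsilon>)) * (graph_norm L a g U0)\<^sup>2"
    by blast
  interpret memory_kernel g g' m
    by standard (use assms in auto)
  \<comment> \<open>With |Re z| \<le> m / 4 the squared history grows at most like e^(m s / 2),
    which the kernel absorbs; this is more than the transform itself asks for.\<close>
  define r where "r = m / 4"
  have r: "0 < r" "r < m" using \<open>m > 0\<close> by (auto simp: r_def)
  obtain K where K: "\<And>z. \<bar>Re z\<bar> \<le> r \<Longrightarrow> cmod z * cmod (laplace z) \<le> K"
    using laplace_bound[OF r(2)] r(1) by (metis less_imp_le)
  obtain M B where MB: "\<And>\<mu>. \<mu> \<ge> M \<Longrightarrow> \<exists>z. \<bar>Re z\<bar> \<le> r \<and> \<bar>Re z\<bar> * \<mu>\<^sup>2 \<le> B \<and> z \<noteq> 0 \<and> cmod z \<le> 2 * \<mu> \<and>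
      (z\<^sup>2 + (of_real \<mu>)\<^sup>2 * (of_real a - laplace z)) * (z\<^sup>2 + (of_real \<mu>)\<^sup>2) = - z\<^sup>2"
    using high_frequency_root[OF \<open>a \<noteq> 1\<close> r(1) continuous_on_laplace[OF r(2)] K] by metis
  define p where "p = 2 / (2 - \<epsilon>)"
  have p: "p > 1" using assms by (simp add: p_def)
  \<comment> \<open>The constant part of the history integral restores \<open>a\<close> in front of
    the transform. \<open>a_tilde\<close> integrates over s \<ge> 0 and the weighted measure lives
    on s > 0, which differ by a null set.\<close>
  have mass: "a_tilde a g + (\<integral>s. 1 \<partial>weight_measure g) = a"
  proof -
    have "(\<integral>s. g s \<partial>lebesgue_on {0..}) = (\<integral>s. g s \<partial>lebesgue_on {0<..})"
    proof -
      have "AE s in lebesgue. s \<noteq> (0::real)"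
        using AE_not_in[of "{0::real}" lebesgue] by simp
      then have ae: "AE s in lebesgue. indicat_real {0..} s *\<^sub>R g s = indicat_real {0<..} s *\<^sub>R g s"
        by eventually_elim (auto simp: indicator_def)
      have m1: "(\<lambda>s. indicat_real {0..} s *\<^sub>R g s) \<in> borel_measurable lebesgue"
        using assms(3) by (simp add: integrable_restrict_space borel_measurable_integrable)
      show ?thesis
        using integral_cong_AE[OF m1 borel_measurable_AE[OF m1 ae] ae] by (simp add: integral_restrict_space)
    qed
    moreover have "(\<integral>s. 1 \<partial>weight_measure g) = (\<integral>s. g s \<partial>lebesgue_on {0<..})"
      using weight_iff(2)[of "\<lambda>_. 1::real"] lebesgue_on_Ioi_iff(2)[OF continuous_on_Ioi(1)] by simp
    ultimately show ?thesis by (simp add: a_tilde_def)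
  qed
  \<comment> \<open>A positive lower bound free of \<mu>, against a quantity that tends to 0 as
    \<mu> grows because 1 - p < 0.\<close>
  have key: "exp (- 2 * B) / 2 \<le> 9 * C * (\<mu>\<^sup>2) powr (1 - p)"
    if \<mu>_ge: "\<mu> \<ge> M" "\<mu> \<ge> 1" "sin (\<mu> * L) = 0" for \<mu>
  proof -
    obtain z where z: "\<bar>Re z\<bar> \<le> r" "\<bar>Re z\<bar> * \<mu>\<^sup>2 \<le> B" "z \<noteq> 0" "cmod z \<le> 2 * \<mu>"
      "(z\<^sup>2 + (of_real \<mu>)\<^sup>2 * (of_real a - laplace z)) * (z\<^sup>2 + (of_real \<mu>)\<^sup>2) = - z\<^sup>2"
      using MB[OF \<mu>_ge(1)] by blast
    \<comment> \<open>The ratio of u to y dictated by the y-equation, that is by \<open>eq2\<close>;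
      the u-equation is then the characteristic equation divided by z.\<close>
    define \<alpha> where "\<alpha> = (z\<^sup>2 + (of_real \<mu>)\<^sup>2) / z"
    have zm: "\<bar>Re z\<bar> < m" using z(1) r by linarith
    interpret eigenmode L \<mu> g a \<alpha> z
    proof
      show "integrable (lebesgue_on {0<..}) g"
        using one_weight_integrable weight_iff(1)[of "\<lambda>_. 1::real"] lebesgue_on_Ioi_iff(1)[OF continuous_on_Ioi(1)] by simp
      show "integrable (weight_measure g) (\<lambda>s. exp (- z * complex_of_real s))"
        by (rule cexp_weight_integrable[OF zm])
      show "integrable (weight_measure g) (\<lambda>s. (cmod (1 - exp (- z * complex_of_real s)))\<^sup>2)"
      proof (rule Bochner_Integration.integrable_bound)
        show "integrable (weight_measure g) (\<lambda>s. 2 + 2 * exp (2 * r * s))"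
          using one_weight_integrable exp_weight_integrable[of "2 * r"] integrable_mult_right[OF one_weight_integrable, of 2] \<open>m > 0\<close>
          by (simp add: r_def)
        show "(\<lambda>s. (cmod (1 - exp (- z * complex_of_real s)))\<^sup>2) \<in> borel_measurable (weight_measure g)"
          unfolding borel_measurable_weight
          by (intro continuous_measurable_lebesgue_on continuous_intros)
        show "AE s in weight_measure g. norm ((cmod (1 - exp (- z * complex_of_real s)))\<^sup>2) \<le> norm (2 + 2 * exp (2 * r * s))"
        proof (rule AE_I2)
          fix s assume "s \<in> space (weight_measure g)"
          then have s: "s > 0" by (simp add: space_weight)
          have "cmod (1 - exp (- z * complex_of_real s)) \<le> 1 + exp (r * s)"
            using order_trans[OF norm_triangle_ineq4[of 1 "exp (- z * complex_of_real s)"] add_left_mono[OF cexp_bound[OF s z(1)]]]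
            by (simp only: norm_one)
          then have "(cmod (1 - exp (- z * complex_of_real s)))\<^sup>2 \<le> (1 + exp (r * s))\<^sup>2"
            by (intro power_mono) auto
          also have "\<dots> \<le> 2 + 2 * (exp (r * s))\<^sup>2"
            using sum_squares_bound[of 1 "exp (r * s)"] by (simp add: power2_sum)
          also have "(exp (r * s))\<^sup>2 = exp (2 * r * s)" by (simp add: power2_eq_square mult_ac flip: exp_add)
          finally show "norm ((cmod (1 - exp (- z * complex_of_real s)))\<^sup>2) \<le> norm (2 + 2 * exp (2 * r * s))" by simp
        qed
      qed
      show "- (of_real \<mu>)\<^sup>2 + z * \<alpha> = z\<^sup>2" using z(3) by (simp add: \<alpha>_def)
      show "- (of_real \<mu>)\<^sup>2 * (of_real (a_tilde a g) * \<alpha> + \<alpha> * (\<integral>s. 1 - exp (- z * of_real s) \<partial>weight_measure g)) - z = z\<^sup>2 * \<alpha>"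
      proof -
        define X :: real where "X = (\<integral>s. 1 \<partial>weight_measure g)"
        have X: "(\<integral>s. 1 - exp (- z * of_real s) \<partial>weight_measure g) = of_real X - laplace z"
          using integrable_of_real[OF one_weight_integrable, where 'a=complex] cexp_weight_integrable[OF zm] integral_of_real[OF one_weight_integrable, where 'a=complex]
          unfolding laplace_def X_def by (subst Bochner_Integration.integral_diff) auto
        have "of_real (a_tilde a g) * \<alpha> + \<alpha> * (of_real X - laplace z) = \<alpha> * (of_real (a_tilde a g + X) - laplace z)"
          by (simp add: algebra_simps)
        then have 1: "of_real (a_tilde a g) * \<alpha> + \<alpha> * (\<integral>s. 1 - exp (- z * of_real s) \<partial>weight_measure g) = \<alpha> * (of_real a - laplace z)"
          unfolding X mass[folded X_def] .
        have "z * (\<alpha> * (z\<^sup>2 + (of_real \<mu>)\<^sup>2 * (of_real a - laplace z))) = z * (- z)"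
          using z(5) z(3) by (simp add: \<alpha>_def mult_ac power2_eq_square)
        then have "\<alpha> * (z\<^sup>2 + (of_real \<mu>)\<^sup>2 * (of_real a - laplace z)) = - z" using z(3) by (simp only: mult_cancel_left) simp
        then show ?thesis unfolding 1 by (simp add: algebra_simps)
      qed
    qed (use \<open>L > 0\<close> \<mu>_ge z(3) assms(6,7) one_weight_integrable in auto)
    \<comment> \<open>At this time the factor exp (Re z t) is still bounded below, since |Re z|
      \<mu>^2 \<le> B.\<close>
    define t where "t = \<mu>\<^sup>2"
    have t: "t > 0" using \<mu>_ge by (simp add: t_def)
    have "energy L a g (St (exp (z * of_real t))) \<le> C / t powr p * (graph_norm L a g (St 1))\<^sup>2"
      unfolding p_def by (rule C[OF St_domain exp_solution t])
    then have "1/2 * (exp (Re z * t))\<^sup>2 * Q\<^sup>2 \<le> C / t powr p * (1 + cmod z)\<^sup>2 * Q\<^sup>2"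
      by (simp add: energy_St graph_norm_St power_mult_distrib)
    \<comment> \<open>\<open>Q\<close> depends on \<mu>, but it is a positive factor common to both
      sides.\<close>
    then have 1: "1/2 * (exp (Re z * t))\<^sup>2 \<le> C / t powr p * (1 + cmod z)\<^sup>2"
      by (rule mult_right_le_imp_le) (use Q_pos in simp)
    have "exp (- B) \<le> exp (Re z * t)" 
    proof -
      have "- Re z * t \<le> \<bar>Re z\<bar> * t" using t by (intro mult_right_mono) auto
      then show ?thesis using z(2) by (simp add: t_def)
    qed
    then have "(exp (- B))\<^sup>2 \<le> (exp (Re z * t))\<^sup>2" by (intro power_mono) auto
    then have "exp (- 2 * B) \<le> (exp (Re z * t))\<^sup>2" by (simp add: power2_eq_square flip: exp_add)
    \<comment> \<open>|z| \<le> 2 \<mu> and \<mu> \<ge> 1 give 1 + |z| \<le> 3 \<mu>, whence the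
      factor 9 t: the graph norm costs one power of t, leaving the exponent 1 - p.\<close>
    moreover have "C / t powr p * (1 + cmod z)\<^sup>2 \<le> C / t powr p * (9 * t)"
    proof (rule mult_left_mono)
      have "1 + cmod z \<le> 3 * \<mu>" using z(4) \<mu>_ge(2) by linarith
      then have "(1 + cmod z)\<^sup>2 \<le> (3 * \<mu>)\<^sup>2" by (intro power_mono) auto
      then show "(1 + cmod z)\<^sup>2 \<le> 9 * t" by (simp add: t_def power_mult_distrib)
    qed (use \<open>C > 0\<close> in simp)
    moreover have "C / t powr p * (9 * t) = 9 * C * t powr (1 - p)"
      using t by (simp add: powr_diff)
    ultimately show ?thesis using 1 unfolding t_def by linarith
  qed
  define \<mu> where "\<mu> n = pi / L * real n" for n
  have sin0: "sin (\<mu> n * L) = 0" for n using \<open>L > 0\<close> by (simp add: \<mu>_def)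
  have lim: "filterlim \<mu> at_top sequentially"
    unfolding \<mu>_def using \<open>L > 0\<close>
    by (intro filterlim_tendsto_pos_mult_at_top[OF tendsto_const _ filterlim_real_sequentially]) simp
  then have "filterlim (\<lambda>n. (\<mu> n)\<^sup>2) at_top sequentially"
    by (rule filterlim_pow_at_top[rotated]) simp
  then have "(\<lambda>n. ((\<mu> n)\<^sup>2) powr (1 - p)) \<longlonglongrightarrow> 0"
    using p by (intro tendsto_neg_powr) auto
  then have "(\<lambda>n. 9 * C * ((\<mu> n)\<^sup>2) powr (1 - p)) \<longlonglongrightarrow> 9 * C * 0" by (intro tendsto_intros)
  moreover have "\<forall>\<^sub>F n in sequentially. exp (- 2 * B) / 2 \<le> 9 * C * ((\<mu> n)\<^sup>2) powr (1 - p)"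
    using lim[unfolded filterlim_at_top, rule_format, of "max M 1"]
    by eventually_elim (rule key, auto simp: sin0)
  ultimately have "exp (- 2 * B) / 2 \<le> 9 * C * 0"
    by (rule tendsto_lowerbound) simp
  then show False by (simp add: not_le)
qed

end
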